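(* Let $(A_N)_{N\geq 1}$ and $(B_N)_{N\geq 1}$ be two deterministic sequences of $N\times N$ Hermitian matrices (respectively real symmetric matrices), and let $(v_N)_{N\geq 1}$ be a sequence of unit vectors of $\mathbb{C}^N$ (resp. of $\mathbb{R}^N$). Assume that almost surely, as $N\to\infty$, the following convergences hold in moment: $\mu_{A_N}\to \mu_1$, $\mu_{A_N}^{v_N}\to \nu_1$ and $\mu_{B_N}\to \mu_2$, for some probability measures $\mu_1,\nu_1,\mu_2$ on $\mathbb{R}$. Let $(U_N)_{N\geq 1}$ be a sequence of Haar distributed unitary (resp. orthogonal) random matrices of size $N$. Then there exist unital linear functionals $\tau,\varphi:\mathbb{C}\langle X,Y\rangle\to\mathbb{C}$ such that: (i) for all $P\in \mathbb{C}\langle X,Y\rangle$, $\frac{1}{N}\operatorname{Tr}(P(A_N, U_NB_NU_N^* ))=\tau(P)+o(1)$ almost surely; (ii) for all $P\in \mathbb{C}\langle X,Y\rangle$, $\langle P(A_N, U_NB_NU_N^* )v_N,v_N\rangle=\varphi(P)+o(1)$ almost surely; (iii) the unital subalgebras $\mathbb{C}\langle X\rangle$ and $\mathbb{C}\langle Y\rangle$ are conditionally free with respect to $(\tau,\varphi)$.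
   Context: $\mathbb{C}\langle X,Y\rangle$ denotes the algebra of non-commutative polynomials in two variables. For an $N\times N$ Hermitian matrix $M$, $\mu_M=\frac1N\sum_\lambda\delta_\lambda$ (eigenvalues with multiplicity), and for a unit vector $v$, $\mu_M^v$ is the probability measure with $\int x^kd\mu_M^v=\langle M^kv,v\rangle$ for all $k$. Convergence in moment of $\mu_N$ to $\mu$ means $\int x^kd\mu_N\to\int x^kd\mu$ for all $k\ge0$. Given a unital algebra $\mathcal{A}$ and two unital linear functionals $\tau,\varphi$ on it, unital subalgebras $\mathcal{A}_1,\mathcal{A}_2$ are conditionally free with respect to $(\tau,\varphi)$ if whenever $n>1$, $a_j\in\mathcal{A}_{i_j}$ with $i_1\neq i_2\neq\cdots\neq i_n$ (consecutive indices distinct) and $\tau(a_1)=\cdots=\tau(a_n)=0$, one has $\tau(a_1\cdots a_n)=0$ and $\varphi(a_1\cdots a_n)=\varphi(a_1)\cdots\varphi(a_n)$. *)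

theory Defs
  imports "HOL-Probability.Probability" "Jordan_Normal_Form.Matrix"
begin

definition adj :: "complex mat \<Rightarrow> complex mat" where
  "adj M = transpose_mat (map_mat cnj M)"

definition tr :: "complex mat \<Rightarrow> complex" where
  "tr M = (\<Sum>i<dim_row M. M $$ (i,i))"

definition hermitian_mat :: "nat \<Rightarrow> complex mat \<Rightarrow> bool" where
  "hermitian_mat N M \<longleftrightarrow> M \<in> carrier_mat N N \<and> adj M = M"

definition unitary_mat :: "nat \<Rightarrow> complex mat \<Rightarrow> bool" where
  "unitary_mat N U \<longleftrightarrow> U \<in> carrier_mat N N \<and> U * adj U = 1\<^sub>m N \<and> adj U * U = 1\<^sub>m N"

text \<open>real_case = True: real symmetric / real vectors / orthogonal matrices
 (entries restricted to the reals); real_case = False: complex (Hermitian/unitary) case.\<close>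
definition real_mat :: "complex mat \<Rightarrow> bool" where
  "real_mat M \<longleftrightarrow> (\<forall>i<dim_row M. \<forall>j<dim_col M. M $$ (i,j) \<in> \<real>)"

definition real_vec :: "complex vec \<Rightarrow> bool" where
  "real_vec v \<longleftrightarrow> (\<forall>i<dim_vec v. v $ i \<in> \<real>)"

definition unit_vec :: "nat \<Rightarrow> complex vec \<Rightarrow> bool" where
  "unit_vec N v \<longleftrightarrow> v \<in> carrier_vec N \<and> v \<bullet>c v = 1"

definition entries :: "nat \<Rightarrow> complex mat \<Rightarrow> (nat \<times> nat \<Rightarrow> complex)" where
  "entries N M = restrict (\<lambda>ij. M $$ ij) ({..<N} \<times> {..<N})"

definition mat_space :: "nat \<Rightarrow> (nat \<times> nat \<Rightarrow> complex) measure" where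
  "mat_space N = PiM ({..<N} \<times> {..<N}) (\<lambda>_. borel)"

text \<open>Haar distributed random matrix on U(N) (resp. O(N)): a random unitary (orthogonal)
 matrix whose law is invariant under left multiplication by every fixed unitary
 (orthogonal) matrix; this characterizes the Haar probability measure.\<close>
definition haar_random :: "bool \<Rightarrow> 'w measure \<Rightarrow> nat \<Rightarrow> ('w \<Rightarrow> complex mat) \<Rightarrow> bool" where
  "haar_random real_case M N U \<longleftrightarrow>
     (\<forall>w\<in>space M. unitary_mat N (U w) \<and> (real_case \<longrightarrow> real_mat (U w))) \<and>
     (\<forall>i<N. \<forall>j<N. (\<lambda>w. U w $$ (i,j)) \<in> borel_measurable M) \<and>
     (\<forall>W. unitary_mat N W \<and> (real_case \<longrightarrow> real_mat W) \<longrightarrow>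
        distr M (mat_space N) (\<lambda>w. entries N (W * U w)) = distr M (mat_space N) (\<lambda>w. entries N (U w)))"

text \<open>k-th moment of mu_M = (1/N) sum lambda^k = (1/N) Tr(M^k); k-th moment of mu_M^v = <M^k v, v>.\<close>
definition emp_moment :: "nat \<Rightarrow> complex mat \<Rightarrow> nat \<Rightarrow> complex" where
  "emp_moment N M k = tr (M ^\<^sub>m k) / of_nat N"

definition vec_moment :: "nat \<Rightarrow> complex mat \<Rightarrow> complex vec \<Rightarrow> nat \<Rightarrow> complex" where
  "vec_moment N M v k = ((M ^\<^sub>m k) *\<^sub>v v) \<bullet>c v"

definition real_prob_measure :: "real measure \<Rightarrow> bool" where
  "real_prob_measure \<mu> \<longleftrightarrow> prob_space \<mu> \<and> sets \<mu> = sets borel"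

definition moment_conv :: "(nat \<Rightarrow> nat \<Rightarrow> complex) \<Rightarrow> real measure \<Rightarrow> bool" where
  "moment_conv m \<mu> \<longleftrightarrow> (\<forall>k. integrable \<mu> (\<lambda>x. x ^ k) \<and>
      (\<lambda>N. m N k) \<longlonglongrightarrow> complex_of_real (\<integral>x. x ^ k \<partial>\<mu>))"

text \<open>A word is a bool list: False stands for X, True for Y. A polynomial is a finitely
 supported coefficient function on words.\<close>
type_synonym ncpoly = "bool list \<Rightarrow> complex"

definition is_ncpoly :: "ncpoly \<Rightarrow> bool" where
  "is_ncpoly P \<longleftrightarrow> finite {w. P w \<noteq> 0}"

definition nc_one :: ncpoly where
  "nc_one w = (if w = [] then 1 else 0)"

definition nc_mult :: "ncpoly \<Rightarrow> ncpoly \<Rightarrow> ncpoly" where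
  "nc_mult P Q w = (\<Sum>i\<le>length w. P (take i w) * Q (drop i w))"

definition in_subalg :: "bool \<Rightarrow> ncpoly \<Rightarrow> bool" where
  "in_subalg b P \<longleftrightarrow> is_ncpoly P \<and> (\<forall>w. P w \<noteq> 0 \<longrightarrow> set w \<subseteq> {b})"

definition word_eval :: "nat \<Rightarrow> complex mat \<Rightarrow> complex mat \<Rightarrow> bool list \<Rightarrow> complex mat" where
  "word_eval N A B w = foldr (\<lambda>x M. (if x then B else A) * M) w (1\<^sub>m N)"

definition nc_eval :: "nat \<Rightarrow> complex mat \<Rightarrow> complex mat \<Rightarrow> ncpoly \<Rightarrow> complex mat" where
  "nc_eval N A B P = mat N N (\<lambda>ij. \<Sum>w\<in>{w. P w \<noteq> 0}. P w * word_eval N A B w $$ ij)"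

definition unital_linear_functional :: "(ncpoly \<Rightarrow> complex) \<Rightarrow> bool" where
  "unital_linear_functional f \<longleftrightarrow>
     (\<forall>P Q. is_ncpoly P \<longrightarrow> is_ncpoly Q \<longrightarrow> f (\<lambda>w. P w + Q w) = f P + f Q) \<and>
     (\<forall>c P. is_ncpoly P \<longrightarrow> f (\<lambda>w. c * P w) = c * f P) \<and>
     f nc_one = 1"

definition cond_free :: "(ncpoly \<Rightarrow> complex) \<Rightarrow> (ncpoly \<Rightarrow> complex) \<Rightarrow> bool" where
  "cond_free \<tau> \<phi> \<longleftrightarrow>
     (\<forall>(as :: ncpoly list) (idx :: bool list).
        length as = length idx \<and> length as > 1 \<and>
        (\<forall>j<length as. in_subalg (idx ! j) (as ! j)) \<and>
        (\<forall>j. j + 1 < length idx \<longrightarrow> idx ! j \<noteq> idx ! (j + 1)) \<and>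
        (\<forall>j<length as. \<tau> (as ! j) = 0)
      \<longrightarrow> \<tau> (foldr nc_mult as nc_one) = 0 \<and>
          \<phi> (foldr nc_mult as nc_one) = prod_list (map \<phi> as))"

end

theory Submission
  imports Defs
begin

text \<open>
  Write \<open>q\<^sub>k = U (B\<^sup>k - tr B\<^sup>k / N) U\<^sup>*\<close> and \<open>c\<^sub>k = A\<^sup>k - tr A\<^sup>k / N\<close>. Every alternating product of centered powers,
  tested against the normalized trace or against the vector \<open>v\<close>, is a trace of a word in the \<open>q\<^sub>k\<close>, the \<open>c\<^sub>k\<close> and
  rank one matrices \<open>c\<^sub>k v v\<^sup>* c\<^sub>l\<close> in which no two \<open>q\<close>'s are neighbours. The key estimate is that the expectation of a
  product of unnormalized traces of such words, with \<open>m\<close> letters \<open>q\<close> and \<open>n\<close> letters \<open>c\<close> altogether, is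
  \<open>O(N\<^bsup>(n - m)/2\<^esup>)\<close>. It is proved by induction on \<open>m\<close>, differentiating the Haar invariance along elementary rotations.
  For \<open>m = 0\<close> it holds because every trace is \<open>O(N)\<close> and those with a single letter \<open>c\<close> vanish.
  Applied to fourth moments it gives summable bounds, hence almost sure convergence to \<open>0\<close> of all alternating
  centered products. All other words are reduced to these by induction on the length, and conditional freeness
  follows by multilinearity: both sides of the equation for \<open>\<phi>\<close> are \<open>0\<close>, since \<open>\<tau>\<close> and \<open>\<phi>\<close> agree on polynomials in \<open>Y\<close>.
\<close>

section \<open>Square matrices\<close>

text \<open>Only moments are controlled, not operator norms, so the estimates have to be made on
  traces. In the exponent \<open>(n - m)/2\<close> a letter \<open>c\<close> may cost
  \<open>sqrt N\<close> and a letter \<open>q\<close> must gain \<open>1 / sqrt N\<close>: a loop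
  equation gains \<open>1 / N\<close> and a merger of two \<open>q\<close> loses at most two of
  them, so the balance closes. In an alternating word \<open>n\<close> and \<open>m\<close> differ
  by at most one. For the normalized trace the division by \<open>N\<close> leaves room. In the
  vector case a rank one letter of weight 0 takes the place of one \<open>c\<close>, and the trace
  is of order \<open>1 / sqrt N\<close>; its second moment, of order \<open>1 / N\<close>, would not
  be summable, hence the fourth moments. Products of several traces are unavoidable in the
  induction, since differentiating splits a trace in two and merges different traces. For the
  unitary group the phases 1 and \<open>i\<close> together kill the expected derivative along every
  matrix unit. For the orthogonal group only antisymmetric directions are available; the surviving
  transposed terms force the words to be closed under reversal, hence the involution
  \<open>star\<close> on the letters.\<close>

lemma mult_square_carrier [simp]:
  "X \<in> carrier_mat N N \<Longrightarrow> Y \<in> carrier_mat N N \<Longrightarrow> X * Y \<in> carrier_mat N N"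
  by (rule mult_carrier_mat)

lemma minus_square_carrier [simp]:
  "X \<in> carrier_mat N N \<Longrightarrow> Y \<in> carrier_mat N N \<Longrightarrow> X - Y \<in> carrier_mat N N"
  by (rule minus_carrier_mat)

lemma add_entry: "X \<in> carrier_mat N N \<Longrightarrow> Y \<in> carrier_mat N N \<Longrightarrow> i < N \<Longrightarrow> j < N \<Longrightarrow>
    (X + Y) $$ (i,j) = X $$ (i,j) + Y $$ (i,j)"
  by auto

lemma minus_entry: "X \<in> carrier_mat N N \<Longrightarrow> Y \<in> carrier_mat N N \<Longrightarrow> i < N \<Longrightarrow> j < N \<Longrightarrow>
    (X - Y) $$ (i,j) = X $$ (i,j) - Y $$ (i,j)"
  by auto

lemma mult_entry:
  assumes "X \<in> carrier_mat N N" "Y \<in> carrier_mat N N" "i < N" "j < N"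
  shows "(X * Y) $$ (i,j) = (\<Sum>k<N. X $$ (i,k) * Y $$ (k,j))"
  using assms by (auto simp: scalar_prod_def atLeast0LessThan intro!: sum.cong)

lemma tr_carrier: "X \<in> carrier_mat N N \<Longrightarrow> tr X = (\<Sum>i<N. X $$ (i,i))"
  by (auto simp: tr_def)

lemma tr_mult:
  assumes "X \<in> carrier_mat N N" "Y \<in> carrier_mat N N"
  shows "tr (X * Y) = (\<Sum>i<N. \<Sum>j<N. X $$ (i,j) * Y $$ (j,i))"
proof -
  have "X * Y \<in> carrier_mat N N" using assms by simp
  then show ?thesis using assms by (simp add: tr_carrier[of _ N] mult_entry[of _ N] del: index_mult_mat)
qed

lemma tr_mult_comm:
  assumes "X \<in> carrier_mat N N" "Y \<in> carrier_mat N N"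
  shows "tr (X * Y) = tr (Y * X)"
  unfolding tr_mult[OF assms] tr_mult[OF assms(2,1)]
  by (subst sum.swap) (simp add: mult.commute)

lemma tr_add: "X \<in> carrier_mat N N \<Longrightarrow> Y \<in> carrier_mat N N \<Longrightarrow> tr (X + Y) = tr X + tr Y"
  by (auto simp: tr_def sum.distrib)

lemma tr_minus: "X \<in> carrier_mat N N \<Longrightarrow> Y \<in> carrier_mat N N \<Longrightarrow> tr (X - Y) = tr X - tr Y"
  by (auto simp: tr_def sum_subtractf)

lemma tr_smult: "X \<in> carrier_mat N N \<Longrightarrow> tr (c \<cdot>\<^sub>m X) = c * tr X"
  by (auto simp: tr_def sum_distrib_left)

lemma tr_one: "tr (1\<^sub>m N) = of_nat N"
  by (auto simp: tr_def)

lemma adj_carrier [simp]: "X \<in> carrier_mat N N \<Longrightarrow> adj X \<in> carrier_mat N N"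
  by (auto simp: adj_def)

lemma adj_entry: "X \<in> carrier_mat N N \<Longrightarrow> i < N \<Longrightarrow> j < N \<Longrightarrow> adj X $$ (i,j) = cnj (X $$ (j,i))"
  by (auto simp: adj_def)

lemma adj_adj [simp]: "adj (adj X) = X"
  by (rule eq_matI) (auto simp: adj_def)

lemma adj_one [simp]: "adj (1\<^sub>m N) = 1\<^sub>m N"
  by (rule eq_matI) (auto simp: adj_def)

lemma adj_mult:
  assumes "X \<in> carrier_mat N N" "Y \<in> carrier_mat N N"
  shows "adj (X * Y) = adj Y * adj X"
proof (rule eq_matI)
  fix i j assume "i < dim_row (adj Y * adj X)" "j < dim_col (adj Y * adj X)"
  then have ij: "i < N" "j < N" using assms by (auto simp: adj_def)
  have "X * Y \<in> carrier_mat N N" using assms by simp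
  then show "adj (X * Y) $$ (i,j) = (adj Y * adj X) $$ (i,j)"
    using assms ij
    by (simp add: adj_entry[of _ N] mult_entry[of _ N] mult.commute del: index_mult_mat)
qed (use assms in \<open>auto simp: adj_def\<close>)

lemma adj_minus:
  assumes "X \<in> carrier_mat N N" "Y \<in> carrier_mat N N"
  shows "adj (X - Y) = adj X - adj Y"
  by (rule eq_matI) (use assms in \<open>auto simp: adj_def\<close>)

lemma adj_smult: "adj (c \<cdot>\<^sub>m X) = cnj c \<cdot>\<^sub>m adj X"
  by (rule eq_matI) (auto simp: adj_def)

lemma tr_adj: "X \<in> carrier_mat N N \<Longrightarrow> tr (adj X) = cnj (tr X)"
  by (simp add: tr_carrier[of _ N] adj_entry[of _ N])

lemma real_mat_mult:
  assumes "X \<in> carrier_mat N N" "Y \<in> carrier_mat N N" "real_mat X" "real_mat Y"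
  shows "real_mat (X * Y)"
proof -
  have "(X * Y) $$ (i,j) \<in> \<real>" if "i < N" "j < N" for i j
    unfolding mult_entry[OF assms(1,2) that] using assms that
    by (auto simp: real_mat_def intro!: sum_in_Reals Reals_mult)
  then show ?thesis using assms by (auto simp: real_mat_def simp del: index_mult_mat(1))
qed

lemma real_mat_entry: "real_mat X \<Longrightarrow> X \<in> carrier_mat N N \<Longrightarrow> i < N \<Longrightarrow> j < N \<Longrightarrow> cnj (X $$ (i,j)) = X $$ (i,j)"
  by (auto simp: real_mat_def Reals_cnj_iff)

text \<open>The adjoint of a real matrix is its transpose. This serves the transposed contractions
  of the orthogonal case.\<close>

lemma sum_entries_eq_tr_adj:
  assumes "X \<in> carrier_mat N N" "Y \<in> carrier_mat N N" "real_mat Y"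
  shows "(\<Sum>a<N. \<Sum>b<N. X $$ (a,b) * Y $$ (a,b)) = tr (X * adj Y)"
  using assms by (simp add: tr_mult adj_entry real_mat_entry[of Y N])

section \<open>Words\<close>

text \<open>The letter \<open>(Some k, x)\<close> stands for the product \<open>q k * d x\<close> of a random and a deterministic matrix, the
  letter \<open>(None, x)\<close> for \<open>d x\<close> alone. With this encoding two random matrices are never adjacent in a
  nonempty word, not even cyclically, and this survives all the rewirings below.\<close>

type_synonym 'd word = "(nat option \<times> 'd) list"

fun lev :: "(nat \<Rightarrow> complex mat) \<Rightarrow> ('d \<Rightarrow> complex mat) \<Rightarrow> nat option \<times> 'd \<Rightarrow> complex mat" where
  "lev q d (None, x) = d x"
| "lev q d (Some k, x) = q k * d x"

primrec wev :: "nat \<Rightarrow> (nat \<Rightarrow> complex mat) \<Rightarrow> ('d \<Rightarrow> complex mat) \<Rightarrow> 'd word \<Rightarrow> complex mat" where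
  "wev N q d [] = 1\<^sub>m N"
| "wev N q d (l # w) = lev q d l * wev N q d w"

definition traces :: "nat \<Rightarrow> (nat \<Rightarrow> complex mat) \<Rightarrow> ('d \<Rightarrow> complex mat) \<Rightarrow> 'd word list \<Rightarrow> complex" where
  "traces N q d s = (\<Prod>w\<leftarrow>s. tr (wev N q d w))"

text \<open>Under conjugation by \<open>exp (s H)\<close> the derivative of \<open>q k\<close> at
  \<open>s = 0\<close> is the commutator with \<open>H\<close>; deterministic letters do not
  move.\<close>

fun dlev :: "nat \<Rightarrow> (nat \<Rightarrow> complex mat) \<Rightarrow> ('d \<Rightarrow> complex mat) \<Rightarrow> complex mat \<Rightarrow> nat option \<times> 'd \<Rightarrow> complex mat" where
  "dlev N q d H (None, x) = 0\<^sub>m N N"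
| "dlev N q d H (Some k, x) = (H * q k - q k * H) * d x"

primrec dwev :: "nat \<Rightarrow> (nat \<Rightarrow> complex mat) \<Rightarrow> ('d \<Rightarrow> complex mat) \<Rightarrow> complex mat \<Rightarrow> 'd word \<Rightarrow> complex mat" where
  "dwev N q d H [] = 0\<^sub>m N N"
| "dwev N q d H (l # w) = dlev N q d H l * wev N q d w + lev q d l * dwev N q d H w"

text \<open>The derivation sending \<open>q k\<close> to \<open>[E\<^sub>x\<^sub>y, q k]\<close> and \<open>d x\<close> to \<open>0\<close>: the contribution of position \<open>p\<close> to the
  \<open>(c,e)\<close> entry.\<close>

definition dsplit :: "nat \<Rightarrow> (nat \<Rightarrow> complex mat) \<Rightarrow> ('d \<Rightarrow> complex mat) \<Rightarrow> nat \<Rightarrow> nat \<Rightarrow> 'd word \<Rightarrow> nat \<Rightarrow> nat \<Rightarrow> nat \<Rightarrow> complex" where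
  "dsplit N q d x y w c e p = (case fst (w ! p) of None \<Rightarrow> 0 | Some k \<Rightarrow>
     wev N q d (take p w) $$ (c,x) * wev N q d (drop p w) $$ (y,e) -
     (wev N q d (take p w) * q k) $$ (c,x) * wev N q d ((None, snd (w ! p)) # drop (Suc p) w) $$ (y,e))"

locale word_model =
  fixes N :: nat and q :: "nat \<Rightarrow> complex mat" and d :: "'d \<Rightarrow> complex mat"
  assumes q_carrier [simp]: "q k \<in> carrier_mat N N"
    and d_carrier [simp]: "d x \<in> carrier_mat N N"
begin

abbreviation "wd \<equiv> wev N q d"
abbreviation "trs \<equiv> traces N q d"
abbreviation "dsp \<equiv> dsplit N q d"

lemma lev_carrier [simp]: "lev q d l \<in> carrier_mat N N"
  by (cases "(q, d, l)" rule: lev.cases) auto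

lemma wev_carrier [simp]: "wd w \<in> carrier_mat N N"
  by (induction w) auto

lemma dlev_carrier [simp]: "H \<in> carrier_mat N N \<Longrightarrow> dlev N q d H l \<in> carrier_mat N N"
  by (cases "(N, q, d, H, l)" rule: dlev.cases) auto

lemma dwev_carrier [simp]: "H \<in> carrier_mat N N \<Longrightarrow> dwev N q d H w \<in> carrier_mat N N"
  by (induction w) auto

lemma wev_append: "wd (v @ w) = wd v * wd w"
  by (induction v) (auto simp: assoc_mult_mat[of _ N N _ N _ N] left_mult_one_mat[of _ N N])

lemma tr_wev_rotate: "tr (wd (v @ w)) = tr (wd (w @ v))"
  unfolding wev_append by (rule tr_mult_comm[of _ N]) auto

lemma dsplit_Suc:
  assumes "c < N" "x < N" "e < N" "y < N" "p < length w"
  shows "dsp x y (l # w) c e (Suc p) = (\<Sum>f<N. lev q d l $$ (c,f) * dsp x y w f e p)"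
proof (cases "fst (w ! p)")
  case (Some k)
  have "(lev q d l * wd (take p w) * q k) $$ (c,x) = (lev q d l * (wd (take p w) * q k)) $$ (c,x)"
    by (subst assoc_mult_mat[of _ N N _ N _ N]) auto
  also have "\<dots> = (\<Sum>f<N. lev q d l $$ (c,f) * (wd (take p w) * q k) $$ (f,x))"
    using assms by (intro mult_entry) auto
  finally have 1: "(lev q d l * wd (take p w) * q k) $$ (c,x) =
    (\<Sum>f<N. lev q d l $$ (c,f) * (wd (take p w) * q k) $$ (f,x))" .
  have 2: "(lev q d l * wd (take p w)) $$ (c,x) = (\<Sum>f<N. lev q d l $$ (c,f) * wd (take p w) $$ (f,x))"
    using assms by (intro mult_entry) auto
  show ?thesis
    unfolding dsplit_def using Some
    by (simp add: 1 2 sum_distrib_right sum_distrib_left sum_subtractf right_diff_distrib mult.assoc del: index_mult_mat)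
qed (simp add: dsplit_def)

lemma dlev_entry:
  assumes "H \<in> carrier_mat N N" "c < N" "e < N"
  shows "(dlev N q d H l * wd w) $$ (c,e) = (\<Sum>x<N. \<Sum>y<N. H $$ (x,y) * dsp x y (l # w) c e 0)"
proof (cases l)
  case (Pair o' u)
  show ?thesis
  proof (cases o')
    case None
    then show ?thesis using Pair assms by (simp add: dsplit_def mult_entry[of _ N] del: index_mult_mat)
  next
    case (Some k)
    let ?Z = "d u * wd w"
    have "dlev N q d H l * wd w = H * (q k * d u * wd w) - q k * H * ?Z"
      using assms Pair Some
      by (simp add: minus_mult_distrib_mat[of _ N N _ _ N] assoc_mult_mat[of _ N N _ N _ N])
    then have "(dlev N q d H l * wd w) $$ (c,e) = (H * (q k * d u * wd w)) $$ (c,e) - (q k * H * ?Z) $$ (c,e)"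
      using assms by (simp add: minus_entry[of _ N] del: index_mult_mat index_minus_mat)
    also have "(H * (q k * d u * wd w)) $$ (c,e) = (\<Sum>y<N. H $$ (c,y) * (q k * d u * wd w) $$ (y,e))"
      using assms by (intro mult_entry) auto
    \<comment> \<open>The empty prefix of position 0 is written as an identity matrix, which frees
      the row index of \<open>H\<close>.\<close>
    also have "\<dots> = (\<Sum>x<N. \<Sum>y<N. H $$ (x,y) * ((1\<^sub>m N) $$ (c,x) * (q k * d u * wd w) $$ (y,e)))"
    proof -
      have "(\<Sum>x<N. \<Sum>y<N. H $$ (x,y) * ((1\<^sub>m N) $$ (c,x) * (q k * d u * wd w) $$ (y,e)))
        = (\<Sum>x<N. if x = c then \<Sum>y<N. H $$ (x,y) * (q k * d u * wd w) $$ (y,e) else 0)"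
        using assms by (intro sum.cong) auto
      then show ?thesis using assms by (simp add: sum.delta del: index_mult_mat)
    qed
    also have "(q k * H * ?Z) $$ (c,e) = (\<Sum>y<N. (\<Sum>x<N. q k $$ (c,x) * H $$ (x,y)) * ?Z $$ (y,e))"
      using assms by (subst mult_entry[of _ N]) (auto simp: mult_entry[of _ N] simp del: index_mult_mat intro!: sum.cong)
    also have "\<dots> = (\<Sum>x<N. \<Sum>y<N. H $$ (x,y) * (q k $$ (c,x) * ?Z $$ (y,e)))"
      unfolding sum_distrib_right by (subst sum.swap) (simp add: mult_ac)
    finally show ?thesis
      using Pair Some
      by (simp add: dsplit_def sum_subtractf right_diff_distrib left_mult_one_mat[of _ N N] del: index_mult_mat)
  qed
qed

text \<open>Leibniz rule, expanded linearly in the entries of \<open>H\<close>. Matrix units are not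
  antihermitian, so they cannot be directions of rotation themselves; this expansion reaches them
  through combinations.\<close>

lemma dwev_entry:
  assumes "H \<in> carrier_mat N N" "c < N" "e < N"
  shows "dwev N q d H w $$ (c,e) = (\<Sum>x<N. \<Sum>y<N. H $$ (x,y) * (\<Sum>p<length w. dsp x y w c e p))"
  using assms(2)
proof (induction w arbitrary: c)
  case (Cons l w)
  have "dwev N q d H (l # w) $$ (c,e) = (dlev N q d H l * wd w) $$ (c,e) + (lev q d l * dwev N q d H w) $$ (c,e)"
    using assms Cons.prems by (simp add: add_entry[of _ N] del: index_mult_mat index_add_mat)
  also have "(lev q d l * dwev N q d H w) $$ (c,e) = (\<Sum>f<N. lev q d l $$ (c,f) * dwev N q d H w $$ (f,e))"
    using assms Cons.prems by (intro mult_entry) auto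
  also have "\<dots> = (\<Sum>f<N. lev q d l $$ (c,f) * (\<Sum>x<N. \<Sum>y<N. H $$ (x,y) * (\<Sum>p<length w. dsp x y w f e p)))"
    using Cons.IH by (intro sum.cong) auto
  also have "\<dots> = (\<Sum>x<N. \<Sum>y<N. H $$ (x,y) * (\<Sum>p<length w. (\<Sum>f<N. lev q d l $$ (c,f) * dsp x y w f e p)))"
  proof -
    have "(\<Sum>f<N. lev q d l $$ (c,f) * (\<Sum>x<N. \<Sum>y<N. H $$ (x,y) * (\<Sum>p<length w. dsp x y w f e p)))
      = (\<Sum>f<N. \<Sum>x<N. \<Sum>y<N. \<Sum>p<length w. H $$ (x,y) * (lev q d l $$ (c,f) * dsp x y w f e p))"
      by (simp add: sum_distrib_left mult_ac)
    also have "\<dots> = (\<Sum>x<N. \<Sum>y<N. \<Sum>p<length w. \<Sum>f<N. H $$ (x,y) * (lev q d l $$ (c,f) * dsp x y w f e p))"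
      by (intro trans[OF sum.swap sum.cong[OF refl]] trans[OF sum.swap sum.cong[OF refl]] sum.swap)
    finally show ?thesis by (simp add: sum_distrib_left mult_ac)
  qed
  also have "\<dots> = (\<Sum>x<N. \<Sum>y<N. H $$ (x,y) * (\<Sum>p<length w. dsp x y (l # w) c e (Suc p)))"
    using assms Cons.prems by (intro sum.cong refl arg_cong2[where f = times]) (auto simp: dsplit_Suc)
  finally show ?case
    using assms Cons.prems
    by (simp add: dlev_entry sum.lessThan_Suc_shift distrib_left sum.distrib del: index_mult_mat sum.lessThan_Suc)
qed (use assms in auto)

end

text \<open>\<open>rev_word star u w\<close> encodes the adjoint of the word \<open>(None, u) # w\<close>; its first letter is again of the form
  \<open>(None, _)\<close>, so that a random matrix can be put in front of it by \<open>attach\<close>.\<close>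

primrec rev_word :: "('d \<Rightarrow> 'd) \<Rightarrow> 'd \<Rightarrow> 'd word \<Rightarrow> 'd word" where
  "rev_word star u [] = [(None, star u)]"
| "rev_word star u (l # w) = rev_word star (snd l) w @ [(fst l, star u)]"

definition attach :: "nat \<Rightarrow> 'd word \<Rightarrow> 'd word" where
  "attach k w = (Some k, snd (hd w)) # tl w"

lemma rev_word_nonempty [simp]: "rev_word star u w \<noteq> []"
  by (cases w) auto

lemma fst_hd_rev_word [simp]: "fst (hd (rev_word star u w)) = None"
  by (induction w arbitrary: u) auto

section \<open>Contracted derivatives: traces split and merge\<close>

context word_model
begin

lemma wev_None: "wd ((Some k, u) # w) = q k * wd ((None, u) # w)"
  by (simp add: assoc_mult_mat[of _ N N _ N _ N])

lemma wev_attach: "w \<noteq> [] \<Longrightarrow> fst (hd w) = None \<Longrightarrow> wd (attach k w) = q k * wd w"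
  by (cases w) (auto simp: attach_def assoc_mult_mat[of _ N N _ N _ N])

lemma wev_attach_rev_word: "wd (attach k (rev_word star u w)) = q k * wd (rev_word star u w)"
  by (rule wev_attach) auto

lemma wev_drop:
  "p < length w \<Longrightarrow> fst (w ! p) = Some k \<Longrightarrow>
   wd (drop p w) = q k * wd ((None, snd (w ! p)) # drop (Suc p) w)"
  by (cases "w ! p") (simp add: Cons_nth_drop_Suc[symmetric] wev_None del: wev.simps)

text \<open>The indices of the entry are contracted with those of the direction \<open>E_ab\<close>,
  so prefix and suffix close up into separate traces.\<close>

lemma sum_dsplit_diag:
  assumes "p < length w"
  shows "(\<Sum>a<N. \<Sum>b<N. dsp a b w a b p) = (case fst (w ! p) of None \<Rightarrow> 0 | Some k \<Rightarrow>
    tr (wd (take p w)) * tr (wd (drop p w))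
    - tr (wd (take p w) * q k) * tr (wd ((None, snd (w ! p)) # drop (Suc p) w)))"
proof (cases "fst (w ! p)")
  case (Some k)
  show ?thesis unfolding Some dsplit_def option.case sum_subtractf
    by (simp add: tr_carrier[of _ N] sum_product del: index_mult_mat wev.simps)
qed (simp add: dsplit_def)

lemma sum_trace_dsplit:
  assumes "p < length w" "x < N" "y < N"
  shows "(\<Sum>c<N. dsp x y w c c p) = (case fst (w ! p) of None \<Rightarrow> 0 | Some k \<Rightarrow>
    (wd (drop p w) * wd (take p w)) $$ (y,x)
    - (wd ((None, snd (w ! p)) # drop (Suc p) w) * (wd (take p w) * q k)) $$ (y,x))"
proof (cases "fst (w ! p)")
  case (Some k)
  show ?thesis unfolding Some dsplit_def option.case sum_subtractf using assms
    by (simp add: mult_entry[of _ N, OF wev_carrier wev_carrier]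
        mult_entry[of _ N, OF wev_carrier mult_square_carrier] mult.commute del: index_mult_mat wev.simps)
qed (simp add: dsplit_def)

text \<open>Here the derivative hits a different trace. Contraction with \<open>X\<close> joins the
  two closed words into one; the second word is cut open at position \<open>p\<close>, whence the
  cyclic order of \<open>drop\<close> and \<open>take\<close>.\<close>

lemma sum_mult_trace_dsplit:
  assumes "p < length w" "X \<in> carrier_mat N N"
  shows "(\<Sum>a<N. \<Sum>b<N. X $$ (a,b) * (\<Sum>c<N. dsp a b w c c p)) = (case fst (w ! p) of None \<Rightarrow> 0 | Some k \<Rightarrow>
    tr (X * wd (w ! p # drop (Suc p) w @ take p w))
    - tr (q k * (X * wd ((None, snd (w ! p)) # drop (Suc p) w @ take p w))))"
proof (cases "fst (w ! p)")
  case (Some k)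
  define Y where "Y = wd (drop p w) * wd (take p w)"
  define Z where "Z = wd ((None, snd (w ! p)) # drop (Suc p) w) * (wd (take p w) * q k)"
  have c: "Y \<in> carrier_mat N N" "Z \<in> carrier_mat N N" unfolding Y_def Z_def by auto
  have Y: "Y = wd (w ! p # drop (Suc p) w @ take p w)"
    unfolding Y_def wev_append[symmetric] using assms by (simp add: Cons_nth_drop_Suc del: wev.simps flip: append_Cons)
  have Z: "Z = wd ((None, snd (w ! p)) # drop (Suc p) w @ take p w) * q k"
    unfolding Z_def append_Cons[symmetric] wev_append by (rule assoc_mult_mat[of _ N N _ N _ N, symmetric]) auto
  have "tr (X * Z) = tr (q k * (X * wd ((None, snd (w ! p)) # drop (Suc p) w @ take p w)))"
    unfolding Z using assms
    by (subst tr_mult_comm[of "q k" N]) (auto simp: assoc_mult_mat[of _ N N _ N _ N] simp del: wev.simps)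
  moreover have "(\<Sum>a<N. \<Sum>b<N. X $$ (a,b) * (\<Sum>c<N. dsp a b w c c p)) = (\<Sum>a<N. \<Sum>b<N. X $$ (a,b) * (Y $$ (b,a) - Z $$ (b,a)))"
    using assms Some by (intro sum.cong refl) (auto simp: sum_trace_dsplit Y_def Z_def simp del: index_mult_mat wev.simps)
  ultimately show ?thesis using Some assms c
    by (simp add: tr_mult[of X N] right_diff_distrib sum_subtractf Y del: index_mult_mat wev.simps)
qed (use assms in \<open>simp add: dsplit_def\<close>)

definition dtraces :: "nat \<Rightarrow> nat \<Rightarrow> 'd word list \<Rightarrow> complex" where
  "dtraces x y s = (\<Sum>i<length s. (\<Sum>c<N. \<Sum>p<length (s ! i). dsp x y (s ! i) c c p)
      * trs (take i s @ drop (Suc i) s))"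

text \<open>The Leibniz derivative along \<open>E_xy\<close> of the entry \<open>(a,b)\<close> of
  \<open>w\<close> times the traces in \<open>s\<close>. One entry is left open so that it can be
  contracted with the direction.\<close>

definition dentry :: "'d word \<Rightarrow> 'd word list \<Rightarrow> nat \<Rightarrow> nat \<Rightarrow> nat \<Rightarrow> nat \<Rightarrow> complex" where
  "dentry w s a b x y = (\<Sum>p<length w. dsp x y w a b p) * trs s
      + wd w $$ (a,b) * dtraces x y s"

lemma traces_Cons: "trs (w # s) = tr (wd w) * trs s"
  by (simp add: traces_def)

lemma traces_append: "trs (s @ s') = trs s * trs s'"
  by (simp add: traces_def)

text \<open>The direction is an arbitrary function of \<open>(a,b)\<close>: the identity gives the
  unitary contraction, the swap the orthogonal one.\<close>

lemma sum_mult_dtraces: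
  "(\<Sum>a<N. \<Sum>b<N. X a b * dtraces (f a b) (g a b) s) =
   (\<Sum>i<length s. \<Sum>p<length (s ! i).
     (\<Sum>a<N. \<Sum>b<N. X a b * (\<Sum>c<N. dsp (f a b) (g a b) (s ! i) c c p))
     * trs (take i s @ drop (Suc i) s))"
proof -
  have "(\<Sum>a<N. \<Sum>b<N. X a b * dtraces (f a b) (g a b) s) =
     (\<Sum>a<N. \<Sum>b<N. \<Sum>i<length s. \<Sum>p<length (s ! i). X a b * (\<Sum>c<N. dsp (f a b) (g a b) (s ! i) c c p)
     * trs (take i s @ drop (Suc i) s))"
    unfolding dtraces_def
    by (intro sum.cong refl, simp add: sum_distrib_left sum_distrib_right mult.assoc)
       (intro sum.cong refl sum.swap)
  also have "\<dots> = (\<Sum>i<length s. \<Sum>a<N. \<Sum>b<N. \<Sum>p<length (s ! i). X a b * (\<Sum>c<N. dsp (f a b) (g a b) (s ! i) c c p)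
     * trs (take i s @ drop (Suc i) s))"
    by (subst (2) sum.swap, subst sum.swap) simp
  also have "\<dots> = (\<Sum>i<length s. \<Sum>p<length (s ! i). \<Sum>a<N. \<Sum>b<N. X a b * (\<Sum>c<N. dsp (f a b) (g a b) (s ! i) c c p)
     * trs (take i s @ drop (Suc i) s))"
    by (rule sum.cong[OF refl], subst (2) sum.swap, subst sum.swap) simp
  finally show ?thesis by (simp add: sum_distrib_right)
qed

lemma sum_dentry:
  "(\<Sum>a<N. \<Sum>b<N. dentry w s a b (f a b) (g a b)) =
   (\<Sum>p<length w. (\<Sum>a<N. \<Sum>b<N. dsp (f a b) (g a b) w a b p)) * trs s
   + (\<Sum>a<N. \<Sum>b<N. wd w $$ (a,b) * dtraces (f a b) (g a b) s)"
proof -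
  have "(\<Sum>a<N. \<Sum>b<N. \<Sum>p<length w. dsp (f a b) (g a b) w a b p) =
     (\<Sum>p<length w. \<Sum>a<N. \<Sum>b<N. dsp (f a b) (g a b) w a b p)"
    by (subst (2) sum.swap, subst sum.swap) simp
  then show ?thesis
    unfolding dentry_def sum.distrib by (simp flip: sum_distrib_right)
qed

text \<open>The factor \<open>N\<close> comes from the first letter: its empty prefix closes to the
  trace of the identity, and the other half of its commutator contains \<open>tr (q k0) = 0\<close>.
  Later positions of \<open>w\<close> split the word, positions in \<open>s\<close> merge another
  trace into it; in each case one half of the commutator rewires and the other puts two random
  letters side by side.\<close>

lemma loop_unitary:
  assumes "tr (q k0) = 0" and w: "w = (Some k0, u0) # R"
  shows "(\<Sum>a<N. \<Sum>b<N. dentry w s a b a b) = of_nat N * trs (w # s)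
   + (\<Sum>p<length R. case fst (R ! p) of None \<Rightarrow> 0 | Some k \<Rightarrow>
        trs (take (Suc p) w # drop (Suc p) w # s)
        - tr (q k * wd (take (Suc p) w)) * trs (((None, snd (R ! p)) # drop (Suc p) R) # s))
   + (\<Sum>i<length s. \<Sum>p<length (s ! i). case fst (s ! i ! p) of None \<Rightarrow> 0 | Some k \<Rightarrow>
        trs ((w @ s ! i ! p # drop (Suc p) (s ! i) @ take p (s ! i)) # take i s @ drop (Suc i) s)
        - tr (q k * wd (w @ (None, snd (s ! i ! p)) # drop (Suc p) (s ! i) @ take p (s ! i)))
          * trs (take i s @ drop (Suc i) s))"
proof -
  have 1: "(\<Sum>p<length w. (\<Sum>a<N. \<Sum>b<N. dsp a b w a b p)) = of_nat N * tr (wd w) +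
    (\<Sum>p<length R. case fst (R ! p) of None \<Rightarrow> 0 | Some k \<Rightarrow>
        tr (wd (take (Suc p) w)) * tr (wd (drop (Suc p) w))
        - tr (q k * wd (take (Suc p) w)) * tr (wd ((None, snd (R ! p)) # drop (Suc p) R)))"
  proof -
    have "(\<Sum>p<length w. (\<Sum>a<N. \<Sum>b<N. dsp a b w a b p)) =
      (\<Sum>a<N. \<Sum>b<N. dsp a b w a b 0) + (\<Sum>p<length R. (\<Sum>a<N. \<Sum>b<N. dsp a b w a b (Suc p)))"
      by (simp add: w sum.lessThan_Suc_shift del: sum.lessThan_Suc)
    also have "(\<Sum>a<N. \<Sum>b<N. dsp a b w a b 0) = of_nat N * tr (wd w)"
      using assms by (subst sum_dsplit_diag) (auto simp: tr_one left_mult_one_mat[of _ N N] simp del: wev.simps(2))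
    also have "(\<Sum>p<length R. (\<Sum>a<N. \<Sum>b<N. dsp a b w a b (Suc p))) =
      (\<Sum>p<length R. case fst (R ! p) of None \<Rightarrow> 0 | Some k \<Rightarrow>
        tr (wd (take (Suc p) w)) * tr (wd (drop (Suc p) w))
        - tr (q k * wd (take (Suc p) w)) * tr (wd ((None, snd (R ! p)) # drop (Suc p) R)))"
      by (intro sum.cong refl, subst sum_dsplit_diag)
        (auto simp: w tr_mult_comm[of "q _" N, OF q_carrier mult_square_carrier[OF lev_carrier wev_carrier]] simp del: lev.simps split: option.splits)
    finally show ?thesis .
  qed
  have 2: "(\<Sum>a<N. \<Sum>b<N. wd w $$ (a,b) * dtraces a b s) =
     (\<Sum>i<length s. \<Sum>p<length (s ! i). case fst (s ! i ! p) of None \<Rightarrow> 0 | Some k \<Rightarrow>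
        trs ((w @ s ! i ! p # drop (Suc p) (s ! i) @ take p (s ! i)) # take i s @ drop (Suc i) s)
        - tr (q k * wd (w @ (None, snd (s ! i ! p)) # drop (Suc p) (s ! i) @ take p (s ! i)))
          * trs (take i s @ drop (Suc i) s))"
    unfolding sum_mult_dtraces
    by (intro sum.cong refl, subst sum_mult_trace_dsplit)
      (auto simp: traces_Cons wev_append left_diff_distrib simp del: wev.simps split: option.splits)
  show ?thesis
    unfolding sum_dentry 1 2
    by (simp add: traces_Cons distrib_right sum_distrib_right mult.assoc del: wev.simps)
       (intro sum.cong refl, auto simp: traces_Cons left_diff_distrib split: option.splits simp del: wev.simps)
qed

end

section \<open>Adjoints of words and the transposed contractions\<close>

locale herm_word_model = word_model N q d for N q and d :: "'d \<Rightarrow> complex mat" +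
  fixes star :: "'d \<Rightarrow> 'd"
  assumes adj_q [simp]: "adj (q k) = q k" and adj_d [simp]: "adj (d x) = d (star x)"
begin

text \<open>In the adjoint of \<open>d u * q k * d u'\<close> the letter \<open>q k\<close> stands
  in front of \<open>d (star u)\<close>. Each random letter thus changes its partner, and the last
  deterministic letter comes first, without a partner.\<close>

lemma adj_wev: "adj (wd ((None, u) # w)) = wd (rev_word star u w)"
proof (induction w arbitrary: u)
  case Nil
  then show ?case by (simp add: right_mult_one_mat[of _ N N])
next
  case (Cons l w)
  obtain o' u' where l: "l = (o', u')" by force
  let ?W = "wd ((None, u') # w)"
  have W: "?W \<in> carrier_mat N N" by simp
  have "adj (wd ((None, u) # l # w)) = adj (wd (l # w)) * d (star u)"
    by (simp add: adj_mult[of _ N])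
  also have "adj (wd (l # w)) * d (star u) = adj ?W * lev q d (o', star u)"
  proof (cases o')
    case (Some k)
    then have "wd (l # w) = q k * ?W" using l wev_None by simp
    then show ?thesis using Some by (simp add: adj_mult[OF q_carrier W] assoc_mult_mat[of _ N N _ N _ N] del: wev.simps)
  qed (simp add: l)
  finally show ?case
    by (simp add: l Cons wev_append right_mult_one_mat[of _ N N] del: wev.simps(2))
       (simp add: right_mult_one_mat[of _ N N])
qed

lemma tr_mult_adj_wev_drop:
  assumes "X \<in> carrier_mat N N" 
  shows "tr (X * adj (q k * wd ((None, u) # w))) = tr (q k * (X * wd (rev_word star u w)))"
    and "tr (X * q k * adj (wd ((None, u) # w))) = tr (X * wd (attach k (rev_word star u w)))"
    and "tr (X * adj (wd ((None, u) # w) * q k)) = tr (X * wd (attach k (rev_word star u w)))"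
  using assms
  by (simp_all add: adj_mult[OF q_carrier wev_carrier] adj_mult[OF wev_carrier q_carrier] adj_wev wev_attach_rev_word
    assoc_mult_mat[of _ N N _ N _ N] tr_mult_comm[of "q k" N, OF q_carrier mult_square_carrier[OF assms wev_carrier]] del: wev.simps)

end

locale real_word_model = herm_word_model +
  assumes real_q: "real_mat (q k)" and real_d: "real_mat (d x)"
begin

lemma real_lev: "real_mat (lev q d l)"
  by (cases "(q, d, l)" rule: lev.cases) (auto simp: real_q real_d intro!: real_mat_mult[of _ N])

lemma real_wev: "real_mat (wd w)"
  by (induction w) (auto intro!: real_mat_mult[of _ N] simp: real_lev, simp add: real_mat_def)

text \<open>With the direction transposed, prefix and suffix do not close separately: the suffix is
  attached to the prefix after transposition. All matrices being real, its transpose is its adjoint,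
  encoded by \<open>rev_word\<close>.\<close>

lemma sum_dsplit_antidiag:
  assumes "p < length w"
  shows "(\<Sum>a<N. \<Sum>b<N. dsp b a w a b p) = (case fst (w ! p) of None \<Rightarrow> 0 | Some k \<Rightarrow>
    tr (q k * (wd (take p w) * wd (rev_word star (snd (w ! p)) (drop (Suc p) w))))
    - tr (wd (take p w @ attach k (rev_word star (snd (w ! p)) (drop (Suc p) w)))))"
proof (cases "fst (w ! p)")
  case (Some k)
  have "(\<Sum>a<N. \<Sum>b<N. dsp b a w a b p) =
    tr (wd (take p w) * adj (wd (drop p w)))
    - tr (wd (take p w) * q k * adj (wd ((None, snd (w ! p)) # drop (Suc p) w)))"
    unfolding Some dsplit_def option.case sum_subtractf
    by (subst (1 2) sum_entries_eq_tr_adj[of _ N]) (auto simp: real_wev simp del: wev.simps)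
  then show ?thesis
    using Some wev_drop[OF assms Some] tr_mult_adj_wev_drop[OF wev_carrier] by (simp add: wev_append del: wev.simps)
qed (simp add: dsplit_def)

lemma sum_mult_trace_dsplit_swap:
  assumes "p < length w" "X \<in> carrier_mat N N"
  shows "(\<Sum>a<N. \<Sum>b<N. X $$ (a,b) * (\<Sum>c<N. dsp b a w c c p)) = (case fst (w ! p) of None \<Rightarrow> 0 | Some k \<Rightarrow>
    tr (q k * (X * wd (rev_word star (snd (w ! p)) (drop (Suc p) w @ take p w))))
    - tr (X * wd (attach k (rev_word star (snd (w ! p)) (drop (Suc p) w @ take p w)))))"
proof (cases "fst (w ! p)")
  case (Some k)
  define V where "V = wd ((None, snd (w ! p)) # drop (Suc p) w @ take p w)"
  have Vc: "V \<in> carrier_mat N N" unfolding V_def by simp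
  have V: "V = wd ((None, snd (w ! p)) # drop (Suc p) w) * wd (take p w)"
    unfolding V_def by (simp only: wev_append flip: append_Cons)
  define Y where "Y = wd (drop p w) * wd (take p w)"
  define Z where "Z = wd ((None, snd (w ! p)) # drop (Suc p) w) * (wd (take p w) * q k)"
  have Y: "Y = q k * V"
    unfolding Y_def V wev_drop[OF assms(1) Some] by (rule assoc_mult_mat[of _ N N _ N _ N]) auto
  have Z: "Z = V * q k"
    unfolding Z_def V by (rule assoc_mult_mat[of _ N N _ N _ N, symmetric]) auto
  have V_real: "real_mat V" unfolding V_def by (rule real_wev)
  have r: "real_mat Y" "real_mat Z" unfolding Y Z using Vc V_real by (auto intro!: real_mat_mult[of _ N] simp: real_q)
  have c: "Y \<in> carrier_mat N N" "Z \<in> carrier_mat N N" unfolding Y Z using Vc by auto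
  have "(\<Sum>a<N. \<Sum>b<N. X $$ (a,b) * (\<Sum>c<N. dsp b a w c c p)) = (\<Sum>a<N. \<Sum>b<N. X $$ (a,b) * (Y $$ (a,b) - Z $$ (a,b)))"
    using assms Some by (intro sum.cong refl) (auto simp: sum_trace_dsplit Y_def Z_def simp del: index_mult_mat wev.simps)
  also have "\<dots> = tr (X * adj Y) - tr (X * adj Z)"
    unfolding sum_entries_eq_tr_adj[OF assms(2) c(1) r(1), symmetric] sum_entries_eq_tr_adj[OF assms(2) c(2) r(2), symmetric]
    by (simp add: right_diff_distrib sum_subtractf)
  finally show ?thesis using Some tr_mult_adj_wev_drop[OF assms(2)]
    unfolding Y Z V_def by (simp del: wev.simps)
qed (use assms in \<open>simp add: dsplit_def\<close>)

text \<open>No term of order \<open>N\<close> arises: at the first letter both halves of the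
  commutator give the same trace and cancel. Elsewhere one half reverses a segment and keeps all
  letters, the other puts two random letters side by side.\<close>

lemma loop_orthogonal:
  assumes w: "w = (Some k0, u0) # R"
  shows "(\<Sum>a<N. \<Sum>b<N. dentry w s a b b a) =
   (\<Sum>p<length R. case fst (R ! p) of None \<Rightarrow> 0 | Some k \<Rightarrow>
        tr (q k * wd (take (Suc p) w @ rev_word star (snd (R ! p)) (drop (Suc p) R))) * trs s
        - trs ((take (Suc p) w @ attach k (rev_word star (snd (R ! p)) (drop (Suc p) R))) # s))
   + (\<Sum>i<length s. \<Sum>p<length (s ! i). case fst (s ! i ! p) of None \<Rightarrow> 0 | Some k \<Rightarrow>
        tr (q k * wd (w @ rev_word star (snd (s ! i ! p)) (drop (Suc p) (s ! i) @ take p (s ! i))))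
          * trs (take i s @ drop (Suc i) s)
        - trs ((w @ attach k (rev_word star (snd (s ! i ! p)) (drop (Suc p) (s ! i) @ take p (s ! i)))) # take i s @ drop (Suc i) s))"
proof -
  have 1: "(\<Sum>p<length w. (\<Sum>a<N. \<Sum>b<N. dsp b a w a b p)) =
    (\<Sum>p<length R. case fst (R ! p) of None \<Rightarrow> 0 | Some k \<Rightarrow>
        tr (q k * wd (take (Suc p) w @ rev_word star (snd (R ! p)) (drop (Suc p) R)))
        - tr (wd (take (Suc p) w @ attach k (rev_word star (snd (R ! p)) (drop (Suc p) R)))))"
  proof -
    have "(\<Sum>p<length w. (\<Sum>a<N. \<Sum>b<N. dsp b a w a b p)) =
      (\<Sum>a<N. \<Sum>b<N. dsp b a w a b 0) + (\<Sum>p<length R. (\<Sum>a<N. \<Sum>b<N. dsp b a w a b (Suc p)))"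
      by (simp add: w sum.lessThan_Suc_shift del: sum.lessThan_Suc)
    also have "(\<Sum>a<N. \<Sum>b<N. dsp b a w a b 0) = 0"
      by (subst sum_dsplit_antidiag) (auto simp: w left_mult_one_mat[of _ N N] wev_attach_rev_word simp del: wev.simps(2))
    also have "(\<Sum>p<length R. (\<Sum>a<N. \<Sum>b<N. dsp b a w a b (Suc p))) =
      (\<Sum>p<length R. case fst (R ! p) of None \<Rightarrow> 0 | Some k \<Rightarrow>
        tr (q k * wd (take (Suc p) w @ rev_word star (snd (R ! p)) (drop (Suc p) R)))
        - tr (wd (take (Suc p) w @ attach k (rev_word star (snd (R ! p)) (drop (Suc p) R)))))"
      by (intro sum.cong refl, subst sum_dsplit_antidiag)
        (auto simp: w wev_append assoc_mult_mat[of _ N N _ N _ N] simp del: lev.simps split: option.splits)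
    finally show ?thesis by simp
  qed
  have 2: "(\<Sum>a<N. \<Sum>b<N. wd w $$ (a,b) * dtraces b a s) =
     (\<Sum>i<length s. \<Sum>p<length (s ! i). case fst (s ! i ! p) of None \<Rightarrow> 0 | Some k \<Rightarrow>
        tr (q k * wd (w @ rev_word star (snd (s ! i ! p)) (drop (Suc p) (s ! i) @ take p (s ! i))))
          * trs (take i s @ drop (Suc i) s)
        - trs ((w @ attach k (rev_word star (snd (s ! i ! p)) (drop (Suc p) (s ! i) @ take p (s ! i)))) # take i s @ drop (Suc i) s))"
    unfolding sum_mult_dtraces
    by (intro sum.cong refl, subst sum_mult_trace_dsplit_swap)
      (auto simp: traces_Cons wev_append left_diff_distrib simp del: wev.simps split: option.splits)
  show ?thesis
    unfolding sum_dentry 1 2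
    by (simp add: traces_Cons sum_distrib_right del: wev.simps)
       (intro sum.cong refl, auto simp: traces_Cons left_diff_distrib split: option.splits simp del: wev.simps)
qed

end

section \<open>First-order expansions\<close>

definition bdd_meas :: "'w measure \<Rightarrow> ('w \<Rightarrow> complex) \<Rightarrow> bool" where
  "bdd_meas M f \<longleftrightarrow> f \<in> borel_measurable M \<and> (\<exists>K. \<forall>w\<in>space M. cmod (f w) \<le> K)"

lemma bdd_meas_const [simp]: "bdd_meas M (\<lambda>_. c)"
  by (auto simp: bdd_meas_def)

lemma bdd_meas_add: assumes "bdd_meas M f" "bdd_meas M g" shows "bdd_meas M (\<lambda>w. f w + g w)"
proof -
  from assms obtain K L where "\<forall>w\<in>space M. cmod (f w) \<le> K" "\<forall>w\<in>space M. cmod (g w) \<le> L" by (auto simp: bdd_meas_def)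
  then have "\<forall>w\<in>space M. cmod (f w + g w) \<le> K + L" by (meson add_mono norm_triangle_le)
  then show ?thesis using assms by (auto simp: bdd_meas_def)
qed

lemma bdd_meas_mult: assumes "bdd_meas M f" "bdd_meas M g" shows "bdd_meas M (\<lambda>w. f w * g w)"
proof -
  from assms obtain K L where "\<forall>w\<in>space M. cmod (f w) \<le> K" "\<forall>w\<in>space M. cmod (g w) \<le> L" by (auto simp: bdd_meas_def)
  then have "\<forall>w\<in>space M. cmod (f w * g w) \<le> K * L"
    by (metis norm_mult mult_mono' norm_ge_zero)
  then show ?thesis using assms by (auto simp: bdd_meas_def)
qed

lemma bdd_meas_uminus: "bdd_meas M f \<Longrightarrow> bdd_meas M (\<lambda>w. - f w)"
  by (auto simp: bdd_meas_def)

lemma bdd_meas_diff: "bdd_meas M f \<Longrightarrow> bdd_meas M g \<Longrightarrow> bdd_meas M (\<lambda>w. f w - g w)"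
  using bdd_meas_add[of M f "\<lambda>w. - g w"] bdd_meas_uminus[of M g] by simp

lemma borel_measurable_cnj: "f \<in> borel_measurable M \<Longrightarrow> (\<lambda>w. cnj (f w)) \<in> borel_measurable M"
  by (rule measurable_compose[OF _ borel_measurable_continuous_onI]) (auto intro: continuous_intros)

lemma bdd_meas_cnj: "bdd_meas M f \<Longrightarrow> bdd_meas M (\<lambda>w. cnj (f w))"
  by (auto simp: bdd_meas_def borel_measurable_cnj)

lemma bdd_meas_sum: "(\<And>i. i \<in> I \<Longrightarrow> bdd_meas M (f i)) \<Longrightarrow> bdd_meas M (\<lambda>w. \<Sum>i\<in>I. f i w)"
  by (induction I rule: infinite_finite_induct) (auto intro: bdd_meas_add)

lemma bdd_meas_cong: "(\<And>w. w \<in> space M \<Longrightarrow> f w = g w) \<Longrightarrow> bdd_meas M f \<longleftrightarrow> bdd_meas M g"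
  unfolding bdd_meas_def by (simp cong: measurable_cong)

lemma (in prob_space) bdd_meas_integrable: "bdd_meas M f \<Longrightarrow> integrable M f"
  unfolding bdd_meas_def by (auto intro: integrable_const_bound AE_I2)

text \<open>\<open>g \<theta> = g0 + \<theta> g1 + O(\<theta>\<^sup>2)\<close> uniformly on the probability space: closed under sums and products, and strong
  enough to differentiate under the expectation.\<close>

definition first_order :: "'w measure \<Rightarrow> (real \<Rightarrow> 'w \<Rightarrow> complex) \<Rightarrow> ('w \<Rightarrow> complex) \<Rightarrow> ('w \<Rightarrow> complex) \<Rightarrow> bool" where
  "first_order M g g0 g1 \<longleftrightarrow> (\<forall>\<theta>\<in>{0..1}. g \<theta> \<in> borel_measurable M) \<and> bdd_meas M g0 \<and> bdd_meas M g1 \<and>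
     (\<exists>K. \<forall>w\<in>space M. \<forall>\<theta>\<in>{0..1}. cmod (g \<theta> w - g0 w - of_real \<theta> * g1 w) \<le> K * \<theta>\<^sup>2)"

lemma first_orderI:
  assumes "\<And>\<theta>. \<theta> \<in> {0..1} \<Longrightarrow> g \<theta> \<in> borel_measurable M" "bdd_meas M g0" "bdd_meas M g1"
    "\<And>w \<theta>. w \<in> space M \<Longrightarrow> \<theta> \<in> {0..1} \<Longrightarrow> cmod (g \<theta> w - g0 w - of_real \<theta> * g1 w) \<le> K * \<theta>\<^sup>2"
  shows "first_order M g g0 g1"
  unfolding first_order_def using assms by blast

lemma first_order_measurable: "first_order M g g0 g1 \<Longrightarrow> \<theta> \<in> {0..1} \<Longrightarrow> g \<theta> \<in> borel_measurable M"
  and first_order_bdd_meas: "first_order M g g0 g1 \<Longrightarrow> bdd_meas M g0" "first_order M g g0 g1 \<Longrightarrow> bdd_meas M g1"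
  by (simp_all add: first_order_def)

lemma first_order_cong:
  assumes "first_order M g g0 g1"
    "\<And>\<theta> w. w \<in> space M \<Longrightarrow> \<theta> \<in> {0..1} \<Longrightarrow> g \<theta> w = h \<theta> w"
    "\<And>w. w \<in> space M \<Longrightarrow> g0 w = h0 w" "\<And>w. w \<in> space M \<Longrightarrow> g1 w = h1 w"
  shows "first_order M h h0 h1"
proof -
  from assms(1) obtain K where K: "\<And>w \<theta>. w \<in> space M \<Longrightarrow> \<theta> \<in> {0..1} \<Longrightarrow> cmod (g \<theta> w - g0 w - of_real \<theta> * g1 w) \<le> K * \<theta>\<^sup>2"
    unfolding first_order_def by blast
  show ?thesis
  proof (rule first_orderI[of _ _ _ _ K])
    fix \<theta> :: real assume "\<theta> \<in> {0..1}"
    then show "h \<theta> \<in> borel_measurable M"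
      using first_order_measurable[OF assms(1)] measurable_cong[of M "g \<theta>" "h \<theta>" borel] assms(2) by auto
  qed (use first_order_bdd_meas[OF assms(1)] bdd_meas_cong[of M g0 h0] bdd_meas_cong[of M g1 h1] assms(2-4) K in auto)
qed

lemma first_order_const: "bdd_meas M f \<Longrightarrow> first_order M (\<lambda>_. f) f (\<lambda>_. 0)"
  by (auto simp: first_order_def bdd_meas_def intro!: exI[of _ 0])

lemma first_order_add:
  assumes "first_order M g g0 g1" "first_order M h h0 h1"
  shows "first_order M (\<lambda>\<theta> w. g \<theta> w + h \<theta> w) (\<lambda>w. g0 w + h0 w) (\<lambda>w. g1 w + h1 w)"
proof -
  from assms obtain K L where K: "\<forall>w\<in>space M. \<forall>\<theta>\<in>{0..1}. cmod (g \<theta> w - g0 w - of_real \<theta> * g1 w) \<le> K * \<theta>\<^sup>2"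
    and L: "\<forall>w\<in>space M. \<forall>\<theta>\<in>{0..1}. cmod (h \<theta> w - h0 w - of_real \<theta> * h1 w) \<le> L * \<theta>\<^sup>2"
    by (auto simp: first_order_def)
  have "cmod (g \<theta> w + h \<theta> w - (g0 w + h0 w) - of_real \<theta> * (g1 w + h1 w)) \<le> (K + L) * \<theta>\<^sup>2"
    if "w \<in> space M" "\<theta> \<in> {0..1}" for w \<theta>
  proof -
    have "g \<theta> w + h \<theta> w - (g0 w + h0 w) - of_real \<theta> * (g1 w + h1 w) =
      (g \<theta> w - g0 w - of_real \<theta> * g1 w) + (h \<theta> w - h0 w - of_real \<theta> * h1 w)"
      by (simp add: algebra_simps)
    also have "cmod \<dots> \<le> K * \<theta>\<^sup>2 + L * \<theta>\<^sup>2"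
      using K L that by (intro norm_triangle_le add_mono) auto
    finally show ?thesis by (simp add: algebra_simps)
  qed
  then show ?thesis using assms
    by (intro first_orderI[of _ _ _ _ "K + L"] bdd_meas_add borel_measurable_add) (auto dest: first_order_bdd_meas first_order_measurable)
qed

lemma first_order_mult:
  assumes "first_order M g g0 g1" "first_order M h h0 h1"
  shows "first_order M (\<lambda>\<theta> w. g \<theta> w * h \<theta> w) (\<lambda>w. g0 w * h0 w) (\<lambda>w. g1 w * h0 w + g0 w * h1 w)"
proof -
  from assms obtain K L where K: "\<forall>w\<in>space M. \<forall>\<theta>\<in>{0..1}. cmod (g \<theta> w - g0 w - of_real \<theta> * g1 w) \<le> K * \<theta>\<^sup>2"
    and L: "\<forall>w\<in>space M. \<forall>\<theta>\<in>{0..1}. cmod (h \<theta> w - h0 w - of_real \<theta> * h1 w) \<le> L * \<theta>\<^sup>2"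
    by (auto simp: first_order_def)
  from assms obtain G0 G1 H0 H1 where b: "\<forall>w\<in>space M. cmod (g0 w) \<le> G0" "\<forall>w\<in>space M. cmod (g1 w) \<le> G1"
     "\<forall>w\<in>space M. cmod (h0 w) \<le> H0" "\<forall>w\<in>space M. cmod (h1 w) \<le> H1"
    unfolding first_order_def bdd_meas_def by blast
  have "cmod (g \<theta> w * h \<theta> w - (g0 w * h0 w) - of_real \<theta> * (g1 w * h0 w + g0 w * h1 w)) \<le>
      (G1 * H1 + K * (L + H0 + H1) + (G0 + G1) * L) * \<theta>\<^sup>2"
    if w: "w \<in> space M" and t: "\<theta> \<in> {0..1}" for w \<theta>
  proof -
    define r where "r = g \<theta> w - g0 w - of_real \<theta> * g1 w"
    define s where "s = h \<theta> w - h0 w - of_real \<theta> * h1 w"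
    have r: "cmod r \<le> K * \<theta>\<^sup>2" and s: "cmod s \<le> L * \<theta>\<^sup>2" using K L w t by (auto simp: r_def s_def)
    have bb: "cmod (g0 w) \<le> G0" "cmod (g1 w) \<le> G1" "cmod (h0 w) \<le> H0" "cmod (h1 w) \<le> H1" using b w by auto
    have nn: "0 \<le> G0" "0 \<le> G1" "0 \<le> H0" "0 \<le> H1" using bb by (meson norm_ge_zero order_trans)+
    \<comment> \<open>\<open>K\<close> and \<open>L\<close> bound norms at
      \<open>\<theta> = 1\<close>, hence they are nonnegative.\<close>
    have "cmod (h 1 w - h0 w - of_real 1 * h1 w) \<le> L * 1\<^sup>2" "cmod (g 1 w - g0 w - of_real 1 * g1 w) \<le> K * 1\<^sup>2"
      using K[rule_format, OF w, of 1] L[rule_format, OF w, of 1] by simp_all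
    then have KL: "0 \<le> L" "0 \<le> K" by (auto intro: order_trans[OF norm_ge_zero])
    have t2: "\<theta>\<^sup>2 \<le> 1" "\<bar>\<theta>\<bar> \<le> 1" using t by (auto simp: power_le_one)
    have "cmod (of_real \<theta> * h1 w) \<le> 1 * H1" "cmod (of_real \<theta> * g1 w) \<le> 1 * G1"
      unfolding norm_mult norm_of_real using bb t2 nn by (intro mult_mono; auto)+
    moreover have "L * \<theta>\<^sup>2 \<le> L" using KL t2 by (simp add: mult_left_le)
    ultimately have h: "cmod (h \<theta> w) \<le> L + H0 + H1" and g': "cmod (g0 w + of_real \<theta> * g1 w) \<le> G0 + G1"
      using s bb norm_triangle_ineq[of "s + h0 w" "of_real \<theta> * h1 w"] norm_triangle_ineq[of s "h0 w"]
        norm_triangle_ineq[of "g0 w" "of_real \<theta> * g1 w"]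
      by (auto simp: s_def algebra_simps)
    \<comment> \<open>Beyond first order there remain one quadratic term and the two products with a
      remainder; each gives one summand of the constant.\<close>
    have "g \<theta> w * h \<theta> w - (g0 w * h0 w) - of_real \<theta> * (g1 w * h0 w + g0 w * h1 w) =
      of_real (\<theta>\<^sup>2) * (g1 w * h1 w) + r * h \<theta> w + (g0 w + of_real \<theta> * g1 w) * s"
      unfolding r_def s_def by (simp add: algebra_simps power2_eq_square)
    also have "cmod \<dots> \<le> \<theta>\<^sup>2 * (G1 * H1) + K * \<theta>\<^sup>2 * (L + H0 + H1) + (G0 + G1) * (L * \<theta>\<^sup>2)"
    proof (intro norm_triangle_le add_mono)
      show "cmod (of_real (\<theta>\<^sup>2) * (g1 w * h1 w)) \<le> \<theta>\<^sup>2 * (G1 * H1)"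
        unfolding norm_mult norm_of_real using bb nn by (auto intro!: mult_mono)
      show "cmod (r * h \<theta> w) \<le> K * \<theta>\<^sup>2 * (L + H0 + H1)"
        unfolding norm_mult using r h KL by (intro mult_mono) auto
      show "cmod ((g0 w + of_real \<theta> * g1 w) * s) \<le> (G0 + G1) * (L * \<theta>\<^sup>2)"
        unfolding norm_mult using s g' nn by (intro mult_mono) auto
    qed
    finally show ?thesis by (simp add: algebra_simps)
  qed
  then show ?thesis using assms
    by (intro first_orderI[of _ _ _ _ "G1 * H1 + K * (L + H0 + H1) + (G0 + G1) * L"] bdd_meas_add bdd_meas_mult borel_measurable_times)
       (auto dest: first_order_bdd_meas first_order_measurable)
qed

lemma first_order_sum:
  assumes "\<And>i. i \<in> I \<Longrightarrow> first_order M (g i) (g0 i) (g1 i)"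
  shows "first_order M (\<lambda>\<theta> w. \<Sum>i\<in>I. g i \<theta> w) (\<lambda>w. \<Sum>i\<in>I. g0 i w) (\<lambda>w. \<Sum>i\<in>I. g1 i w)"
  using assms
proof (induction I rule: infinite_finite_induct)
  case (insert x F)
  then show ?case using first_order_add[of M "g x" "g0 x" "g1 x"] by simp
qed (simp_all add: first_order_const)

text \<open>The remainder has expectation \<open>- \<theta> * E g1\<close>, so
  \<open>\<theta> * c \<le> K * \<theta>^2\<close> for every small \<theta>. Uniformity of
  \<open>K\<close> over the space takes the place of dominated convergence.\<close>

lemma (in prob_space) first_order_expectation_eq_0:
  assumes "first_order M g g0 g1" "\<And>\<theta>. \<theta> \<in> {0..1} \<Longrightarrow> (\<integral>w. g \<theta> w \<partial>M) = (\<integral>w. g0 w \<partial>M)"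
  shows "(\<integral>w. g1 w \<partial>M) = 0"
proof (rule ccontr)
  define c where "c = cmod (\<integral>w. g1 w \<partial>M)"
  assume "(\<integral>w. g1 w \<partial>M) \<noteq> 0"
  then have c: "c > 0" by (simp add: c_def)
  from assms obtain K where K: "\<forall>w\<in>space M. \<forall>\<theta>\<in>{0..1}. cmod (g \<theta> w - g0 w - of_real \<theta> * g1 w) \<le> K * \<theta>\<^sup>2"
    by (auto simp: first_order_def)
  have i: "integrable M g0" "integrable M g1" using first_order_bdd_meas[OF assms(1)] by (auto intro: bdd_meas_integrable)
  have bound: "c \<le> K * \<theta>" if t: "0 < \<theta>" "\<theta> \<le> 1" for \<theta>
  proof -
    let ?r = "\<lambda>w. g \<theta> w - g0 w - of_real \<theta> * g1 w"
    have "?r \<in> borel_measurable M" using first_order_measurable[OF assms(1), of \<theta>] t i by auto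
    then have r: "integrable M ?r"
    proof (intro bdd_meas_integrable, unfold bdd_meas_def, intro conjI exI ballI)
      show "cmod (?r w) \<le> K * \<theta>\<^sup>2" if "w \<in> space M" for w
        using K[rule_format, OF that, of \<theta>] t by simp
    qed
    have "integrable M (\<lambda>w. ?r w + g0 w + of_real \<theta> * g1 w)"
      using r i by (intro Bochner_Integration.integrable_add integrable_mult_right) auto
    then have g: "integrable M (g \<theta>)" by (simp add: algebra_simps)
    have "(\<integral>w. ?r w \<partial>M) = - of_real \<theta> * (\<integral>w. g1 w \<partial>M)"
      using g i assms(2)[of \<theta>] t by simp
    moreover have "cmod (\<integral>w. ?r w \<partial>M) \<le> K * \<theta>\<^sup>2"
    proof -
      have "cmod (\<integral>w. ?r w \<partial>M) \<le> (\<integral>w. cmod (?r w) \<partial>M)" by (rule integral_norm_bound)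
      also have "\<dots> \<le> (\<integral>w. K * \<theta>\<^sup>2 \<partial>M)"
        using r K t by (intro integral_mono integrable_norm) auto
      finally show ?thesis by (simp add: prob_space)
    qed
    ultimately have "\<theta> * c \<le> K * \<theta>\<^sup>2" using t by (simp add: norm_mult c_def)
    then have "\<theta> * c \<le> \<theta> * (K * \<theta>)" by (simp add: power2_eq_square mult_ac)
    then show ?thesis using t by (simp only: mult_le_cancel_left_pos)
  qed
  have K0: "K > 0" using bound[of 1] c by simp
  \<comment> \<open>This \<theta> makes the bound at most \<open>c / 2\<close>.\<close>
  have "c \<le> K * min 1 (c / (2 * K))" using c K0 by (intro bound) auto
  also have "\<dots> \<le> K * (c / (2 * K))" using K0 by (intro mult_left_mono) auto
  also have "\<dots> = c / 2" using K0 by simp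
  finally show False using c by simp
qed

section \<open>First-order expansions of matrices\<close>

definition first_order_mat :: "nat \<Rightarrow> 'w measure \<Rightarrow> (real \<Rightarrow> 'w \<Rightarrow> complex mat) \<Rightarrow> ('w \<Rightarrow> complex mat) \<Rightarrow> ('w \<Rightarrow> complex mat) \<Rightarrow> bool" where
  "first_order_mat N M X X0 X1 \<longleftrightarrow>
     (\<forall>w\<in>space M. \<forall>\<theta>\<in>{0..1}. X \<theta> w \<in> carrier_mat N N) \<and>
     (\<forall>w\<in>space M. X0 w \<in> carrier_mat N N \<and> X1 w \<in> carrier_mat N N) \<and>
     (\<forall>i<N. \<forall>j<N. first_order M (\<lambda>\<theta> w. X \<theta> w $$ (i,j)) (\<lambda>w. X0 w $$ (i,j)) (\<lambda>w. X1 w $$ (i,j)))"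

lemma first_order_matI:
  assumes "\<And>w \<theta>. w \<in> space M \<Longrightarrow> \<theta> \<in> {0..1} \<Longrightarrow> X \<theta> w \<in> carrier_mat N N"
    "\<And>w. w \<in> space M \<Longrightarrow> X0 w \<in> carrier_mat N N" "\<And>w. w \<in> space M \<Longrightarrow> X1 w \<in> carrier_mat N N"
    "\<And>i j. i < N \<Longrightarrow> j < N \<Longrightarrow> first_order M (\<lambda>\<theta> w. X \<theta> w $$ (i,j)) (\<lambda>w. X0 w $$ (i,j)) (\<lambda>w. X1 w $$ (i,j))"
  shows "first_order_mat N M X X0 X1"
  unfolding first_order_mat_def using assms by blast

lemma first_order_matD:
  assumes "first_order_mat N M X X0 X1"
  shows "\<And>w \<theta>. w \<in> space M \<Longrightarrow> \<theta> \<in> {0..1} \<Longrightarrow> X \<theta> w \<in> carrier_mat N N"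
    "\<And>w. w \<in> space M \<Longrightarrow> X0 w \<in> carrier_mat N N" "\<And>w. w \<in> space M \<Longrightarrow> X1 w \<in> carrier_mat N N"
    "\<And>i j. i < N \<Longrightarrow> j < N \<Longrightarrow> first_order M (\<lambda>\<theta> w. X \<theta> w $$ (i,j)) (\<lambda>w. X0 w $$ (i,j)) (\<lambda>w. X1 w $$ (i,j))"
  using assms unfolding first_order_mat_def by blast+

lemma first_order_mat_cong:
  assumes X: "first_order_mat N M X X0 X1"
    and eq: "\<And>\<theta> w. w \<in> space M \<Longrightarrow> \<theta> \<in> {0..1} \<Longrightarrow> X \<theta> w = Y \<theta> w"
    "\<And>w. w \<in> space M \<Longrightarrow> X0 w = Y0 w" "\<And>w. w \<in> space M \<Longrightarrow> X1 w = Y1 w"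
  shows "first_order_mat N M Y Y0 Y1"
proof (rule first_order_matI)
  show "first_order M (\<lambda>\<theta> w. Y \<theta> w $$ (i,j)) (\<lambda>w. Y0 w $$ (i,j)) (\<lambda>w. Y1 w $$ (i,j))" if "i < N" "j < N" for i j
    by (rule first_order_cong[OF first_order_matD(4)[OF X that]]) (simp_all add: eq)
qed (simp_all add: first_order_matD[OF X] flip: eq)

lemma first_order_mat_mult:
  assumes X: "first_order_mat N M X X0 X1" and Y: "first_order_mat N M Y Y0 Y1"
  shows "first_order_mat N M (\<lambda>\<theta> w. X \<theta> w * Y \<theta> w) (\<lambda>w. X0 w * Y0 w) (\<lambda>w. X1 w * Y0 w + X0 w * Y1 w)"
proof (rule first_order_matI)
  fix i j assume ij: "i < N" "j < N"
  have "first_order M (\<lambda>\<theta> w. \<Sum>k<N. X \<theta> w $$ (i,k) * Y \<theta> w $$ (k,j)) (\<lambda>w. \<Sum>k<N. X0 w $$ (i,k) * Y0 w $$ (k,j))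
     (\<lambda>w. \<Sum>k<N. X1 w $$ (i,k) * Y0 w $$ (k,j) + X0 w $$ (i,k) * Y1 w $$ (k,j))"
    using ij by (intro first_order_sum first_order_mult first_order_matD(4)[OF X] first_order_matD(4)[OF Y]) auto
  then show "first_order M (\<lambda>\<theta> w. (X \<theta> w * Y \<theta> w) $$ (i,j)) (\<lambda>w. (X0 w * Y0 w) $$ (i,j))
      (\<lambda>w. (X1 w * Y0 w + X0 w * Y1 w) $$ (i,j))"
    by (rule first_order_cong)
      (simp_all add: ij first_order_matD[OF X] first_order_matD[OF Y] mult_entry[of _ N] add_entry[of _ N] sum.distrib del: index_mult_mat index_add_mat atLeastAtMost_iff)
qed (simp_all add: first_order_matD[OF X] first_order_matD[OF Y] del: atLeastAtMost_iff)

lemma first_order_mat_const: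
  assumes "X \<in> carrier_mat N N"
  shows "first_order_mat N M (\<lambda>_ _. X) (\<lambda>_. X) (\<lambda>_. 0\<^sub>m N N)"
  unfolding first_order_mat_def
proof (intro conjI allI impI)
  fix i j assume "i < N" "j < N"
  then show "first_order M (\<lambda>\<theta> w. X $$ (i,j)) (\<lambda>w. X $$ (i,j)) (\<lambda>w. 0\<^sub>m N N $$ (i,j))"
    using first_order_const[OF bdd_meas_const, of M "X $$ (i,j)"] by simp
qed (use assms in auto)

lemma first_order_tr:
  assumes X: "first_order_mat N M X X0 X1"
  shows "first_order M (\<lambda>\<theta> w. tr (X \<theta> w)) (\<lambda>w. tr (X0 w)) (\<lambda>w. tr (X1 w))"
proof -
  have "first_order M (\<lambda>\<theta> w. \<Sum>i<N. X \<theta> w $$ (i,i)) (\<lambda>w. \<Sum>i<N. X0 w $$ (i,i)) (\<lambda>w. \<Sum>i<N. X1 w $$ (i,i))"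
    by (intro first_order_sum first_order_matD(4)[OF X]) auto
  then show ?thesis
    by (rule first_order_cong) (simp_all add: tr_carrier[of _ N] first_order_matD[OF X] del: atLeastAtMost_iff)
qed

section \<open>The loop equations\<close>

text \<open>\<open>Wmat\<close> agrees with \<open>exp (\<theta> H)\<close> to first order, and is exactly unitary when \<open>H\<^sup>2 = -P\<close>.\<close>

definition Wmat :: "nat \<Rightarrow> (nat \<Rightarrow> nat \<Rightarrow> complex) \<Rightarrow> (nat \<Rightarrow> nat \<Rightarrow> complex) \<Rightarrow> real \<Rightarrow> complex mat" where
  "Wmat N h p \<theta> = mat N N (\<lambda>(i,j). of_bool (i = j) + of_real \<theta> * h i j + of_real (sqrt (1 - \<theta>\<^sup>2) - 1) * p i j)"

text \<open>An antihermitian \<open>h\<close> and the projection \<open>p = - h h\<close> onto its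
  range. Then \<open>exp (s h) = 1 + sin s * h + (cos s - 1) * p\<close>, and \<open>Wmat\<close> is
  this matrix parametrized by \<open>\<theta> = sin s\<close>.\<close>

definition rot_pair :: "nat \<Rightarrow> (nat \<Rightarrow> nat \<Rightarrow> complex) \<Rightarrow> (nat \<Rightarrow> nat \<Rightarrow> complex) \<Rightarrow> bool" where
  "rot_pair N h p \<longleftrightarrow> (\<forall>i<N. \<forall>j<N. cnj (h j i) = - h i j \<and> cnj (p j i) = p i j \<and>
     (\<Sum>k<N. h i k * h k j) = - p i j \<and> (\<Sum>k<N. h i k * p k j) = h i j \<and>
     (\<Sum>k<N. p i k * h k j) = h i j \<and> (\<Sum>k<N. p i k * p k j) = p i j)"

lemma Wmat_carrier [simp]: "Wmat N h p \<theta> \<in> carrier_mat N N"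
  by (simp add: Wmat_def)

lemma adj_Wmat: "rot_pair N h p \<Longrightarrow> adj (Wmat N h p \<theta>) = Wmat N (\<lambda>i j. - h i j) p \<theta>"
  by (rule eq_matI) (auto simp: adj_def Wmat_def rot_pair_def)

lemma Wmat_mult:
  assumes "rot_pair N h p" "\<theta> \<in> {0..1}"
  shows "Wmat N h p \<theta> * Wmat N (\<lambda>i j. - h i j) p \<theta> = 1\<^sub>m N"
proof (rule eq_matI)
  fix i j assume "i < dim_row (1\<^sub>m N :: complex mat)" "j < dim_col (1\<^sub>m N :: complex mat)"
  then have ij: "i < N" "j < N" by auto
  define c where "c = complex_of_real (sqrt (1 - \<theta>\<^sup>2) - 1)"
  define t where "t = complex_of_real \<theta>"
  have "\<theta>\<^sup>2 \<le> 1" using assms by (auto simp: power_le_one)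
  \<comment> \<open>This is \<open>cos^2 + sin^2 = 1\<close>, written for the coefficient of
    \<open>p\<close> in the product.\<close>
  then have "(sqrt (1 - \<theta>\<^sup>2) - 1)\<^sup>2 + 2 * (sqrt (1 - \<theta>\<^sup>2) - 1) + \<theta>\<^sup>2 = 0"
    by (simp add: power2_diff)
  then have "complex_of_real ((sqrt (1 - \<theta>\<^sup>2) - 1)\<^sup>2 + 2 * (sqrt (1 - \<theta>\<^sup>2) - 1) + \<theta>\<^sup>2) = 0" by (metis of_real_0)
  then have ct: "c * c + 2 * c + t * t = 0" by (simp add: c_def t_def power2_eq_square)
  have d: "(\<Sum>k<N. of_bool (i = k) * f k) = f i" "(\<Sum>k<N. f k * of_bool (k = j)) = f j" for f :: "nat \<Rightarrow> complex"
    using ij by (simp_all add: of_bool_def if_distrib if_distribR sum.delta cong: if_cong)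
  have "(Wmat N h p \<theta> * Wmat N (\<lambda>i j. - h i j) p \<theta>) $$ (i,j) =
    (\<Sum>k<N. (of_bool (i = k) + t * h i k + c * p i k) * (of_bool (k = j) - t * h k j + c * p k j))"
    using ij by (subst mult_entry[of _ N]) (auto simp: Wmat_def c_def t_def)
  also have "\<dots> = (\<Sum>k<N. of_bool (i = k) * (of_bool (k = j) - t * h k j + c * p k j))
      + (\<Sum>k<N. (t * h i k + c * p i k) * of_bool (k = j))
      - t * t * (\<Sum>k<N. h i k * h k j) + t * c * (\<Sum>k<N. h i k * p k j)
      - c * t * (\<Sum>k<N. p i k * h k j) + c * c * (\<Sum>k<N. p i k * p k j)"
    unfolding sum_distrib_left by (simp add: sum.distrib[symmetric] sum_subtractf[symmetric] algebra_simps)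
  also have "\<dots> = of_bool (i = j) + (c * c + 2 * c + t * t) * p i j"
  proof -
    have e: "(\<Sum>k<N. h i k * h k j) = - p i j" "(\<Sum>k<N. h i k * p k j) = h i j"
      "(\<Sum>k<N. p i k * h k j) = h i j" "(\<Sum>k<N. p i k * p k j) = p i j"
      using assms(1) ij unfolding rot_pair_def by blast+
    show ?thesis unfolding d e by (simp add: algebra_simps)
  qed
  finally show "(Wmat N h p \<theta> * Wmat N (\<lambda>i j. - h i j) p \<theta>) $$ (i,j) = 1\<^sub>m N $$ (i,j)"
    using ij ct by simp
qed (auto simp: Wmat_def)

lemma rot_pair_uminus: "rot_pair N h p \<Longrightarrow> rot_pair N (\<lambda>i j. - h i j) p"
  by (simp add: rot_pair_def sum_negf)

lemma unitary_Wmat: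
  assumes "rot_pair N h p" "\<theta> \<in> {0..1}"
  shows "unitary_mat N (Wmat N h p \<theta>)"
  using Wmat_mult[OF assms] Wmat_mult[OF rot_pair_uminus[OF assms(1)] assms(2)] adj_Wmat[OF assms(1)]
  by (simp add: unitary_mat_def)

lemma real_Wmat:
  assumes "\<And>i j. h i j \<in> \<real>" "\<And>i j. p i j \<in> \<real>"
  shows "real_mat (Wmat N h p \<theta>)"
  using assms by (auto simp: real_mat_def Wmat_def intro!: Reals_add Reals_mult Reals_of_real simp del: of_real_diff)

lemma sum_two_points:
  fixes a b N :: nat
  assumes "a < N" "b < N" "a \<noteq> b" "\<And>k. k \<noteq> a \<Longrightarrow> k \<noteq> b \<Longrightarrow> f k = 0"
  shows "(\<Sum>k<N. f k) = f a + (f b :: complex)"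
proof -
  have "(\<Sum>k<N. f k) = (\<Sum>k\<in>{a,b}. f k)"
    using assms by (intro sum.mono_neutral_right) auto
  then show ?thesis using assms by simp
qed

text \<open>A rotation in the plane of the basis vectors \<open>a\<close> and \<open>b\<close>. It
  is real for real \<alpha>; comparing the phases 1 and \<open>i\<close> separates the two matrix
  units.\<close>

lemma rot_pair_offdiag:
  assumes "a < N" "b < N" "a \<noteq> b" "\<alpha> * cnj \<alpha> = 1"
  shows "rot_pair N (\<lambda>i j. \<alpha> * of_bool (i = a \<and> j = b) - cnj \<alpha> * of_bool (i = b \<and> j = a))
     (\<lambda>i j. of_bool (i = j \<and> (i = a \<or> i = b)))"
  unfolding rot_pair_def
proof (intro allI impI conjI)
  fix i j
  show "(\<Sum>k<N. (\<alpha> * of_bool (i = a \<and> k = b) - cnj \<alpha> * of_bool (i = b \<and> k = a)) *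
      (\<alpha> * of_bool (k = a \<and> j = b) - cnj \<alpha> * of_bool (k = b \<and> j = a))) = - of_bool (i = j \<and> (i = a \<or> i = b))"
    using assms by (subst sum_two_points[OF assms(1-3)]) (auto simp: mult.commute)
  show "(\<Sum>k<N. (\<alpha> * of_bool (i = a \<and> k = b) - cnj \<alpha> * of_bool (i = b \<and> k = a)) *
      of_bool (k = j \<and> (k = a \<or> k = b))) = \<alpha> * of_bool (i = a \<and> j = b) - cnj \<alpha> * of_bool (i = b \<and> j = a)"
    using assms by (subst sum_two_points[OF assms(1-3)]) auto
  show "(\<Sum>k<N. of_bool (i = k \<and> (i = a \<or> i = b)) *
      (\<alpha> * of_bool (k = a \<and> j = b) - cnj \<alpha> * of_bool (k = b \<and> j = a))) = \<alpha> * of_bool (i = a \<and> j = b) - cnj \<alpha> * of_bool (i = b \<and> j = a)"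
    using assms by (subst sum_two_points[OF assms(1-3)]) auto
  show "(\<Sum>k<N. of_bool (i = k \<and> (i = a \<or> i = b)) * of_bool (k = j \<and> (k = a \<or> k = b))) =
      (of_bool (i = j \<and> (i = a \<or> i = b)) :: complex)"
    using assms by (subst sum_two_points[OF assms(1-3)]) auto
qed (use assms in auto)

text \<open>A phase on a single basis vector. It exists only in the unitary group and handles the
  diagonal matrix units.\<close>

lemma rot_pair_diag:
  assumes "a < N"
  shows "rot_pair N (\<lambda>i j. \<i> * of_bool (i = a \<and> j = a)) (\<lambda>i j. of_bool (i = j \<and> i = a))"
proof -
  have 1: "(\<Sum>k<N. f k) = f a" if "\<And>k. k \<noteq> a \<Longrightarrow> f k = 0" for f :: "nat \<Rightarrow> complex"
  proof -
    have "(\<Sum>k<N. f k) = (\<Sum>k\<in>{a}. f k)"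
      using assms that by (intro sum.mono_neutral_right) auto
    then show ?thesis by simp
  qed
  show ?thesis
    unfolding rot_pair_def
  proof (intro allI impI conjI)
    fix i j
    show "(\<Sum>k<N. \<i> * of_bool (i = a \<and> k = a) * (\<i> * of_bool (k = a \<and> j = a))) = - of_bool (i = j \<and> i = a)"
      by (subst 1) auto
    show "(\<Sum>k<N. \<i> * of_bool (i = a \<and> k = a) * of_bool (k = j \<and> k = a)) = \<i> * of_bool (i = a \<and> j = a)"
      by (subst 1) auto
    show "(\<Sum>k<N. of_bool (i = k \<and> i = a) * (\<i> * of_bool (k = a \<and> j = a))) = \<i> * of_bool (i = a \<and> j = a)"
      by (subst 1) auto
    show "(\<Sum>k<N. of_bool (i = k \<and> i = a) * of_bool (k = j \<and> k = a)) = (of_bool (i = j \<and> i = a) :: complex)"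
      by (subst 1) auto
  qed auto
qed

lemma sqrt_expansion: "\<theta> \<in> {0..1} \<Longrightarrow> \<bar>sqrt (1 - \<theta>\<^sup>2) - 1\<bar> \<le> \<theta>\<^sup>2"
proof -
  assume "\<theta> \<in> {0..1}"
  then have t: "0 \<le> 1 - \<theta>\<^sup>2" "1 - \<theta>\<^sup>2 \<le> 1" by (auto simp: power_le_one)
  have "(1 - \<theta>\<^sup>2) \<le> sqrt (1 - \<theta>\<^sup>2)"
    using t by (intro real_le_rsqrt) (simp add: power2_eq_square mult_left_le)
  moreover have "sqrt (1 - \<theta>\<^sup>2) \<le> 1" using t by simp
  ultimately show ?thesis by simp
qed

lemma first_order_mat_Wmat: "first_order_mat N M (\<lambda>\<theta> _. Wmat N h p \<theta>) (\<lambda>_. 1\<^sub>m N) (\<lambda>_. mat N N (\<lambda>(i,j). h i j))"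
  unfolding first_order_mat_def
proof (intro conjI allI impI)
  fix i j assume ij: "i < N" "j < N"
  have "cmod (Wmat N h p \<theta> $$ (i,j) - 1\<^sub>m N $$ (i,j) - of_real \<theta> * mat N N (\<lambda>(i,j). h i j) $$ (i,j)) \<le> cmod (p i j) * \<theta>\<^sup>2"
    if "\<theta> \<in> {0..1}" for \<theta>
  proof -
    have "Wmat N h p \<theta> $$ (i,j) - 1\<^sub>m N $$ (i,j) - of_real \<theta> * mat N N (\<lambda>(i,j). h i j) $$ (i,j)
       = of_real (sqrt (1 - \<theta>\<^sup>2) - 1) * p i j"
      using ij by (simp add: Wmat_def of_bool_def)
    then show ?thesis using sqrt_expansion[OF that]
      by (simp only: norm_mult norm_of_real) (metis mult.commute mult_left_mono norm_ge_zero)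
  qed
  then show "first_order M (\<lambda>\<theta> w. Wmat N h p \<theta> $$ (i,j)) (\<lambda>w. 1\<^sub>m N $$ (i,j)) (\<lambda>w. mat N N (\<lambda>(i,j). h i j) $$ (i,j))"
    by (intro first_orderI[of _ _ _ _ "cmod (p i j)"]) (auto simp del: index_mat)
qed auto

section \<open>Measurability and Haar invariance of expectations\<close>

definition conj_by :: "(nat \<Rightarrow> complex mat) \<Rightarrow> complex mat \<Rightarrow> nat \<Rightarrow> complex mat" where
  "conj_by b X k = X * b k * adj X"

definition meas_mat :: "nat \<Rightarrow> 'w measure \<Rightarrow> ('w \<Rightarrow> complex mat) \<Rightarrow> bool" where
  "meas_mat N M X \<longleftrightarrow> (\<forall>w\<in>space M. X w \<in> carrier_mat N N) \<and> (\<forall>i<N. \<forall>j<N. (\<lambda>w. X w $$ (i,j)) \<in> borel_measurable M)"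

lemma meas_mat_const: "X \<in> carrier_mat N N \<Longrightarrow> meas_mat N M (\<lambda>_. X)"
  by (simp add: meas_mat_def)

lemma meas_mat_mult:
  assumes "meas_mat N M X" "meas_mat N M Y"
  shows "meas_mat N M (\<lambda>w. X w * Y w)"
proof -
  have "(\<lambda>w. (X w * Y w) $$ (i,j)) \<in> borel_measurable M" if "i < N" "j < N" for i j
  proof -
    have "(\<lambda>w. \<Sum>k<N. X w $$ (i,k) * Y w $$ (k,j)) \<in> borel_measurable M"
      using assms that by (intro borel_measurable_sum borel_measurable_times) (auto simp: meas_mat_def)
    then show ?thesis
      by (rule measurable_cong[THEN iffD1, rotated])
        (use assms that in \<open>simp add: meas_mat_def mult_entry[of _ N] del: index_mult_mat\<close>)
  qed
  then show ?thesis using assms by (simp add: meas_mat_def del: index_mult_mat)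
qed

lemma meas_mat_adj:
  assumes "meas_mat N M X"
  shows "meas_mat N M (\<lambda>w. adj (X w))"
proof -
  have "(\<lambda>w. adj (X w) $$ (i,j)) \<in> borel_measurable M" if "i < N" "j < N" for i j
  proof -
    have "(\<lambda>w. cnj (X w $$ (j,i))) \<in> borel_measurable M"
      using assms that by (intro borel_measurable_cnj) (auto simp: meas_mat_def)
    then show ?thesis
      by (rule measurable_cong[THEN iffD1, rotated])
        (use assms that in \<open>simp add: meas_mat_def adj_entry[of _ N]\<close>)
  qed
  then show ?thesis using assms by (simp add: meas_mat_def)
qed

lemma meas_mat_tr:
  assumes "meas_mat N M X"
  shows "(\<lambda>w. tr (X w)) \<in> borel_measurable M"
proof -
  have "(\<lambda>w. \<Sum>k<N. X w $$ (k,k)) \<in> borel_measurable M"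
    using assms by (intro borel_measurable_sum) (auto simp: meas_mat_def)
  then show ?thesis
    by (rule measurable_cong[THEN iffD1, rotated])
       (use assms in \<open>simp add: meas_mat_def tr_carrier[of _ N]\<close>)
qed

lemma meas_mat_wev:
  assumes "\<And>k. meas_mat N M (\<lambda>w. q w k)" "\<And>x. d x \<in> carrier_mat N N"
  shows "meas_mat N M (\<lambda>w. wev N (q w) d v)"
proof (induction v)
  case (Cons l v)
  have "meas_mat N M (\<lambda>w. lev (q w) d l)"
    by (cases l; cases "fst l") (auto intro!: meas_mat_mult meas_mat_const assms)
  then show ?case using Cons by (simp add: meas_mat_mult)
qed (simp add: meas_mat_const)

lemma traces_measurable:
  assumes "\<And>k. meas_mat N M (\<lambda>w. q w k)" "\<And>x. d x \<in> carrier_mat N N"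
  shows "(\<lambda>w. traces N (q w) d s) \<in> borel_measurable M"
proof (induction s)
  case (Cons v s)
  then show ?case using meas_mat_tr[OF meas_mat_wev[OF assms, where v = v]]
    by (simp add: traces_def)
qed (simp add: traces_def)

lemma mat_entries: "X \<in> carrier_mat N N \<Longrightarrow> mat N N (entries N X) = X"
  by (rule eq_matI) (auto simp: entries_def)

text \<open>Haar invariance is an equality of laws of entry functions on \<open>mat_space\<close>.
  Rebuilding the matrix with \<open>mat N N\<close> undoes \<open>entries\<close>, so
  \<open>G\<close> can be integrated against these laws.\<close>

lemma haar_invariant_expectation:
  fixes G :: "complex mat \<Rightarrow> complex"
  assumes haar: "haar_random rc M N U" and W: "unitary_mat N W" "rc \<Longrightarrow> real_mat W"
    and G: "(\<lambda>e. G (mat N N e)) \<in> borel_measurable (mat_space N)"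
  shows "(\<integral>w. G (W * U w) \<partial>M) = (\<integral>w. G (U w) \<partial>M)"
proof -
  have Uc: "U w \<in> carrier_mat N N" if "w \<in> space M" for w
    using haar that by (auto simp: haar_random_def unitary_mat_def)
  have Wc: "W \<in> carrier_mat N N" using W by (simp add: unitary_mat_def)
  have U: "meas_mat N M U" using haar Uc by (auto simp: meas_mat_def haar_random_def)
  have ent: "(\<lambda>w. entries N (X w)) \<in> measurable M (mat_space N)" if "meas_mat N M X" for X
    unfolding entries_def mat_space_def using that by (intro measurable_restrict) (auto simp: meas_mat_def)
  have WU: "meas_mat N M (\<lambda>w. W * U w)" using U Wc by (intro meas_mat_mult meas_mat_const)
  have eq: "(\<integral>w. G (X w) \<partial>M) = (\<integral>e. G (mat N N e) \<partial>distr M (mat_space N) (\<lambda>w. entries N (X w)))" if "meas_mat N M X" for X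
    unfolding integral_distr[OF ent[OF that] G]
    using that by (intro Bochner_Integration.integral_cong) (auto simp: mat_entries meas_mat_def)
  show ?thesis
    unfolding eq[OF WU] eq[OF U] using haar W by (simp add: haar_random_def)
qed

lemma (in word_model) dtraces_Cons:
  "dtraces x y (w # s) = (\<Sum>c<N. \<Sum>p<length w. dsp x y w c c p) * trs s
     + tr (wd w) * dtraces x y s"
  unfolding dtraces_def length_Cons sum.lessThan_Suc_shift
  by (simp add: traces_Cons sum_distrib_left mult_ac)

lemma (in word_model) tr_dwev:
  assumes "H \<in> carrier_mat N N"
  shows "tr (dwev N q d H w) = (\<Sum>x<N. \<Sum>y<N. H $$ (x,y) * (\<Sum>c<N. \<Sum>p<length w. dsp x y w c c p))"
proof -
  have "tr (dwev N q d H w) = (\<Sum>c<N. \<Sum>x<N. \<Sum>y<N. H $$ (x,y) * (\<Sum>p<length w. dsp x y w c c p))"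
    using assms by (simp add: tr_carrier[of _ N] dwev_entry)
  also have "\<dots> = (\<Sum>x<N. \<Sum>y<N. \<Sum>c<N. H $$ (x,y) * (\<Sum>p<length w. dsp x y w c c p))"
    by (intro trans[OF sum.swap sum.cong[OF refl]] sum.swap)
  finally show ?thesis by (simp add: sum_distrib_left)
qed

section \<open>Integration by parts at fixed size\<close>

locale haar_words = prob_space M for M :: "'w measure" +
  fixes rc :: bool and N :: nat and U :: "'w \<Rightarrow> complex mat" and b :: "nat \<Rightarrow> complex mat"
    and d :: "'d \<Rightarrow> complex mat" and star :: "'d \<Rightarrow> 'd"
  assumes haar: "haar_random rc M N U"
    and b_carrier [simp]: "b k \<in> carrier_mat N N" and d_carrier [simp]: "d x \<in> carrier_mat N N"
    and adj_b: "adj (b k) = b k" and adj_d: "adj (d x) = d (star x)" and tr_b: "tr (b k) = 0"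
    and real_b: "rc \<Longrightarrow> real_mat (b k)" and real_d: "rc \<Longrightarrow> real_mat (d x)"
begin

abbreviation q :: "'w \<Rightarrow> nat \<Rightarrow> complex mat" where "q w \<equiv> conj_by b (U w)"
abbreviation "qev w \<equiv> wev N (q w) d"
abbreviation "qtrs w \<equiv> traces N (q w) d"
abbreviation "qdsp w \<equiv> dsplit N (q w) d"
abbreviation "qdtraces w \<equiv> word_model.dtraces N (q w) d"
abbreviation "qdentry w \<equiv> word_model.dentry N (q w) d"

lemma U_unitary: "w \<in> space M \<Longrightarrow> unitary_mat N (U w)"
  and U_carrier [simp]: "w \<in> space M \<Longrightarrow> U w \<in> carrier_mat N N"
  and U_real: "w \<in> space M \<Longrightarrow> rc \<Longrightarrow> real_mat (U w)"
  using haar by (auto simp: haar_random_def unitary_mat_def)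

lemma q_carrier [simp]: "w \<in> space M \<Longrightarrow> q w k \<in> carrier_mat N N"
  by (simp add: conj_by_def)

lemma adj_real: "X \<in> carrier_mat N N \<Longrightarrow> real_mat X \<Longrightarrow> real_mat (adj X)"
  by (auto simp: real_mat_def adj_def Reals_cnj_iff)

lemma herm_model: "w \<in> space M \<Longrightarrow> herm_word_model N (q w) d star"
proof
  fix k assume w: "w \<in> space M"
  show "adj (q w k) = q w k"
    using w by (simp add: conj_by_def adj_mult[of _ N] adj_b assoc_mult_mat[of _ N N _ N _ N])
qed (simp_all add: adj_d)

lemma model: "w \<in> space M \<Longrightarrow> word_model N (q w) d"
  using herm_model by (simp add: herm_word_model_def)

lemma real_model: "w \<in> space M \<Longrightarrow> rc \<Longrightarrow> real_word_model N (q w) d star"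
proof -
  assume w: "w \<in> space M" and rc: rc
  interpret herm_word_model N "q w" d star by (rule herm_model[OF w])
  show ?thesis
    by unfold_locales
     (use w rc in \<open>auto simp: conj_by_def real_d intro!: real_mat_mult[of _ N] U_real real_b adj_real\<close>)
qed

lemma tr_q: "w \<in> space M \<Longrightarrow> tr (q w k) = 0"
proof -
  assume w: "w \<in> space M"
  have "tr (q w k) = tr (adj (U w) * (U w * b k))"
    unfolding conj_by_def using w by (intro tr_mult_comm[of _ N]) auto
  also have "adj (U w) * (U w * b k) = adj (U w) * U w * b k"
    using w by (intro assoc_mult_mat[symmetric, of _ N N _ N _ N]) auto
  also have "\<dots> = b k" using U_unitary[OF w] by (simp add: unitary_mat_def left_mult_one_mat[of _ N N])
  finally show ?thesis by (simp add: tr_b)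
qed

text \<open>Rows of a unitary matrix have norm one. At fixed \<open>N\<close> all polynomials in the
  entries are therefore bounded, which settles integrability of everything below.\<close>

lemma cmod_U_le_1:
  assumes w: "w \<in> space M" and ij: "i < N" "j < N"
  shows "cmod (U w $$ (i,j)) \<le> 1"
proof -
  have "(U w * adj (U w)) $$ (i,i) = 1" using U_unitary[OF w] ij by (simp add: unitary_mat_def)
  then have "(\<Sum>k<N. U w $$ (i,k) * cnj (U w $$ (i,k))) = 1"
    using w ij by (simp add: mult_entry[of _ N] adj_entry[of _ N] del: index_mult_mat)
  then have "(\<Sum>k<N. complex_of_real ((cmod (U w $$ (i,k)))\<^sup>2)) = complex_of_real 1"
    unfolding complex_norm_square by simp
  then have "(\<Sum>k<N. (cmod (U w $$ (i,k)))\<^sup>2) = 1"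
    unfolding of_real_sum[symmetric] of_real_eq_iff .
  moreover have "(cmod (U w $$ (i,j)))\<^sup>2 \<le> (\<Sum>k<N. (cmod (U w $$ (i,k)))\<^sup>2)"
    using ij by (intro member_le_sum) auto
  ultimately show ?thesis by (simp add: power_le_one_iff abs_square_le_1)
qed

lemma U_bdd_meas: "i < N \<Longrightarrow> j < N \<Longrightarrow> bdd_meas M (\<lambda>w. U w $$ (i,j))"
  using haar cmod_U_le_1 by (auto simp: bdd_meas_def haar_random_def)

lemma q_entry:
  assumes "w \<in> space M" "i < N" "j < N"
  shows "q w k $$ (i,j) = (\<Sum>y<N. (\<Sum>x<N. U w $$ (i,x) * b k $$ (x,y)) * cnj (U w $$ (j,y)))"
  using assms unfolding conj_by_def
  by (simp add: mult_entry[of _ N] adj_entry[of _ N] del: index_mult_mat)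

lemma q_bdd_meas: assumes "i < N" "j < N" shows "bdd_meas M (\<lambda>w. q w k $$ (i,j))"
proof -
  have "bdd_meas M (\<lambda>w. \<Sum>y<N. (\<Sum>x<N. U w $$ (i,x) * b k $$ (x,y)) * cnj (U w $$ (j,y)))"
    using assms by (intro bdd_meas_sum bdd_meas_mult bdd_meas_cnj U_bdd_meas) auto
  then show ?thesis using q_entry assms by (subst bdd_meas_cong) auto
qed

lemma first_order_mat_q_const: "first_order_mat N M (\<lambda>_ w. q w k) (\<lambda>w. q w k) (\<lambda>_. 0\<^sub>m N N)"
proof (rule first_order_matI)
  fix i j assume "i < N" "j < N"
  then show "first_order M (\<lambda>\<theta> w. q w k $$ (i,j)) (\<lambda>w. q w k $$ (i,j)) (\<lambda>w. 0\<^sub>m N N $$ (i,j))"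
    using first_order_const[OF q_bdd_meas] by simp
qed simp_all

context
  fixes h p :: "nat \<Rightarrow> nat \<Rightarrow> complex"
  assumes rot: "rot_pair N h p"
begin

abbreviation "W \<equiv> Wmat N h p"
abbreviation "H \<equiv> mat N N (\<lambda>(i,j). h i j)"
abbreviation "qW \<theta> w \<equiv> conj_by b (W \<theta> * U w)"

lemma qW: "w \<in> space M \<Longrightarrow> qW \<theta> w k = W \<theta> * q w k * Wmat N (\<lambda>i j. - h i j) p \<theta>"
  by (simp add: conj_by_def adj_mult[of _ N] adj_Wmat[OF rot] assoc_mult_mat[of _ N N _ N _ N])

lemma first_order_mat_qW: "first_order_mat N M (\<lambda>\<theta> w. qW \<theta> w k) (\<lambda>w. q w k) (\<lambda>w. H * q w k - q w k * H)"
proof (rule first_order_mat_cong[OF first_order_mat_mult[OF first_order_mat_mult[OF first_order_mat_Wmat first_order_mat_q_const] first_order_mat_Wmat]])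
  fix w assume w: "w \<in> space M"
  let ?H' = "mat N N (\<lambda>(i,j). - h i j)"
  have H'c: "?H' \<in> carrier_mat N N" and Hc: "H \<in> carrier_mat N N" by simp_all
  have *: "q w k * ?H' = - (q w k * H)"
  proof (rule eq_matI)
    fix i j assume "i < dim_row (- (q w k * H))" "j < dim_col (- (q w k * H))"
    then have ij: "i < N" "j < N" using q_carrier[OF w, of k] by auto
    then have "(q w k * ?H') $$ (i,j) = - ((q w k * H) $$ (i,j))"
      unfolding mult_entry[OF q_carrier[OF w] Hc ij] mult_entry[OF q_carrier[OF w] H'c ij]
      by (simp add: sum_negf)
    then show "(q w k * ?H') $$ (i,j) = (- (q w k * H)) $$ (i,j)"
      using ij q_carrier[OF w, of k] by (auto simp del: index_mult_mat(1))
  qed (use q_carrier[OF w, of k] in auto)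
  have "(H * q w k + 1\<^sub>m N * 0\<^sub>m N N) * 1\<^sub>m N + 1\<^sub>m N * q w k * ?H' = H * q w k + - (q w k * H)"
    using q_carrier[OF w, of k] mult_square_carrier[OF Hc q_carrier[OF w, of k]]
    by (simp add: * left_mult_one_mat[of _ N N] right_mult_one_mat[of _ N N] right_add_zero_mat[of _ N N])
  also have "\<dots> = H * q w k - q w k * H"
    using q_carrier[OF w, of k] by (intro eq_matI) auto
  finally show "(H * q w k + 1\<^sub>m N * 0\<^sub>m N N) * 1\<^sub>m N + 1\<^sub>m N * q w k * ?H' = H * q w k - q w k * H" .
  show "1\<^sub>m N * q w k * 1\<^sub>m N = q w k" using q_carrier[OF w, of k] by simp
qed (simp add: qW)

lemma first_order_mat_wevW: "first_order_mat N M (\<lambda>\<theta> w. wev N (qW \<theta> w) d v) (\<lambda>w. qev w v) (\<lambda>w. dwev N (q w) d H v)"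
proof (induction v)
  case Nil
  then show ?case by (simp add: first_order_mat_const)
next
  case (Cons l v)
  have "first_order_mat N M (\<lambda>\<theta> w. lev (qW \<theta> w) d l) (\<lambda>w. lev (q w) d l) (\<lambda>w. dlev N (q w) d H l)"
  proof (cases l)
    case (Pair o' u)
    show ?thesis
    proof (cases o')
      case None
      then show ?thesis using Pair by (simp add: first_order_mat_const)
    next
      case (Some k)
      have "first_order_mat N M (\<lambda>\<theta> w. qW \<theta> w k * d u) (\<lambda>w. q w k * d u) (\<lambda>w. (H * q w k - q w k * H) * d u)"
      proof (rule first_order_mat_cong[OF first_order_mat_mult[OF first_order_mat_qW first_order_mat_const[OF d_carrier]]])
        fix w assume w: "w \<in> space M"
        have c: "(H * q w k - q w k * H) * d u \<in> carrier_mat N N" 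
          using w by (intro mult_square_carrier minus_square_carrier) auto
        show "(H * q w k - q w k * H) * d u + q w k * 0\<^sub>m N N = (H * q w k - q w k * H) * d u"
          using right_mult_zero_mat[OF q_carrier[OF w]] right_add_zero_mat[OF c] by simp
      qed simp_all
      then show ?thesis using Pair Some by simp
    qed
  qed
  from first_order_mat_mult[OF this Cons.IH] show ?case by simp
qed

lemma first_order_tracesW: "first_order M (\<lambda>\<theta> w. traces N (qW \<theta> w) d s) (\<lambda>w. qtrs w s)
   (\<lambda>w. \<Sum>x<N. \<Sum>y<N. H $$ (x,y) * qdtraces w x y s)"
proof (induction s)
  case Nil
  show ?case
    by (rule first_order_cong[OF first_order_const[OF bdd_meas_const, of _ 1]])
      (simp_all add: traces_def word_model.dtraces_def[OF model])
next
  case (Cons v s)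
  show ?case
  proof (rule first_order_cong[OF first_order_mult[OF first_order_tr[OF first_order_mat_wevW] Cons.IH]])
    fix w assume w: "w \<in> space M"
    interpret word_model N "q w" d by (rule model[OF w])
    have Hc: "H \<in> carrier_mat N N" by simp
    show "tr (dwev N (q w) d H v) * qtrs w s + tr (qev w v) * (\<Sum>x<N. \<Sum>y<N. H $$ (x,y) * dtraces x y s)
      = (\<Sum>x<N. \<Sum>y<N. H $$ (x,y) * dtraces x y (v # s))"
      unfolding tr_dwev[OF Hc] dtraces_Cons
      by (simp add: sum_distrib_right sum_distrib_left distrib_left sum.distrib mult_ac)
  qed (simp_all add: traces_def)
qed

lemma first_order_entryW:
  assumes "a < N" "c < N"
  shows "first_order M (\<lambda>\<theta> w. wev N (qW \<theta> w) d v $$ (a,c) * traces N (qW \<theta> w) d s) (\<lambda>w. qev w v $$ (a,c) * qtrs w s)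
   (\<lambda>w. \<Sum>x<N. \<Sum>y<N. h x y * qdentry w v s a c x y)"
proof (rule first_order_cong[OF first_order_mult[OF first_order_matD(4)[OF first_order_mat_wevW assms] first_order_tracesW]])
  fix w assume w: "w \<in> space M"
  interpret word_model N "q w" d by (rule model[OF w])
  have Hc: "H \<in> carrier_mat N N" by simp
  have "dwev N (q w) d H v $$ (a,c) * qtrs w s + qev w v $$ (a,c) * (\<Sum>x<N. \<Sum>y<N. H $$ (x,y) * dtraces x y s)
    = (\<Sum>x<N. \<Sum>y<N. H $$ (x,y) * dentry v s a c x y)"
    unfolding dwev_entry[OF Hc assms] dentry_def
    by (simp add: sum_distrib_right sum_distrib_left distrib_left sum.distrib mult_ac)
  also have "\<dots> = (\<Sum>x<N. \<Sum>y<N. h x y * dentry v s a c x y)" by (intro sum.cong) auto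
  finally show "dwev N (q w) d H v $$ (a,c) * qtrs w s + qev w v $$ (a,c) * (\<Sum>x<N. \<Sum>y<N. H $$ (x,y) * dtraces x y s)
    = (\<Sum>x<N. \<Sum>y<N. h x y * dentry v s a c x y)" .
qed simp_all

text \<open>By left invariance the expectation taken at \<open>W \<theta> * U\<close> does not
  depend on \<theta>, so its first-order coefficient vanishes.\<close>

lemma expectation_derivative_0:
  assumes "a < N" "c < N" and real: "rc \<Longrightarrow> (\<forall>i j. h i j \<in> \<real> \<and> p i j \<in> \<real>)"
  shows "(\<integral>w. (\<Sum>x<N. \<Sum>y<N. h x y * qdentry w v s a c x y) \<partial>M) = 0"
proof (rule first_order_expectation_eq_0[OF first_order_entryW[OF assms(1,2)]])
  fix \<theta> :: real assume t: "\<theta> \<in> {0..1}"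
  define G where "G X = wev N (conj_by b X) d v $$ (a,c) * traces N (conj_by b X) d s" for X
  have "meas_mat N (mat_space N) (\<lambda>e. mat N N e)"
    unfolding meas_mat_def mat_space_def by (auto intro!: measurable_component_singleton)
  then have m: "meas_mat N (mat_space N) (\<lambda>e. conj_by b (mat N N e) k)" for k
    unfolding conj_by_def by (intro meas_mat_mult meas_mat_const meas_mat_adj) auto
  have "(\<lambda>e. G (mat N N e)) \<in> borel_measurable (mat_space N)"
    unfolding G_def using meas_mat_wev[OF m d_carrier, where v = v] traces_measurable[OF m d_carrier, where s = s] assms
    by (intro borel_measurable_times) (auto simp: meas_mat_def)
  then have "(\<integral>w. G (W \<theta> * U w) \<partial>M) = (\<integral>w. G (U w) \<partial>M)"
    using real by (intro haar_invariant_expectation[OF haar unitary_Wmat[OF rot t]] real_Wmat) auto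
  then show "(\<integral>w. wev N (qW \<theta> w) d v $$ (a,c) * traces N (qW \<theta> w) d s \<partial>M)
      = (\<integral>w. qev w v $$ (a,c) * qtrs w s \<partial>M)"
    by (simp add: G_def)
qed

end

lemma wev_bdd_meas: assumes "i < N" "j < N" shows "bdd_meas M (\<lambda>w. qev w v $$ (i,j))"
  using assms
proof (induction v arbitrary: i j)
  case (Cons l v)
  have 1: "bdd_meas M (\<lambda>w. lev (q w) d l $$ (i,k))" if "k < N" for k
  proof (cases "fst l")
    case (Some m)
    have "bdd_meas M (\<lambda>w. \<Sum>x<N. q w m $$ (i,x) * d (snd l) $$ (x,k))"
      using Cons.prems by (intro bdd_meas_sum bdd_meas_mult q_bdd_meas) auto
    then show ?thesis
      by (rule bdd_meas_cong[THEN iffD1, rotated]) (use Some that Cons.prems in \<open>cases l, simp add: mult_entry[of _ N] del: index_mult_mat\<close>)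
  qed (cases l, simp)
  have "bdd_meas M (\<lambda>w. \<Sum>x<N. lev (q w) d l $$ (i,x) * qev w v $$ (x,j))"
    using Cons.prems by (intro bdd_meas_sum bdd_meas_mult Cons.IH 1) auto
  then show ?case
  proof (rule bdd_meas_cong[THEN iffD1, rotated])
    fix w assume w: "w \<in> space M"
    interpret word_model N "q w" d by (rule model[OF w])
    show "(\<Sum>x<N. lev (q w) d l $$ (i,x) * qev w v $$ (x,j)) = qev w (l # v) $$ (i,j)"
      using Cons.prems by (simp add: mult_entry[of _ N] del: index_mult_mat)
  qed
qed simp

lemma tr_wev_bdd_meas: "bdd_meas M (\<lambda>w. tr (qev w v))"
proof -
  have "bdd_meas M (\<lambda>w. \<Sum>i<N. qev w v $$ (i,i))" by (intro bdd_meas_sum wev_bdd_meas) auto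
  then show ?thesis
    by (rule bdd_meas_cong[THEN iffD1, rotated]) (simp add: tr_carrier[OF word_model.wev_carrier[OF model]])
qed

lemma traces_bdd_meas: "bdd_meas M (\<lambda>w. qtrs w s)"
  by (induction s) (auto simp: traces_def intro!: bdd_meas_mult tr_wev_bdd_meas)

lemma dsplit_bdd_meas:
  assumes "x < N" "y < N" "c < N" "e < N"
  shows "bdd_meas M (\<lambda>w. qdsp w x y v c e r)"
proof (cases "fst (v ! r)")
  case (Some k)
  have "bdd_meas M (\<lambda>w. \<Sum>f<N. qev w (take r v) $$ (c,f) * q w k $$ (f,x))"
    using assms by (intro bdd_meas_sum bdd_meas_mult q_bdd_meas wev_bdd_meas) auto
  then have "bdd_meas M (\<lambda>w. (qev w (take r v) * q w k) $$ (c,x))"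
    by (rule bdd_meas_cong[THEN iffD1, rotated]) (use assms in \<open>simp add: mult_entry[OF word_model.wev_carrier[OF model] q_carrier]\<close>)
  then show ?thesis unfolding dsplit_def Some option.case
    using assms by (intro bdd_meas_diff bdd_meas_mult wev_bdd_meas)
qed (simp add: dsplit_def)

lemma dentry_bdd_meas:
  assumes "x < N" "y < N" "a < N" "c < N"
  shows "bdd_meas M (\<lambda>w. qdentry w v s a c x y)"
proof -
  have "bdd_meas M (\<lambda>w. (\<Sum>p<length v. qdsp w x y v a c p) * qtrs w s
      + qev w v $$ (a,c) * (\<Sum>i<length s. (\<Sum>c<N. \<Sum>p<length (s ! i). qdsp w x y (s ! i) c c p)
      * qtrs w (take i s @ drop (Suc i) s)))"
    using assms by (intro bdd_meas_add bdd_meas_mult bdd_meas_sum dsplit_bdd_meas wev_bdd_meas traces_bdd_meas) auto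
  then show ?thesis
    by (rule bdd_meas_cong[THEN iffD1, rotated])
      (simp add: word_model.dentry_def[OF model] word_model.dtraces_def[OF model])
qed

text \<open>With \<open>D x y\<close> the expected derivative along \<open>E_xy\<close>, a rotation
  with phase \<alpha> gives \<open>\<alpha> * D x y = cnj \<alpha> * D y x\<close>. The phase 1
  shows that \<open>D\<close> is symmetric; in the unitary case the phase \<open>i\<close> shows
  that it is also antisymmetric.\<close>

lemma expectation_dentry:
  assumes "x < N" "y < N" "a < N" "c < N"
  shows "(\<integral>w. qdentry w v s a c x y \<partial>M) =
    (if rc then (\<integral>w. qdentry w v s a c y x \<partial>M) else 0)"
proof -
  define D where "D x y = (\<integral>w. qdentry w v s a c x y \<partial>M)" for x y
  have lin: "(\<integral>w. (\<Sum>x<N. \<Sum>y<N. h x y * qdentry w v s a c x y) \<partial>M) = (\<Sum>x<N. \<Sum>y<N. h x y * D x y)" for h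
  proof -
    have i: "integrable M (\<lambda>w. h x y * qdentry w v s a c x y)" if "x < N" "y < N" for x y
      using assms that by (intro integrable_mult_right bdd_meas_integrable dentry_bdd_meas)
    have "(\<integral>w. (\<Sum>x<N. \<Sum>y<N. h x y * qdentry w v s a c x y) \<partial>M)
      = (\<Sum>x<N. \<integral>w. (\<Sum>y<N. h x y * qdentry w v s a c x y) \<partial>M)"
      by (rule Bochner_Integration.integral_sum) (auto intro!: Bochner_Integration.integrable_sum i)
    also have "\<dots> = (\<Sum>x<N. \<Sum>y<N. \<integral>w. h x y * qdentry w v s a c x y \<partial>M)"
      by (intro sum.cong refl Bochner_Integration.integral_sum) (auto intro!: i)
    finally show ?thesis by (simp add: D_def)
  qed
  have off: "\<alpha> * D x y = cnj \<alpha> * D y x" if "x \<noteq> y" "\<alpha> * cnj \<alpha> = 1" "rc \<Longrightarrow> \<alpha> \<in> \<real>" for \<alpha>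
  proof -
    have "(\<Sum>i<N. \<Sum>j<N. (\<alpha> * of_bool (i = x \<and> j = y) - cnj \<alpha> * of_bool (i = y \<and> j = x)) * D i j) = 0"
      unfolding lin[symmetric] using assms that
      by (intro expectation_derivative_0[OF rot_pair_offdiag]) (auto intro!: Reals_diff Reals_mult simp: Reals_cnj_iff)
    also have "(\<Sum>i<N. \<Sum>j<N. (\<alpha> * of_bool (i = x \<and> j = y) - cnj \<alpha> * of_bool (i = y \<and> j = x)) * D i j) = \<alpha> * D x y - cnj \<alpha> * D y x"
      using assms that(1) by (simp add: sum_two_points[of x N y])
    finally show ?thesis by simp
  qed
  have diag: "\<i> * D x x = 0" if "\<not> rc"
  proof -
    have s: "(\<Sum>k<N. f k) = f x" if "\<And>k. k \<noteq> x \<Longrightarrow> f k = 0" for f :: "nat \<Rightarrow> complex"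
    proof -
      have "(\<Sum>k<N. f k) = (\<Sum>k\<in>{x}. f k)"
        using assms that by (intro sum.mono_neutral_right) auto
      then show ?thesis by simp
    qed
    have "(\<Sum>i<N. \<Sum>j<N. (\<i> * of_bool (i = x \<and> j = x)) * D i j) = 0"
      unfolding lin[symmetric] using assms that
      by (intro expectation_derivative_0[OF rot_pair_diag]) auto
    also have "(\<Sum>i<N. \<Sum>j<N. (\<i> * of_bool (i = x \<and> j = x)) * D i j) = \<i> * D x x"
      by (subst s, simp, subst s) auto
    finally show ?thesis .
  qed
  show ?thesis
  proof (cases "x = y")
    case True
    then show ?thesis using diag by (auto simp: D_def)
  next
    case False
    have 1: "D x y = D y x" using off[of 1] False by simp
    have "\<i> * D x y = \<i> * (- D y x)" if "\<not> rc" using off[of \<i>] False that by simp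
    then have "\<not> rc \<Longrightarrow> D x y = - D y x" by (metis complex_i_not_zero mult_left_cancel)
    then show ?thesis using 1 by (auto simp: D_def)
  qed
qed

lemma expectation_loop:
  "(\<integral>w. (\<Sum>a<N. \<Sum>c<N. qdentry w v s a c a c) \<partial>M) =
   (if rc then (\<integral>w. (\<Sum>a<N. \<Sum>c<N. qdentry w v s a c c a) \<partial>M) else 0)"
proof -
  have lin: "(\<integral>w. (\<Sum>a<N. \<Sum>c<N. qdentry w v s a c (f a c) (g a c)) \<partial>M)
      = (\<Sum>a<N. \<Sum>c<N. \<integral>w. qdentry w v s a c (f a c) (g a c) \<partial>M)"
    if "\<And>a c. a < N \<Longrightarrow> c < N \<Longrightarrow> f a c < N" "\<And>a c. a < N \<Longrightarrow> c < N \<Longrightarrow> g a c < N" for f g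
  proof -
    have i: "integrable M (\<lambda>w. qdentry w v s a c (f a c) (g a c))" if "a < N" "c < N" for a c
      using that \<open>\<And>a c. a < N \<Longrightarrow> c < N \<Longrightarrow> f a c < N\<close> \<open>\<And>a c. a < N \<Longrightarrow> c < N \<Longrightarrow> g a c < N\<close>
      by (intro bdd_meas_integrable dentry_bdd_meas)
    have "(\<integral>w. (\<Sum>a<N. \<Sum>c<N. qdentry w v s a c (f a c) (g a c)) \<partial>M)
      = (\<Sum>a<N. \<integral>w. (\<Sum>c<N. qdentry w v s a c (f a c) (g a c)) \<partial>M)"
      by (rule Bochner_Integration.integral_sum) (auto intro!: Bochner_Integration.integrable_sum i)
    also have "\<dots> = (\<Sum>a<N. \<Sum>c<N. \<integral>w. qdentry w v s a c (f a c) (g a c) \<partial>M)"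
      by (intro sum.cong refl Bochner_Integration.integral_sum) (auto intro!: i)
    finally show ?thesis .
  qed
  have "(\<Sum>a<N. \<Sum>c<N. \<integral>w. qdentry w v s a c a c \<partial>M) =
     (\<Sum>a<N. \<Sum>c<N. if rc then (\<integral>w. qdentry w v s a c c a \<partial>M) else 0)"
    by (intro sum.cong refl expectation_dentry) auto
  then show ?thesis
    using lin[of "\<lambda>a c. a" "\<lambda>a c. c"] lin[of "\<lambda>a c. c" "\<lambda>a c. a"]
    by auto
qed

end

section \<open>Orders of magnitude of expected products of traces\<close>

definition bigo :: "(nat \<Rightarrow> real) \<Rightarrow> (nat \<Rightarrow> complex) \<Rightarrow> bool" where
  "bigo h f \<longleftrightarrow> (\<exists>C\<ge>0. \<forall>\<^sub>F N in sequentially. cmod (f N) \<le> C * h N)"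

lemma bigo_add: assumes "bigo h f" "bigo h g" shows "bigo h (\<lambda>N. f N + g N)"
proof -
  from assms obtain C D where "C \<ge> 0" "D \<ge> 0" and 1: "\<forall>\<^sub>F N in sequentially. cmod (f N) \<le> C * h N"
     and 2: "\<forall>\<^sub>F N in sequentially. cmod (g N) \<le> D * h N" unfolding bigo_def by blast
  have "\<forall>\<^sub>F N in sequentially. cmod (f N + g N) \<le> (C + D) * h N"
    using 1 2
  proof eventually_elim
    case (elim N)
    then show ?case using norm_triangle_ineq[of "f N" "g N"] by (simp add: distrib_right)
  qed
  then show ?thesis using \<open>C \<ge> 0\<close> \<open>D \<ge> 0\<close> unfolding bigo_def by (intro exI[of _ "C + D"]) auto
qed

lemma bigo_uminus: "bigo h f \<Longrightarrow> bigo h (\<lambda>N. - f N)"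
  by (simp add: bigo_def)

lemma bigo_diff: "bigo h f \<Longrightarrow> bigo h g \<Longrightarrow> bigo h (\<lambda>N. f N - g N)"
  using bigo_add[of h f "\<lambda>N. - g N"] bigo_uminus[of h g] by simp

lemma bigo_mult: assumes "bigo h f" "bigo h' g" shows "bigo (\<lambda>N. h N * h' N) (\<lambda>N. f N * g N)"
proof -
  from assms obtain C D where "C \<ge> 0" "D \<ge> 0" and 1: "\<forall>\<^sub>F N in sequentially. cmod (f N) \<le> C * h N"
     and 2: "\<forall>\<^sub>F N in sequentially. cmod (g N) \<le> D * h' N" unfolding bigo_def by blast
  have "\<forall>\<^sub>F N in sequentially. cmod (f N * g N) \<le> (C * D) * (h N * h' N)"
    using 1 2
  proof eventually_elim
    case (elim N)
    have "cmod (f N * g N) \<le> (C * h N) * (D * h' N)"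
      unfolding norm_mult using elim by (intro mult_mono) (auto intro: order_trans[OF norm_ge_zero])
    then show ?case by (simp add: mult_ac)
  qed
  then show ?thesis using \<open>C \<ge> 0\<close> \<open>D \<ge> 0\<close> unfolding bigo_def by (intro exI[of _ "C * D"]) auto
qed

lemma bigo_mono:
  assumes "bigo h f" "\<forall>\<^sub>F N in sequentially. h N \<le> h' N"
  shows "bigo h' f"
proof -
  from assms obtain C where C: "C \<ge> 0" and 1: "\<forall>\<^sub>F N in sequentially. cmod (f N) \<le> C * h N" unfolding bigo_def by blast
  have "\<forall>\<^sub>F N in sequentially. cmod (f N) \<le> C * h' N"
    using 1 assms(2)
  proof eventually_elim
    case (elim N)
    then show ?case using mult_left_mono[OF elim(2) C] by linarith
  qed
  then show ?thesis using C unfolding bigo_def by blast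
qed

text \<open>Agreement starts at \<open>N = 1\<close> because the matrix hypotheses are made only
  there.\<close>

lemma bigo_cong:
  assumes "bigo h f" "\<And>N. N \<ge> 1 \<Longrightarrow> f N = g N"
  shows "bigo h g"
proof -
  from assms(1) obtain C where C: "C \<ge> 0" and 1: "\<forall>\<^sub>F N in sequentially. cmod (f N) \<le> C * h N"
    unfolding bigo_def by blast
  have "\<forall>\<^sub>F N in sequentially. cmod (g N) \<le> C * h N"
    using 1 eventually_ge_at_top[of 1] by eventually_elim (simp flip: assms(2))
  then show ?thesis using C unfolding bigo_def by blast
qed

lemma bigo_zero: "bigo h (\<lambda>_. 0)"
  unfolding bigo_def by (rule exI[of _ 0]) simp

lemma bigo_bounded_mult: "bigo (\<lambda>_. 1) c \<Longrightarrow> bigo h f \<Longrightarrow> bigo h (\<lambda>N. c N * f N)"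
  using bigo_mult[of "\<lambda>_. 1" c h f] by simp

lemma bigo_sum: "(\<And>i. i \<in> I \<Longrightarrow> bigo h (f i)) \<Longrightarrow> bigo h (\<lambda>N. \<Sum>i\<in>I. f i N)"
  by (induction I rule: infinite_finite_induct) (simp_all add: bigo_add bigo_zero)

lemma bigo_convergent: "f \<longlonglongrightarrow> l \<Longrightarrow> bigo (\<lambda>_. 1) f"
proof -
  assume "f \<longlonglongrightarrow> l"
  then have "Bseq f" by (intro convergent_imp_Bseq) (auto simp: convergent_def)
  then obtain K where "K > 0" "\<And>n. cmod (f n) \<le> K" unfolding Bseq_def by blast
  then show ?thesis unfolding bigo_def by (intro exI[of _ K]) auto
qed

section \<open>Letter counts and finite classes of products\<close>

definition num_random :: "'d word \<Rightarrow> nat" where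
  "num_random w = (\<Sum>l\<leftarrow>w. of_bool (fst l \<noteq> None))"

definition word_wt :: "('d \<Rightarrow> nat) \<Rightarrow> 'd word \<Rightarrow> nat" where
  "word_wt wt w = (\<Sum>l\<leftarrow>w. wt (snd l))"

lemma num_random_simps [simp]: "num_random [] = 0" "num_random (l # w) = of_bool (fst l \<noteq> None) + num_random w" "num_random (v @ w) = num_random v + num_random w"
  by (auto simp: num_random_def)

lemma word_wt_simps [simp]: "word_wt wt [] = 0" "word_wt wt (l # w) = wt (snd l) + word_wt wt w" "word_wt wt (v @ w) = word_wt wt v + word_wt wt w"
  by (auto simp: word_wt_def)

lemma num_random_eq_0: "num_random w = 0 \<longleftrightarrow> (\<forall>l\<in>set w. fst l = None)"
  by (auto simp: num_random_def)

lemma num_random_rev_word [simp]: "num_random (rev_word star u w) = num_random w"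
  by (induction w arbitrary: u) auto

lemma word_wt_rev_word: "(\<And>x. wt (star x) = wt x) \<Longrightarrow> word_wt wt (rev_word star u w) = wt u + word_wt wt w"
  by (induction w arbitrary: u) auto

lemma length_rev_word [simp]: "length (rev_word star u w) = Suc (length w)"
  by (induction w arbitrary: u) auto

lemma num_random_attach [simp]: "w \<noteq> [] \<Longrightarrow> fst (hd w) = None \<Longrightarrow> num_random (attach k w) = Suc (num_random w)"
  by (cases w) (auto simp: attach_def)

lemma word_wt_attach [simp]: "w \<noteq> [] \<Longrightarrow> word_wt wt (attach k w) = word_wt wt w"
  by (cases w) (auto simp: attach_def)

lemma length_attach [simp]: "w \<noteq> [] \<Longrightarrow> length (attach k w) = length w"
  by (cases w) (auto simp: attach_def)

lemma attach_nonempty [simp]: "attach k w \<noteq> []"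
  by (simp add: attach_def)

text \<open>One bound for the indices of random letters and the heights of deterministic ones: the
  alphabet becomes finite, and reversal does not leave it.\<close>

definition letter_le :: "('d \<Rightarrow> nat) \<Rightarrow> nat \<Rightarrow> nat option \<times> 'd \<Rightarrow> bool" where
  "letter_le ht K l \<longleftrightarrow> (\<forall>k. fst l = Some k \<longrightarrow> k \<le> K) \<and> ht (snd l) \<le> K"

lemma letter_le_rev_word:
  assumes star: "\<And>x. ht (star x) = ht x" and u: "ht u \<le> K" and w: "\<forall>l\<in>set w. letter_le ht K l"
  shows "\<forall>l\<in>set (rev_word star u w). letter_le ht K l"
  using u w
proof (induction w arbitrary: u)
  case Nil
  then show ?case by (simp add: letter_le_def star)
next
  case (Cons l w)
  have "\<forall>l\<in>set (rev_word star (snd l) w). letter_le ht K l"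
    using Cons.prems by (intro Cons.IH) (simp_all add: letter_le_def)
  moreover have "letter_le ht K (fst l, star u)" using Cons.prems by (simp add: letter_le_def star)
  ultimately show ?case by simp
qed

lemma letter_le_attach:
  assumes "w \<noteq> []" "k \<le> K" "\<forall>l\<in>set w. letter_le ht K l"
  shows "\<forall>l\<in>set (attach k w). letter_le ht K l"
proof (cases w)
  case (Cons l v)
  then have "letter_le ht K (Some k, snd l)" using assms by (simp add: letter_le_def)
  then show ?thesis using assms Cons by (simp add: attach_def)
qed (use assms in simp)

text \<open>A finite class of products of traces that is closed under the rewirings of the loop equations.\<close>

definition states :: "('d \<Rightarrow> nat) \<Rightarrow> ('d \<Rightarrow> nat) \<Rightarrow> nat \<Rightarrow> nat \<Rightarrow> nat \<Rightarrow> nat \<Rightarrow> 'd word list set" where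
  "states wt ht K L m n = {s. [] \<notin> set s \<and> length (concat s) = L \<and> num_random (concat s) = m \<and> word_wt wt (concat s) = n \<and>
      (\<forall>l\<in>set (concat s). letter_le ht K l)}"

lemma finite_states:
  assumes fin: "finite {x. ht x \<le> K}"
  shows "finite (states wt ht K L m n)"
proof -
  let ?A = "{l. letter_le ht K l}"
  have "?A \<subseteq> insert None (Some ` {..K}) \<times> {x. ht x \<le> K}"
  proof
    fix l assume "l \<in> ?A"
    then show "l \<in> insert None (Some ` {..K}) \<times> {x. ht x \<le> K}"
      by (cases l; cases "fst l") (auto simp: letter_le_def)
  qed
  then have A: "finite ?A" by (rule finite_subset) (use fin in auto)
  let ?W = "{w. set w \<subseteq> ?A \<and> length w \<le> L}"
  have W: "finite ?W" using A by (rule finite_lists_length_le)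
  \<comment> \<open>Without empty words the total length also bounds the number of words.\<close>
  have len: "length s \<le> length (concat s)" if "[] \<notin> set s" for s :: "'d word list"
    using that
  proof (induction s)
    case (Cons w s)
    then show ?case by (cases w) auto
  qed simp
  have "states wt ht K L m n \<subseteq> {s. set s \<subseteq> ?W \<and> length s \<le> L}"
  proof
    fix s assume s: "s \<in> states wt ht K L m n"
    have "length w \<le> length (concat s)" if "w \<in> set s" for w
      using that unfolding length_concat by (intro member_le_sum_list) auto
    then show "s \<in> {s. set s \<subseteq> ?W \<and> length s \<le> L}" using s len by (auto simp: states_def)
  qed
  then show ?thesis using finite_lists_length_le[OF W] finite_subset by blast
qed

lemma conj_by_mult:
  assumes X: "unitary_mat N X" and b: "\<And>k. b k \<in> carrier_mat N N"
  shows "conj_by b X k * conj_by b X l = X * (b k * b l) * adj X"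
proof -
  have c: "X \<in> carrier_mat N N" using X by (simp add: unitary_mat_def)
  have "conj_by b X k * conj_by b X l = X * b k * (adj X * X) * (b l * adj X)"
    unfolding conj_by_def using c b by (simp add: assoc_mult_mat[of _ N N _ N _ N])
  also have "\<dots> = X * b k * (b l * adj X)"
    using X c b by (simp add: unitary_mat_def right_mult_one_mat[of _ N N])
  finally show ?thesis using c b by (simp add: assoc_mult_mat[of _ N N _ N _ N])
qed

text \<open>\<open>b N k\<close> stands for a centered power with subtracted moment
  \<open>t N k\<close>, and \<open>b_mult\<close> is the expansion of a product of two of them.
  \<open>det_bound\<close> is the case without random letters; the weight \<open>wt\<close> lets
  rank one letters count 0, while \<open>ht\<close> serves to keep alphabets finite.\<close>

locale haar_sequence = prob_space M for M :: "'w measure" +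
  fixes rc :: bool and U :: "'w \<Rightarrow> nat \<Rightarrow> complex mat" and b :: "nat \<Rightarrow> nat \<Rightarrow> complex mat"
    and d :: "nat \<Rightarrow> 'd \<Rightarrow> complex mat" and star :: "'d \<Rightarrow> 'd" and t :: "nat \<Rightarrow> nat \<Rightarrow> complex"
    and wt ht :: "'d \<Rightarrow> nat"
  assumes haar_words: "N \<ge> 1 \<Longrightarrow> haar_words M rc N (\<lambda>w. U w N) (b N) (d N) star"
    and t_bounded: "bigo (\<lambda>_. 1) (\<lambda>N. t N k)"
    and b_mult: "N \<ge> 1 \<Longrightarrow> b N k * b N l =
        b N (k + l) - t N l \<cdot>\<^sub>m b N k - t N k \<cdot>\<^sub>m b N l + (t N (k + l) - t N k * t N l) \<cdot>\<^sub>m 1\<^sub>m N"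
    and wt_star [simp]: "wt (star x) = wt x" and ht_star [simp]: "ht (star x) = ht x"
    and finite_ht: "finite {x. ht x \<le> K}"
    and det_bound: "v \<noteq> [] \<Longrightarrow> \<forall>l\<in>set v. fst l = None \<Longrightarrow>
        bigo (\<lambda>N. real N powr (real (word_wt wt v) / 2)) (\<lambda>N. tr (wev N (b N) (d N) v))"
begin

abbreviation q :: "nat \<Rightarrow> 'w \<Rightarrow> nat \<Rightarrow> complex mat" where "q N w \<equiv> conj_by (b N) (U w N)"
abbreviation "qev N w \<equiv> wev N (q N w) (d N)"
abbreviation "qdentry N w \<equiv> word_model.dentry N (q N w) (d N)"

definition F :: "'d word list \<Rightarrow> nat \<Rightarrow> 'w \<Rightarrow> complex" where
  "F s N w = traces N (q N w) (d N) s"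

definition EF :: "'d word list \<Rightarrow> nat \<Rightarrow> complex" where
  "EF s N = (\<integral>w. F s N w \<partial>M)"

lemma model: "N \<ge> 1 \<Longrightarrow> w \<in> space M \<Longrightarrow> word_model N (q N w) (d N)"
  using haar_words.model[OF haar_words] .

lemma q_mult:
  assumes "N \<ge> 1" "w \<in> space M"
  shows "q N w k * q N w l =
    q N w (k + l) - t N l \<cdot>\<^sub>m q N w k - t N k \<cdot>\<^sub>m q N w l + (t N (k + l) - t N k * t N l) \<cdot>\<^sub>m 1\<^sub>m N"
proof -
  interpret hw: haar_words M rc N "\<lambda>w. U w N" "b N" "d N" star by (rule haar_words[OF assms(1)])
  let ?X = "U w N"
  have c: "?X \<in> carrier_mat N N" "adj ?X \<in> carrier_mat N N" using assms by auto
  have u: "?X * adj ?X = 1\<^sub>m N" using hw.U_unitary[OF assms(2)] by (simp add: unitary_mat_def)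
  have "q N w k * q N w l = ?X * (b N k * b N l) * adj ?X"
    by (rule conj_by_mult[OF hw.U_unitary[OF assms(2)]]) simp
  also have "\<dots> = ?X * b N (k + l) * adj ?X - t N l \<cdot>\<^sub>m (?X * b N k * adj ?X) - t N k \<cdot>\<^sub>m (?X * b N l * adj ?X)
      + (t N (k + l) - t N k * t N l) \<cdot>\<^sub>m (?X * adj ?X)"
    unfolding b_mult[OF assms(1)] using c
    by (simp add: mult_add_distrib_mat[of _ N N _ N] mult_minus_distrib_mat[of _ N N _ N] add_mult_distrib_mat[of _ N N _ _ N]
        minus_mult_distrib_mat[of _ N N _ _ N] mult_smult_distrib[of _ N N _ N] mult_smult_assoc_mat[of _ N N _ N]
        right_mult_one_mat[of _ N N])
  finally show ?thesis unfolding u conj_by_def .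
qed

text \<open>Adjacent random letters recombine linearly: three terms keep one random letter and the
  last keeps none, with coefficients built from bounded moments. A merger thus loses one or two
  random letters and no deterministic ones.\<close>

lemma tr_merge:
  assumes "N \<ge> 1" "w \<in> space M"
  shows "tr (q N w k * qev N w ((Some k1, u) # v)) * F s N w =
    F (((Some (k + k1), u) # v) # s) N w - t N k1 * F (((Some k, u) # v) # s) N w
     - t N k * F (((Some k1, u) # v) # s) N w + (t N (k + k1) - t N k * t N k1) * F (((None, u) # v) # s) N w"
proof -
  interpret word_model N "q N w" "d N" by (rule model[OF assms])
  define Z where "Z = qev N w ((None, u) # v)"
  have Z: "Z \<in> carrier_mat N N" unfolding Z_def by (rule wev_carrier)
  have "q N w k * qev N w ((Some k1, u) # v) = q N w k * q N w k1 * Z"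
    unfolding wev_None Z_def[symmetric] using Z by (simp add: assoc_mult_mat[of _ N N _ N _ N])
  also have "\<dots> = q N w (k + k1) * Z - t N k1 \<cdot>\<^sub>m (q N w k * Z) - t N k \<cdot>\<^sub>m (q N w k1 * Z) + (t N (k + k1) - t N k * t N k1) \<cdot>\<^sub>m Z"
    unfolding q_mult[OF assms] using Z
    by (simp add: add_mult_distrib_mat[of _ N N _ _ N] minus_mult_distrib_mat[of _ N N _ _ N]
       mult_smult_assoc_mat[of _ N N _ N] left_mult_one_mat[of _ N N])
  also have "tr \<dots> = tr (q N w (k + k1) * Z) - t N k1 * tr (q N w k * Z) - t N k * tr (q N w k1 * Z) + (t N (k + k1) - t N k * t N k1) * tr Z"
    using Z by (simp add: tr_add[of _ N] tr_minus[of _ N] tr_smult[of _ N])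
  finally have eq: "tr (q N w k * qev N w ((Some k1, u) # v)) = tr (q N w (k + k1) * Z)
    - t N k1 * tr (q N w k * Z) - t N k * tr (q N w k1 * Z) + (t N (k + k1) - t N k * t N k1) * tr Z" .
  show ?thesis unfolding eq F_def traces_Cons unfolding wev_None Z_def[symmetric]
    by (simp only: left_diff_distrib distrib_right mult.assoc)
qed

lemma F_bdd_meas: "N \<ge> 1 \<Longrightarrow> bdd_meas M (F s N)"
  unfolding F_def using haar_words.traces_bdd_meas[OF haar_words] .

lemma F_integrable: "N \<ge> 1 \<Longrightarrow> integrable M (F s N)"
  by (intro bdd_meas_integrable F_bdd_meas)

text \<open>Integrability is carried along so that the expectation of a loop equation can be split
  into its many terms.\<close>

definition rand_bigo :: "(nat \<Rightarrow> real) \<Rightarrow> (nat \<Rightarrow> 'w \<Rightarrow> complex) \<Rightarrow> bool" where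
  "rand_bigo h Z \<longleftrightarrow> (\<forall>N\<ge>1. integrable M (Z N)) \<and> bigo h (\<lambda>N. \<integral>w. Z N w \<partial>M)"

lemma rand_bigo_diff:
  assumes "rand_bigo h Y" "rand_bigo h Z"
  shows "rand_bigo h (\<lambda>N w. Y N w - Z N w)"
proof -
  have i: "integrable M (Y N)" "integrable M (Z N)" if "N \<ge> 1" for N using assms that by (auto simp: rand_bigo_def)
  have "bigo h (\<lambda>N. (\<integral>w. Y N w \<partial>M) - (\<integral>w. Z N w \<partial>M))" using assms by (intro bigo_diff) (auto simp: rand_bigo_def)
  then have "bigo h (\<lambda>N. \<integral>w. Y N w - Z N w \<partial>M)" by (rule bigo_cong) (simp add: i)
  then show ?thesis by (simp add: rand_bigo_def i)
qed

lemma rand_bigo_add: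
  assumes "rand_bigo h Y" "rand_bigo h Z"
  shows "rand_bigo h (\<lambda>N w. Y N w + Z N w)"
proof -
  have i: "integrable M (Y N)" "integrable M (Z N)" if "N \<ge> 1" for N using assms that by (auto simp: rand_bigo_def)
  have "bigo h (\<lambda>N. (\<integral>w. Y N w \<partial>M) + (\<integral>w. Z N w \<partial>M))" using assms by (intro bigo_add) (auto simp: rand_bigo_def)
  then have "bigo h (\<lambda>N. \<integral>w. Y N w + Z N w \<partial>M)" by (rule bigo_cong) (simp add: i)
  then show ?thesis by (simp add: rand_bigo_def i)
qed

lemma rand_bigo_zero: "rand_bigo h (\<lambda>N w. 0)"
  by (simp add: rand_bigo_def bigo_zero)

lemma rand_bigo_sum: "(\<And>i. i \<in> I \<Longrightarrow> rand_bigo h (Z i)) \<Longrightarrow> rand_bigo h (\<lambda>N w. \<Sum>i\<in>I. Z i N w)"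
  by (induction I rule: infinite_finite_induct) (simp_all add: rand_bigo_add rand_bigo_zero)

lemma rand_bigo_scale:
  assumes "bigo (\<lambda>_. 1) c" "rand_bigo h Z"
  shows "rand_bigo h (\<lambda>N w. c N * Z N w)"
proof -
  have "bigo h (\<lambda>N. c N * (\<integral>w. Z N w \<partial>M))" using assms by (intro bigo_bounded_mult) (auto simp: rand_bigo_def)
  then show ?thesis using assms(2) by (simp add: rand_bigo_def)
qed

lemma rand_bigo_cong:
  assumes Z: "rand_bigo h Z" and eq: "\<And>N w. N \<ge> 1 \<Longrightarrow> w \<in> space M \<Longrightarrow> Z N w = Y N w"
  shows "rand_bigo h Y"
proof -
  have "integrable M (Y N)" if "N \<ge> 1" for N
    using Z that Bochner_Integration.integrable_cong[of M M "Z N" "Y N", OF refl eq[OF that]] by (simp add: rand_bigo_def)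
  moreover have "bigo h (\<lambda>N. \<integral>w. Y N w \<partial>M)"
  proof (rule bigo_cong)
    show "bigo h (\<lambda>N. \<integral>w. Z N w \<partial>M)" using Z by (simp add: rand_bigo_def)
    show "(\<integral>w. Z N w \<partial>M) = (\<integral>w. Y N w \<partial>M)" if "N \<ge> 1" for N
      by (rule Bochner_Integration.integral_cong[OF refl eq[OF that]])
  qed
  ultimately show ?thesis by (simp add: rand_bigo_def)
qed

lemma rand_bigo_F: "bigo h (EF s) \<Longrightarrow> rand_bigo h (F s)"
  by (simp add: rand_bigo_def F_integrable EF_def[abs_def])

end

lemma wev_all_None:
  "\<forall>l\<in>set v. fst l = None \<Longrightarrow> wev N q d v = wev N q' d v"
proof (induction v)
  case (Cons l v)
  then show ?case by (cases l) simp
qed simp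

lemma split_at_Some:
  assumes "p < length R" "fst (R ! p) = Some k"
  obtains R1 u R2 where "R = R1 @ (Some k, u) # R2" "length R1 = p"
proof
  show "R = take p R @ (Some k, snd (R ! p)) # drop (Suc p) R"
    using assms id_take_nth_drop[OF assms(1)] by (metis prod.collapse)
qed (use assms in simp)

lemma split_state:
  assumes "i < length s"
  obtains s1 s2 where "s = s1 @ s ! i # s2" "length s1 = i"
  using id_take_nth_drop[OF assms] assms by (metis length_take min.absorb4)

lemma bigo_cmod: "bigo h f \<Longrightarrow> bigo h (\<lambda>N. of_real (cmod (f N)))"
  by (simp add: bigo_def)

text \<open>Once \<open>N \<ge> 2 * D\<close>, the term \<open>D * S N\<close> is at most half of
  the left side and can be moved there; this causes the factor 2.\<close>

lemma absorb_small_multiple: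
  fixes S g :: "nat \<Rightarrow> real"
  assumes D: "D \<ge> 0" and ev: "\<forall>\<^sub>F N in sequentially. real N * S N \<le> D * (S N + real N * g N)"
    and S: "\<And>N. S N \<ge> 0"
  shows "\<forall>\<^sub>F N in sequentially. S N \<le> 2 * D * g N"
  using ev eventually_ge_at_top[of "nat \<lceil>2 * D\<rceil> + 1"]
proof eventually_elim
  case (elim N)
  have N: "real N \<ge> 2 * D" "real N > 0" using elim(2) by linarith+
  have "2 * D * S N \<le> real N * S N" using N S by (intro mult_right_mono) auto
  then have "real N * S N \<le> real N * (2 * D * g N)" using elim(1) by (simp add: algebra_simps)
  then show ?case using N(2) mult_le_cancel_left_pos by blast
qed

context haar_sequence
begin

text \<open>Without random letters each trace is a constant, and the exponents of the factors add
  up.\<close>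

lemma det_order_bound:
  assumes "[] \<notin> set s" "num_random (concat s) = 0"
  shows "bigo (\<lambda>N. real N powr (real (word_wt wt (concat s)) / 2)) (EF s)"
proof -
  have "bigo (\<lambda>N. real N powr (real (word_wt wt (concat s)) / 2)) (\<lambda>N. traces N (b N) (d N) s)"
    using assms
  proof (induction s)
    case Nil
    have "bigo (\<lambda>N. 1) (\<lambda>N. 1)" unfolding bigo_def by (rule exI[of _ 1]) simp
    moreover have "\<forall>\<^sub>F N in sequentially. 1 \<le> real N powr 0"
      using eventually_gt_at_top[of 0] by eventually_elim simp
    ultimately show ?case by (simp add: traces_def bigo_mono)
  next
    case (Cons v s)
    have "bigo (\<lambda>N. real N powr (real (word_wt wt v) / 2) * real N powr (real (word_wt wt (concat s)) / 2))
      (\<lambda>N. tr (wev N (b N) (d N) v) * traces N (b N) (d N) s)"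
      using Cons by (intro bigo_mult det_bound Cons.IH) (auto simp: num_random_eq_0)
    then show ?case by (simp add: traces_def powr_add[symmetric] add_divide_distrib)
  qed
  moreover have "traces N (b N) (d N) s = EF s N" if "N \<ge> 1" for N
  proof -
    have "F s N w = traces N (b N) (d N) s" for w
    proof -
      have "qev N w v = wev N (b N) (d N) v" if "v \<in> set s" for v
        using assms that by (intro wev_all_None) (auto simp: num_random_eq_0)
      then show ?thesis unfolding F_def traces_def by (metis (mono_tags, lifting) map_cong)
    qed
    then show ?thesis by (simp add: EF_def prob_space)
  qed
  ultimately show ?thesis by (rule bigo_cong)
qed

lemma F_rotate:
  assumes "N \<ge> 1" "w \<in> space M"
  shows "F (s1 @ (v1 @ v2) # s2) N w = F ((v2 @ v1) # s1 @ s2) N w"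
proof -
  interpret word_model N "q N w" "d N" by (rule model[OF assms])
  show ?thesis unfolding F_def traces_append traces_Cons tr_wev_rotate[of v1 v2] by simp
qed

text \<open>The loop equation expresses \<open>N\<close> times the expectation by rewired products, which lie in the same finite class and
  are absorbed for large \<open>N\<close>, and by products in which two random letters merge and one or two of them are lost.\<close>

theorem order_bound:
  assumes "[] \<notin> set s"
  shows "bigo (\<lambda>N. real N powr ((real (word_wt wt (concat s)) - real (num_random (concat s))) / 2)) (EF s)"
  using assms
proof (induction "num_random (concat s)" arbitrary: s rule: less_induct)
  case less
  define m where "m = num_random (concat s)"
  define n where "n = word_wt wt (concat s)"
  define L where "L = length (concat s)"
  \<comment> \<open>Summing over all letters gives a crude \<open>K\<close> that dominates the index
    and the height of each letter of \<open>s\<close>.\<close>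
  define f where "f l = (case fst l of None \<Rightarrow> 0 | Some k \<Rightarrow> k) + ht (snd l)" for l
  define K where "K = sum_list (map f (concat s))"
  define C where "C = states wt ht K L m n"
  define S where "S N = (\<Sum>s\<in>C. cmod (EF s N))" for N
  define g where "g N = real N powr ((real n - real m) / 2)" for N
  \<comment> \<open>The target size for \<open>N\<close> times an expectation: \<open>S N\<close>
    covers terms of the same class, \<open>N * g N\<close> those that lost up to two random
    letters.\<close>
  define h where "h N = S N + real N * g N" for N
  show ?case
  proof (cases "m = 0")
    case True
    then show ?thesis using det_order_bound[of s] less.prems by (simp add: m_def)
  next
    case m0: False
    have finC: "finite C" unfolding C_def using finite_ht by (rule finite_states)
    have S0: "S N \<ge> 0" for N unfolding S_def by (intro sum_nonneg) auto
    have g0: "g N \<ge> 0" for N by (simp add: g_def)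
    have letter_le: "letter_le ht K l" if "l \<in> set (concat s)" for l
    proof -
      have "f l \<le> K" unfolding K_def using that by (intro member_le_sum_list) auto
      then show ?thesis by (auto simp: letter_le_def f_def)
    qed
    have sC: "s \<in> C" unfolding C_def states_def using less.prems letter_le by (simp add: L_def m_def n_def del: set_concat)
    \<comment> \<open>Two lost random letters raise the exponent by 1, which is the factor
      \<open>N\<close> in \<open>h\<close>.\<close>
    have IH: "bigo h (EF s')" if "[] \<notin> set s'" "num_random (concat s') < m" "m \<le> num_random (concat s') + 2" "word_wt wt (concat s') = n" for s'
    proof (rule bigo_mono)
      show "bigo (\<lambda>N. real N powr ((real (word_wt wt (concat s')) - real (num_random (concat s'))) / 2)) (EF s')"
        by (rule less.hyps) (use that in \<open>auto simp: m_def\<close>)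
      show "\<forall>\<^sub>F N in sequentially. real N powr ((real (word_wt wt (concat s')) - real (num_random (concat s'))) / 2) \<le> h N"
        using eventually_ge_at_top[of 1]
      proof eventually_elim
        case (elim N)
        have "real N powr ((real (word_wt wt (concat s')) - real (num_random (concat s'))) / 2) \<le> real N powr (1 + (real n - real m) / 2)"
        proof (rule powr_mono)
          have "real m \<le> real (num_random (concat s')) + 2" using that by linarith
          then show "(real (word_wt wt (concat s')) - real (num_random (concat s'))) / 2 \<le> 1 + (real n - real m) / 2"
            unfolding that(4) by (simp add: field_simps)
        qed (use elim in simp)
        also have "\<dots> = real N * g N" using elim by (simp add: g_def powr_add)
        finally show ?case using S0[of N] by (simp add: h_def)
      qed
    qed
    have rewired: "rand_bigo h (F s')" if "s' \<in> C" for s'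
    proof (rule rand_bigo_F)
      have "cmod (EF s' N) \<le> 1 * h N" for N
      proof -
        have "cmod (EF s' N) \<le> S N" unfolding S_def using that finC by (intro member_le_sum) auto
        then show ?thesis using g0[of N] by (simp add: h_def add_increasing2)
      qed
      then show "bigo h (EF s')" unfolding bigo_def by (intro exI[of _ 1]) simp
    qed
    \<comment> \<open>The \<open>+ 2\<close> counts the merging letters \<open>q k\<close> and
      \<open>Some k1\<close>.\<close>
    have Mg: "rand_bigo h (\<lambda>N x. tr (q N x k * qev N x ((Some k1, u) # v)) * F s' N x)"
      if "[] \<notin> set s'" "num_random v + num_random (concat s') + 2 = m" "wt u + word_wt wt v + word_wt wt (concat s') = n" for k k1 u v s'
    proof (rule rand_bigo_cong)
      show "rand_bigo h (\<lambda>N x. F (((Some (k + k1), u) # v) # s') N x - t N k1 * F (((Some k, u) # v) # s') N x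
        - t N k * F (((Some k1, u) # v) # s') N x + (t N (k + k1) - t N k * t N k1) * F (((None, u) # v) # s') N x)"
        by (intro rand_bigo_add rand_bigo_diff rand_bigo_scale rand_bigo_F IH bigo_diff bigo_bounded_mult t_bounded) (use that in auto)
    qed (simp only: tr_merge)
    have loop: "bigo h (\<lambda>N. of_nat N * EF (w # s') N)" if wC: "w # s' \<in> C" and w: "w = (Some k0, u0) # R" for w s' k0 u0 R
    proof -
      \<comment> \<open>\<open>Z1\<close> holds the splittings of \<open>w\<close> and
        \<open>Z2\<close> its mergers with other traces; \<open>Z3\<close> and \<open>Z4\<close> are
        the transposed counterparts of the real case.\<close>
      define Z1 where "Z1 N x = (\<Sum>p<length R. case fst (R ! p) of None \<Rightarrow> 0 | Some k \<Rightarrow>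
        F (take (Suc p) w # drop (Suc p) w # s') N x
        - tr (q N x k * qev N x (take (Suc p) w)) * F (((None, snd (R ! p)) # drop (Suc p) R) # s') N x)" for N x
      define Z2 where "Z2 N x = (\<Sum>i<length s'. \<Sum>p<length (s' ! i). case fst (s' ! i ! p) of None \<Rightarrow> 0 | Some k \<Rightarrow>
        F ((w @ s' ! i ! p # drop (Suc p) (s' ! i) @ take p (s' ! i)) # take i s' @ drop (Suc i) s') N x
        - tr (q N x k * qev N x (w @ (None, snd (s' ! i ! p)) # drop (Suc p) (s' ! i) @ take p (s' ! i)))
          * F (take i s' @ drop (Suc i) s') N x)" for N x
      define Z3 where "Z3 N x = (\<Sum>p<length R. case fst (R ! p) of None \<Rightarrow> 0 | Some k \<Rightarrow>
        tr (q N x k * qev N x (take (Suc p) w @ rev_word star (snd (R ! p)) (drop (Suc p) R))) * F s' N x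
        - F ((take (Suc p) w @ attach k (rev_word star (snd (R ! p)) (drop (Suc p) R))) # s') N x)" for N x
      define Z4 where "Z4 N x = (\<Sum>i<length s'. \<Sum>p<length (s' ! i). case fst (s' ! i ! p) of None \<Rightarrow> 0 | Some k \<Rightarrow>
        tr (q N x k * qev N x (w @ rev_word star (snd (s' ! i ! p)) (drop (Suc p) (s' ! i) @ take p (s' ! i))))
          * F (take i s' @ drop (Suc i) s') N x
        - F ((w @ attach k (rev_word star (snd (s' ! i ! p)) (drop (Suc p) (s' ! i) @ take p (s' ! i)))) # take i s' @ drop (Suc i) s') N x)" for N x
      have wst: "word_wt wt (rev_word star u v) = wt u + word_wt wt v" for u v by (rule word_wt_rev_word) simp
      have oka: "l \<in> set (attach k (rev_word star u v)) \<Longrightarrow> letter_le ht K l"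
        if "k \<le> K" "ht u \<le> K" "\<forall>l\<in>set v. letter_le ht K l" for k u v l
        using letter_le_attach[OF rev_word_nonempty that(1) letter_le_rev_word[OF ht_star that(2,3)]] by blast
      have Z1: "rand_bigo h Z1" unfolding Z1_def[abs_def]
      proof (intro rand_bigo_sum)
        fix p assume p: "p \<in> {..<length R}"
        show "rand_bigo h (\<lambda>N x. case fst (R ! p) of None \<Rightarrow> 0 | Some k \<Rightarrow>
            F (take (Suc p) w # drop (Suc p) w # s') N x
            - tr (q N x k * qev N x (take (Suc p) w)) * F (((None, snd (R ! p)) # drop (Suc p) R) # s') N x)"
        proof (cases "fst (R ! p)")
          case (Some k)
          obtain R1 u R2 where R: "R = R1 @ (Some k, u) # R2" "length R1 = p"
            using p Some by (auto elim: split_at_Some)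
          show ?thesis using wC R(2)[symmetric]
            by (auto simp: R(1) w C_def states_def simp del: wev.simps intro!: rand_bigo_diff Mg rewired)
        qed (simp add: rand_bigo_zero)
      qed
      have Z2: "rand_bigo h Z2" unfolding Z2_def[abs_def]
      proof (intro rand_bigo_sum)
        fix i p assume i: "i \<in> {..<length s'}" and p: "p \<in> {..<length (s' ! i)}"
        show "rand_bigo h (\<lambda>N x. case fst (s' ! i ! p) of None \<Rightarrow> 0 | Some k \<Rightarrow>
        F ((w @ s' ! i ! p # drop (Suc p) (s' ! i) @ take p (s' ! i)) # take i s' @ drop (Suc i) s') N x
        - tr (q N x k * qev N x (w @ (None, snd (s' ! i ! p)) # drop (Suc p) (s' ! i) @ take p (s' ! i)))
          * F (take i s' @ drop (Suc i) s') N x)"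
        proof (cases "fst (s' ! i ! p)")
          case (Some k)
          obtain s1 s2 where s': "s' = s1 @ s' ! i # s2" "length s1 = i" using i by (auto elim: split_state)
          obtain R1 u R2 where R: "s' ! i = R1 @ (Some k, u) # R2" "length R1 = p"
            using p Some by (auto elim: split_at_Some)
          have e: "s' = s1 @ (R1 @ (Some k, u) # R2) # s2" using s' R by simp
          show ?thesis using wC s'(2)[symmetric] R(2)[symmetric]
            by (auto simp: e w C_def states_def simp del: wev.simps intro!: rand_bigo_diff Mg rewired)
        qed (simp add: rand_bigo_zero)
      qed
      have Z3: "rand_bigo h Z3" unfolding Z3_def[abs_def]
      proof (intro rand_bigo_sum)
        fix p assume p: "p \<in> {..<length R}"
        show "rand_bigo h (\<lambda>N x. case fst (R ! p) of None \<Rightarrow> 0 | Some k \<Rightarrow>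
          tr (q N x k * qev N x (take (Suc p) w @ rev_word star (snd (R ! p)) (drop (Suc p) R))) * F s' N x
          - F ((take (Suc p) w @ attach k (rev_word star (snd (R ! p)) (drop (Suc p) R))) # s') N x)"
        proof (cases "fst (R ! p)")
          case (Some k)
          obtain R1 u R2 where R: "R = R1 @ (Some k, u) # R2" "length R1 = p"
            using p Some by (auto elim: split_at_Some)
          have "k \<le> K" "ht u \<le> K" "\<forall>l\<in>set R2. letter_le ht K l"
            using wC by (auto simp: R w C_def states_def letter_le_def)
          note ok = oka[OF this]
          show ?thesis using wC R(2)[symmetric]
            by (auto simp: R(1) w C_def states_def wst simp del: wev.simps intro!: rand_bigo_diff Mg rewired dest: ok)
        qed (simp add: rand_bigo_zero)
      qed
      have Z4: "rand_bigo h Z4" unfolding Z4_def[abs_def]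
      proof (intro rand_bigo_sum)
        fix i p assume i: "i \<in> {..<length s'}" and p: "p \<in> {..<length (s' ! i)}"
        show "rand_bigo h (\<lambda>N x. case fst (s' ! i ! p) of None \<Rightarrow> 0 | Some k \<Rightarrow>
          tr (q N x k * qev N x (w @ rev_word star (snd (s' ! i ! p)) (drop (Suc p) (s' ! i) @ take p (s' ! i))))
          * F (take i s' @ drop (Suc i) s') N x
          - F ((w @ attach k (rev_word star (snd (s' ! i ! p)) (drop (Suc p) (s' ! i) @ take p (s' ! i)))) # take i s' @ drop (Suc i) s') N x)"
        proof (cases "fst (s' ! i ! p)")
          case (Some k)
          obtain s1 s2 where s': "s' = s1 @ s' ! i # s2" "length s1 = i" using i by (auto elim: split_state)
          obtain R1 u R2 where R: "s' ! i = R1 @ (Some k, u) # R2" "length R1 = p"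
            using p Some by (auto elim: split_at_Some)
          have e: "s' = s1 @ (R1 @ (Some k, u) # R2) # s2" using s' R by simp
          have "k \<le> K" "ht u \<le> K" "\<forall>l\<in>set (R2 @ R1). letter_le ht K l"
            using wC by (auto simp: e w C_def states_def letter_le_def)
          note ok = oka[OF this]
          show ?thesis using wC s'(2)[symmetric] R(2)[symmetric]
            by (auto simp: e w C_def states_def wst simp del: wev.simps intro!: rand_bigo_diff Mg rewired dest: ok)
        qed (simp add: rand_bigo_zero)
      qed
      define RHS where "RHS N x = (if rc then Z3 N x + Z4 N x else 0)" for N x
      have "rand_bigo h (\<lambda>N x. Z3 N x + Z4 N x)" by (rule rand_bigo_add[OF Z3 Z4])
      then have "rand_bigo h RHS" unfolding RHS_def[abs_def] by (cases rc) (simp_all add: rand_bigo_zero)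
      \<comment> \<open>The loop equation is solved for its leading term: \<open>N\<close> times the
        expectation equals that of \<open>RHS - (Z1 + Z2)\<close>.\<close>
      then have "rand_bigo h (\<lambda>N x. RHS N x - (Z1 N x + Z2 N x))" by (intro rand_bigo_diff rand_bigo_add Z1 Z2)
      then have "bigo h (\<lambda>N. \<integral>x. RHS N x - (Z1 N x + Z2 N x) \<partial>M)" by (simp add: rand_bigo_def)
      then show ?thesis
      proof (rule bigo_cong)
        fix N :: nat assume N: "N \<ge> 1"
        interpret hw: haar_words M rc N "\<lambda>w. U w N" "b N" "d N" star by (rule haar_words[OF N])
        have iZ: "integrable M (Z1 N)" "integrable M (Z2 N)" "integrable M (RHS N)"
          using Z1 Z2 \<open>rand_bigo h RHS\<close> N by (simp_all add: rand_bigo_def)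
        have "(\<integral>x. (\<Sum>a<N. \<Sum>c<N. qdentry N x w s' a c a c) \<partial>M) =
          (\<integral>x. of_nat N * F (w # s') N x + Z1 N x + Z2 N x \<partial>M)"
        proof (rule Bochner_Integration.integral_cong[OF refl])
          fix x assume x: "x \<in> space M"
          interpret wm: word_model N "q N x" "d N" by (rule model[OF N x])
          show "(\<Sum>a<N. \<Sum>c<N. wm.dentry w s' a c a c) = of_nat N * F (w # s') N x + Z1 N x + Z2 N x"
            unfolding wm.loop_unitary[OF hw.tr_q[OF x] w] F_def Z1_def Z2_def ..
        qed
        also have "\<dots> = of_nat N * EF (w # s') N + (\<integral>x. Z1 N x + Z2 N x \<partial>M)"
          using iZ F_integrable[OF N] by (simp add: EF_def)
        finally have 1: "(\<integral>x. (\<Sum>a<N. \<Sum>c<N. qdentry N x w s' a c a c) \<partial>M) =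
          of_nat N * EF (w # s') N + (\<integral>x. Z1 N x + Z2 N x \<partial>M)" .
        have 2: "(if rc then (\<integral>x. (\<Sum>a<N. \<Sum>c<N. qdentry N x w s' a c c a) \<partial>M) else 0) = (\<integral>x. RHS N x \<partial>M)"
        proof (cases rc)
          case True
          have "(\<integral>x. (\<Sum>a<N. \<Sum>c<N. qdentry N x w s' a c c a) \<partial>M) = (\<integral>x. RHS N x \<partial>M)"
          proof (rule Bochner_Integration.integral_cong[OF refl])
            fix x assume x: "x \<in> space M"
            interpret wm: real_word_model N "q N x" "d N" star by (rule hw.real_model[OF x True])
            show "(\<Sum>a<N. \<Sum>c<N. wm.dentry w s' a c c a) = RHS N x"
              unfolding wm.loop_orthogonal[OF w] F_def Z3_def Z4_def RHS_def using True by simp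
          qed
          then show ?thesis using True by simp
        qed (simp add: RHS_def)
        have "of_nat N * EF (w # s') N + (\<integral>x. Z1 N x + Z2 N x \<partial>M) = (\<integral>x. RHS N x \<partial>M)"
          using hw.expectation_loop[of w s'] unfolding 1 2 .
        then show "(\<integral>x. RHS N x - (Z1 N x + Z2 N x) \<partial>M) = of_nat N * EF (w # s') N"
          unfolding Bochner_Integration.integral_diff[OF iZ(3) Bochner_Integration.integrable_add[OF iZ(1,2)]]
          by (metis add_diff_cancel_right')
      qed
    qed
    have "bigo h (\<lambda>N. of_nat N * EF s' N)" if s': "s' \<in> C" for s'
    proof -
      \<comment> \<open>Since \<open>m > 0\<close>, each member of the class has a random letter;
        its word can be rotated to start there, as \<open>loop\<close> requires.\<close>
      have "\<not> (\<forall>l\<in>set (concat s'). fst l = None)"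
        using s' m0 num_random_eq_0[of "concat s'"] by (simp add: C_def states_def)
      then obtain v k u where v: "v \<in> set s'" "(Some k, u) \<in> set v" by auto
      then obtain s1 s2 v1 v2 where e: "s' = s1 @ v # s2" "v = v1 @ (Some k, u) # v2"
        by (metis in_set_conv_decomp)
      have "bigo h (\<lambda>N. of_nat N * EF (((Some k, u) # v2 @ v1) # s1 @ s2) N)"
        by (rule loop[OF _ refl]) (use s' in \<open>auto simp: C_def states_def e\<close>)
      then show ?thesis
      proof (rule bigo_cong)
        fix N :: nat assume N: "N \<ge> 1"
        have "EF s' N = EF (((Some k, u) # v2 @ v1) # s1 @ s2) N"
          unfolding EF_def e using F_rotate[OF N, of _ s1 v1 "(Some k, u) # v2" s2]
          by (intro Bochner_Integration.integral_cong) auto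
        then show "of_nat N * EF (((Some k, u) # v2 @ v1) # s1 @ s2) N = of_nat N * EF s' N" by simp
      qed
    qed
    \<comment> \<open>Summation over the finite class turns the bounds into an inequality for
      \<open>S\<close> alone, with \<open>S\<close> on both sides.\<close>
    then have "bigo h (\<lambda>N. \<Sum>s'\<in>C. of_real (cmod (of_nat N * EF s' N)))" by (intro bigo_sum bigo_cmod)
    moreover have "(\<Sum>s'\<in>C. complex_of_real (cmod (of_nat N * EF s' N))) = of_real (real N * S N)" for N
      by (simp add: S_def norm_mult sum_distrib_left)
    ultimately obtain D where D: "D \<ge> 0" and ev: "\<forall>\<^sub>F N in sequentially. cmod (complex_of_real (real N * S N)) \<le> D * h N"
      unfolding bigo_def by auto
    have "cmod (complex_of_real (real N * S N)) = real N * S N" for N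
      unfolding norm_of_real using S0 by (intro abs_of_nonneg) simp
    then have "\<forall>\<^sub>F N in sequentially. S N \<le> 2 * D * g N"
      using ev D S0 unfolding h_def by (intro absorb_small_multiple) auto
    then have "\<forall>\<^sub>F N in sequentially. cmod (EF s N) \<le> (2 * D) * g N"
    proof eventually_elim
      case (elim N)
      have "cmod (EF s N) \<le> S N" unfolding S_def using sC finC by (intro member_le_sum) auto
      then show ?case using elim by linarith
    qed
    then have "bigo g (EF s)" using D unfolding bigo_def by (intro exI[of _ "2 * D"]) auto
    then show ?thesis unfolding g_def m_def n_def .
  qed
qed

end

section \<open>Almost sure convergence\<close>

text \<open>By monotone convergence the series has finite expectation, so it converges almost surely
  and its terms tend to 0.\<close>

lemma (in prob_space) AE_tendsto_0_of_summable_bound: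
  fixes Y :: "nat \<Rightarrow> 'a \<Rightarrow> real"
  assumes nonneg: "\<And>N w. 0 \<le> Y N w" and int: "\<And>N. N \<ge> 1 \<Longrightarrow> integrable M (Y N)"
    and bound: "\<forall>\<^sub>F N in sequentially. (\<integral>w. Y N w \<partial>M) \<le> C * inverse (real N ^ 2)"
  shows "AE w in M. (\<lambda>N. Y N w) \<longlonglongrightarrow> 0"
proof -
  obtain N0 where N0: "\<And>N. N \<ge> N0 \<Longrightarrow> (\<integral>w. Y N w \<partial>M) \<le> C * inverse (real N ^ 2)"
    using bound unfolding eventually_sequentially by blast
  \<comment> \<open>\<open>Suc N0\<close> rather than \<open>N0\<close> keeps the index at least 1,
    where integrability is known.\<close>
  define Z where "Z n = Y (n + Suc N0)" for n
  have Zi: "integrable M (Z n)" for n unfolding Z_def by (intro int) simp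
  have Z0: "Z n w \<ge> 0" for n w unfolding Z_def by (rule nonneg)
  have "summable (\<lambda>n. inverse (real n ^ 2))" by (rule inverse_power_summable) simp
  then have "summable (\<lambda>n. C * inverse (real n ^ 2))" by (rule summable_mult)
  then have s: "summable (\<lambda>n. C * inverse (real (n + Suc N0) ^ 2))"
    by (rule summable_ignore_initial_segment)
  have s': "summable (\<lambda>n. \<integral>w. Z n w \<partial>M)"
  proof (rule summable_comparison_test'[OF s])
    fix n :: nat
    have "(\<integral>w. Z n w \<partial>M) \<ge> 0" using Z0 by (intro Bochner_Integration.integral_nonneg) auto
    then show "norm (\<integral>w. Z n w \<partial>M) \<le> C * inverse (real (n + Suc N0) ^ 2)"
      using N0[of "n + Suc N0"] by (simp add: Z_def)
  qed
  have meas: "(\<lambda>w. ennreal (Z n w)) \<in> borel_measurable M" for n using Zi[of n] by simp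
  have "(\<integral>\<^sup>+w. (\<Sum>n. ennreal (Z n w)) \<partial>M) = (\<Sum>n. \<integral>\<^sup>+w. ennreal (Z n w) \<partial>M)"
    using meas by (rule nn_integral_suminf)
  also have "\<dots> = (\<Sum>n. ennreal (\<integral>w. Z n w \<partial>M))"
    using Zi Z0 by (simp add: nn_integral_eq_integral)
  also have "\<dots> \<noteq> \<infinity>" using s' Z0
    unfolding infinity_ennreal_def by (intro ennreal_suminf_neq_top Bochner_Integration.integral_nonneg) auto
  finally have "AE w in M. (\<Sum>n. ennreal (Z n w)) \<noteq> \<infinity>"
    using meas by (intro nn_integral_PInf_AE) auto
  then show ?thesis
  proof eventually_elim
    case (elim w)
    then have "summable (\<lambda>n. Z n w)" using Z0 by (intro summable_suminf_not_top) auto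
    then have "(\<lambda>n. Y (n + Suc N0) w) \<longlonglongrightarrow> 0" unfolding Z_def by (rule summable_LIMSEQ_zero)
    then show ?case by (rule LIMSEQ_offset)
  qed
qed

context haar_sequence
begin

text \<open>The adjoint of a word with a random first letter ends in that letter; it is rotated back
  to the front. So this represents the adjoint only under the trace.\<close>

definition word_star :: "'d word \<Rightarrow> 'd word" where
  "word_star v = (case fst (hd v) of None \<Rightarrow> rev_word star (snd (hd v)) (tl v) | Some k \<Rightarrow> attach k (rev_word star (snd (hd v)) (tl v)))"

lemma word_star_counts:
  assumes "v \<noteq> []"
  shows "word_star v \<noteq> []" "num_random (word_star v) = num_random v" "word_wt wt (word_star v) = word_wt wt v"
proof -
  obtain o' u v' where v: "v = (o', u) # v'" using assms by (metis list.exhaust surj_pair)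
  show "word_star v \<noteq> []" "num_random (word_star v) = num_random v" "word_wt wt (word_star v) = word_wt wt v"
    unfolding v word_star_def by (cases o'; simp add: word_wt_rev_word)+
qed

lemma tr_word_star:
  assumes "N \<ge> 1" "w \<in> space M" "v \<noteq> []"
  shows "tr (qev N w (word_star v)) = cnj (tr (qev N w v))"
proof -
  interpret herm_word_model N "q N w" "d N" star
    using haar_words.herm_model[OF haar_words[OF assms(1)] assms(2)] .
  obtain o' u v' where v: "v = (o', u) # v'" using assms by (metis list.exhaust surj_pair)
  let ?Z = "qev N w ((None, u) # v')"
  have "cnj (tr (qev N w v)) = tr (adj (qev N w v))" by (simp add: tr_adj[OF wev_carrier])
  also have "\<dots> = tr (qev N w (word_star v))"
  proof (cases o')
    case None
    then show ?thesis using v adj_wev by (simp add: word_star_def del: wev.simps)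
  next
    case (Some k)
    have "tr (adj (qev N w v)) = tr (adj ?Z * q N w k)"
      unfolding v Some wev_None adj_mult[OF q_carrier wev_carrier] by simp
    also have "\<dots> = tr (q N w k * adj ?Z)" by (rule tr_mult_comm[of _ N]) (simp_all add: adj_carrier[OF wev_carrier] del: wev.simps)
    finally show ?thesis unfolding v Some by (simp add: word_star_def wev_attach_rev_word adj_wev del: wev.simps)
  qed
  finally show ?thesis by simp
qed

text \<open>The fourth absolute moment is itself an expected product of four traces, of the word
  twice and its adjoint twice, hence \<open>O(N^(2 (n - m)))\<close> for weight \<open>n\<close> and
  \<open>m\<close> random letters. After division by \<open>N^(4 \<beta>)\<close> the hypothesis
  leaves \<open>O(N^(-2))\<close>, which is summable.\<close>

lemma AE_trace_tendsto_0:
  assumes v: "v \<noteq> []" and le: "word_wt wt v + 1 \<le> num_random v + 2 * \<beta>"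
  shows "AE w in M. (\<lambda>N. tr (qev N w v) / of_nat N ^ \<beta>) \<longlonglongrightarrow> 0"
proof -
  define T where "T N w = tr (qev N w v)" for N w
  define Y where "Y N w = (cmod (T N w / of_nat N ^ \<beta>)) ^ 4" for N w
  define s where "s = [v, v, word_star v, word_star v]"
  have Tb: "bdd_meas M (T N)" if "N \<ge> 1" for N unfolding T_def
    using haar_words.tr_wev_bdd_meas[OF haar_words[OF that]] .
  have F: "F s N w = of_real ((cmod (T N w)) ^ 4)" if "N \<ge> 1" "w \<in> space M" for N w
  proof -
    have "F s N w = (T N w * cnj (T N w)) * (T N w * cnj (T N w))"
      unfolding F_def s_def traces_def using tr_word_star[OF that v] by (simp add: T_def mult_ac)
    also have "\<dots> = of_real ((cmod (T N w)) ^ 4)"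
      unfolding complex_norm_square[symmetric] by (simp add: power2_eq_square power4_eq_xxxx)
    finally show ?thesis .
  qed
  have b4: "bdd_meas M (\<lambda>w. complex_of_real ((cmod (T N w)) ^ 4))" if "N \<ge> 1" for N
    using F_bdd_meas[OF that, of s] F[OF that] bdd_meas_cong[of M "F s N"] by auto
  have int: "integrable M (\<lambda>w. (cmod (T N w)) ^ 4)" if "N \<ge> 1" for N
    using bdd_meas_integrable[OF b4[OF that]] by (simp only: complex_of_real_integrable_eq)
  have EFs: "EF s N = of_real (\<integral>w. (cmod (T N w)) ^ 4 \<partial>M)" if "N \<ge> 1" for N
  proof -
    have "EF s N = (\<integral>w. complex_of_real ((cmod (T N w)) ^ 4) \<partial>M)"
      unfolding EF_def using F[OF that] by (intro Bochner_Integration.integral_cong) auto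
    then show ?thesis by (simp only: integral_complex_of_real)
  qed
  have "bigo (\<lambda>N. real N powr ((real (word_wt wt (concat s)) - real (num_random (concat s))) / 2)) (EF s)"
    using v word_star_counts(1)[OF v] by (intro order_bound) (auto simp: s_def)
  moreover have "(real (word_wt wt (concat s)) - real (num_random (concat s))) / 2 = 2 * (real (word_wt wt v) - real (num_random v))"
    unfolding s_def by (simp add: word_star_counts[OF v])
  ultimately obtain C where C: "C \<ge> 0" and ev: "\<forall>\<^sub>F N in sequentially. cmod (EF s N) \<le> C * real N powr (2 * (real (word_wt wt v) - real (num_random v)))"
    unfolding bigo_def by auto
  have "AE w in M. (\<lambda>N. Y N w) \<longlonglongrightarrow> 0"
  proof (rule AE_tendsto_0_of_summable_bound)
    have Y: "Y N = (\<lambda>w. (cmod (T N w)) ^ 4 / real N ^ (4 * \<beta>))" for N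
      unfolding Y_def by (simp add: norm_divide norm_power power_divide power_mult[symmetric] mult.commute)
    show "integrable M (Y N)" if "N \<ge> 1" for N unfolding Y using int[OF that] by simp
    show "\<forall>\<^sub>F N in sequentially. (\<integral>w. Y N w \<partial>M) \<le> C * inverse (real N ^ 2)"
      using ev eventually_ge_at_top[of 1]
    proof eventually_elim
      case (elim N)
      have N: "real N \<ge> 1" using elim by simp
      have "(\<integral>w. (cmod (T N w)) ^ 4 \<partial>M) \<le> cmod (EF s N)"
        unfolding EFs[OF elim(2)] norm_of_real by simp
      also have "\<dots> \<le> C * real N powr (2 * (real (word_wt wt v) - real (num_random v)))" by (rule elim(1))
      also have "\<dots> \<le> C * real N powr (real (4 * \<beta>) - 2)"
      proof (intro mult_left_mono powr_mono C N)
        have "real (word_wt wt v) + 1 \<le> real (num_random v) + 2 * real \<beta>" using le by linarith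
        then show "2 * (real (word_wt wt v) - real (num_random v)) \<le> real (4 * \<beta>) - 2" by simp
      qed
      also have "\<dots> = C * inverse (real N ^ 2) * real N ^ (4 * \<beta>)"
        using N powr_realpow[of "real N" "4 * \<beta>"] by (simp add: powr_diff divide_inverse)
      finally have "(\<integral>w. (cmod (T N w)) ^ 4 \<partial>M) \<le> C * inverse (real N ^ 2) * real N ^ (4 * \<beta>)" .
      then show ?case unfolding Y using N by (simp add: divide_le_eq)
    qed
  qed (simp add: Y_def)
  then show ?thesis
  proof eventually_elim
    case (elim w)
    then have "(\<lambda>N. root 4 (Y N w)) \<longlonglongrightarrow> root 4 0" by (rule tendsto_real_root)
    moreover have "root 4 (Y N w) = cmod (T N w / of_nat N ^ \<beta>)" for N
      unfolding Y_def by (intro real_root_pos2) auto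
    ultimately have "(\<lambda>N. cmod (T N w / of_nat N ^ \<beta>)) \<longlonglongrightarrow> 0" by simp
    then show ?case unfolding T_def by (rule tendsto_norm_zero_cancel)
  qed
qed

end

section \<open>The deterministic letters\<close>

text \<open>\<open>C k\<close> is the centered power \<open>A\<^sup>k - tr A\<^sup>k / N\<close>, and \<open>V k l\<close> the rank one matrix \<open>e\<^sub>k v v\<^sup>* e\<^sub>l\<close> with \<open>e\<^sub>0 = 1\<close> and
  \<open>e\<^sub>k\<close> the centered power for \<open>k > 0\<close>; it turns quadratic forms in \<open>v\<close> into traces.\<close>

datatype det = C nat | V nat nat

fun det_star :: "det \<Rightarrow> det" where
  "det_star (C k) = C k"
| "det_star (V k l) = V l k"

text \<open>The weights calibrate the case without random letters: \<open>k \<ge> 2\<close> centered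
  powers have trace \<open>O(N)\<close>, at most \<open>N^(k/2)\<close>, and a rank one letter makes
  the trace bounded.\<close>

fun det_wt :: "det \<Rightarrow> nat" where
  "det_wt (C k) = 1"
| "det_wt (V k l) = 0"

fun det_ht :: "det \<Rightarrow> nat" where
  "det_ht (C k) = k"
| "det_ht (V k l) = max k l"

lemma finite_det_ht: "finite {x. det_ht x \<le> K}"
proof -
  have "{x. det_ht x \<le> K} \<subseteq> C ` {..K} \<union> (\<lambda>(k,l). V k l) ` ({..K} \<times> {..K})"
  proof
    fix x assume "x \<in> {x. det_ht x \<le> K}"
    then show "x \<in> C ` {..K} \<union> (\<lambda>(k,l). V k l) ` ({..K} \<times> {..K})" by (cases x) auto
  qed
  then show ?thesis by (rule finite_subset) auto
qed

definition cpow :: "nat \<Rightarrow> complex mat \<Rightarrow> nat \<Rightarrow> complex mat" where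
  "cpow N X k = X ^\<^sub>m k - emp_moment N X k \<cdot>\<^sub>m 1\<^sub>m N"

text \<open>\<open>cpow N X 0\<close> is the zero matrix for \<open>N \<ge> 1\<close>. Using the
  identity instead lets the index 0 stand for an absent end factor of a rank one letter.\<close>

definition epow :: "nat \<Rightarrow> complex mat \<Rightarrow> nat \<Rightarrow> complex mat" where
  "epow N X k = (if k = 0 then 1\<^sub>m N else cpow N X k)"

definition vproj :: "nat \<Rightarrow> complex vec \<Rightarrow> complex mat" where
  "vproj N v = mat N N (\<lambda>(i,j). v $ i * cnj (v $ j))"

fun dlet :: "nat \<Rightarrow> complex mat \<Rightarrow> complex vec \<Rightarrow> det \<Rightarrow> complex mat" where
  "dlet N X v (C k) = cpow N X k"
| "dlet N X v (V k l) = epow N X k * vproj N v * epow N X l"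

lemma pow_mat_carrier [simp]: "X \<in> carrier_mat N N \<Longrightarrow> X ^\<^sub>m k \<in> carrier_mat N N"
  by (metis carrier_matD carrier_matI pow_mat_dim_square)

lemma pow_mat_add:
  assumes X: "X \<in> carrier_mat N N"
  shows "X ^\<^sub>m k * X ^\<^sub>m l = (X ^\<^sub>m (k + l) :: complex mat)"
proof (induction l)
  case 0
  then show ?case using X by (simp add: right_mult_one_mat[of _ N N])
next
  case (Suc l)
  have "X ^\<^sub>m k * X ^\<^sub>m Suc l = X ^\<^sub>m k * X ^\<^sub>m l * X"
    using X by (simp add: assoc_mult_mat[of _ N N _ N _ N])
  then show ?case using Suc by simp
qed

lemma adj_pow:
  assumes X: "X \<in> carrier_mat N N" and a: "adj X = X"
  shows "adj (X ^\<^sub>m k) = X ^\<^sub>m k"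
proof (induction k)
  case 0
  then show ?case using X by simp
next
  case (Suc k)
  have "adj (X ^\<^sub>m Suc k) = X * X ^\<^sub>m k" using X Suc a by (simp add: adj_mult[of _ N])
  also have "\<dots> = X ^\<^sub>m 1 * X ^\<^sub>m k" using X by (simp add: left_mult_one_mat[of _ N N])
  also have "\<dots> = X ^\<^sub>m Suc k" unfolding pow_mat_add[OF X] by simp
  finally show ?case .
qed

lemma real_pow: "X \<in> carrier_mat N N \<Longrightarrow> real_mat X \<Longrightarrow> real_mat (X ^\<^sub>m k)"
proof (induction k)
  case (Suc k)
  then show ?case by (auto intro!: real_mat_mult[of _ N])
qed (auto simp: real_mat_def)

lemma cpow_carrier [simp]: "X \<in> carrier_mat N N \<Longrightarrow> cpow N X k \<in> carrier_mat N N"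
  by (simp add: cpow_def)

lemma epow_carrier [simp]: "X \<in> carrier_mat N N \<Longrightarrow> epow N X k \<in> carrier_mat N N"
  by (simp add: epow_def)

lemma vproj_carrier [simp]: "vproj N v \<in> carrier_mat N N"
  by (simp add: vproj_def)

lemma dlet_carrier [simp]: "X \<in> carrier_mat N N \<Longrightarrow> dlet N X v x \<in> carrier_mat N N"
  by (cases x) simp_all

lemma emp_moment_cnj: "X \<in> carrier_mat N N \<Longrightarrow> adj X = X \<Longrightarrow> cnj (emp_moment N X k) = emp_moment N X k"
  unfolding emp_moment_def using adj_pow[of X N k] tr_adj[of "X ^\<^sub>m k" N] by simp

lemma adj_cpow: "X \<in> carrier_mat N N \<Longrightarrow> adj X = X \<Longrightarrow> adj (cpow N X k) = cpow N X k"
  unfolding cpow_def by (simp add: adj_minus[of _ N] adj_smult adj_pow emp_moment_cnj)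

lemma adj_epow: "X \<in> carrier_mat N N \<Longrightarrow> adj X = X \<Longrightarrow> adj (epow N X k) = epow N X k"
  by (simp add: epow_def adj_cpow)

lemma adj_vproj: "adj (vproj N v) = vproj N v"
  by (rule eq_matI) (auto simp: adj_def vproj_def)

lemma adj_dlet:
  assumes "X \<in> carrier_mat N N" "adj X = X"
  shows "adj (dlet N X v x) = dlet N X v (det_star x)"
  using assms
  by (cases x) (simp_all add: adj_cpow adj_mult[of _ N] adj_epow adj_vproj assoc_mult_mat[of _ N N _ N _ N])

lemma tr_cpow: "X \<in> carrier_mat N N \<Longrightarrow> N \<ge> 1 \<Longrightarrow> tr (cpow N X k) = 0"
  unfolding cpow_def by (simp add: tr_minus[of _ N] tr_smult[of _ N] tr_one emp_moment_def)

lemma real_cpow: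
  assumes "X \<in> carrier_mat N N" "adj X = X" "real_mat X"
  shows "real_mat (cpow N X k)"
proof -
  have "emp_moment N X k \<in> \<real>" using emp_moment_cnj[OF assms(1,2)] by (simp add: Reals_cnj_iff)
  then show ?thesis using real_pow[OF assms(1,3), of k] assms(1)
    by (auto simp: real_mat_def cpow_def intro!: Reals_diff)
qed

lemma real_dlet:
  assumes "X \<in> carrier_mat N N" "adj X = X" "real_mat X" "v \<in> carrier_vec N" "real_vec v"
  shows "real_mat (dlet N X v x)"
proof -
  have "real_mat (vproj N v)" using assms by (auto simp: real_mat_def vproj_def real_vec_def Reals_cnj_iff)
  moreover have "real_mat (epow N X k)" for k
    using real_cpow[OF assms(1-3)] by (auto simp: epow_def real_mat_def)
  ultimately show ?thesis using assms real_cpow[OF assms(1-3)]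
    by (cases x) (auto intro!: real_mat_mult[of _ N])
qed

lemma cpow_mult:
  assumes X: "X \<in> carrier_mat N N"
  shows "cpow N X k * cpow N X l = cpow N X (k + l) - emp_moment N X l \<cdot>\<^sub>m cpow N X k - emp_moment N X k \<cdot>\<^sub>m cpow N X l
     + (emp_moment N X (k + l) - emp_moment N X k * emp_moment N X l) \<cdot>\<^sub>m 1\<^sub>m N"
proof -
  let ?t = "emp_moment N X"
  have 1: "cpow N X k * cpow N X l = X ^\<^sub>m (k + l) - ?t k \<cdot>\<^sub>m (X ^\<^sub>m l) - ?t l \<cdot>\<^sub>m (X ^\<^sub>m k - ?t k \<cdot>\<^sub>m 1\<^sub>m N)"
    unfolding cpow_def using X
    by (simp add: mult_minus_distrib_mat[of _ N N _ N] minus_mult_distrib_mat[of _ N N _ _ N]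
        mult_smult_distrib[of _ N N _ N] mult_smult_assoc_mat[of _ N N _ N] pow_mat_add[of _ N]
        left_mult_one_mat[of _ N N] right_mult_one_mat[of _ N N])
  show ?thesis unfolding 1 unfolding cpow_def using X
    by (intro eq_matI) (auto simp: algebra_simps)
qed

lemma pow_mult_cpow:
  assumes X: "X \<in> carrier_mat N N"
  shows "X ^\<^sub>m a * cpow N X k = X ^\<^sub>m (a + k) - emp_moment N X k \<cdot>\<^sub>m X ^\<^sub>m a"
  unfolding cpow_def using X
  by (simp add: mult_minus_distrib_mat[of _ N N _ N] mult_smult_distrib[of _ N N _ N] pow_mat_add[of _ N]
        right_mult_one_mat[of _ N N])

lemma quadratic_form_eq_tr:
  assumes "X \<in> carrier_mat N N" "v \<in> carrier_vec N"
  shows "(X *\<^sub>v v) \<bullet>c v = tr (X * vproj N v)"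
proof -
  have "(X *\<^sub>v v) \<bullet>c v = (\<Sum>i<N. (\<Sum>j<N. X $$ (i,j) * v $ j) * cnj (v $ i))"
    using assms by (auto simp: scalar_prod_def atLeast0LessThan intro!: sum.cong)
  also have "\<dots> = tr (X * vproj N v)"
    unfolding tr_mult[OF assms(1) vproj_carrier]
    unfolding sum_distrib_right by (intro sum.cong refl) (simp add: vproj_def)
  finally show ?thesis .
qed

text \<open>Between two copies of the projection only the scalar \<open><Y v, v>\<close> survives,
  so the trace falls apart into quadratic forms.\<close>

lemma tr_vproj_split:
  assumes "X \<in> carrier_mat N N" "Y \<in> carrier_mat N N"
  shows "tr (X * vproj N v * Y * vproj N v) = tr (X * vproj N v) * tr (Y * vproj N v)"
proof -
  have "vproj N v * (Y * vproj N v) = tr (Y * vproj N v) \<cdot>\<^sub>m vproj N v"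
  proof (rule eq_matI)
    fix i j assume "i < dim_row (tr (Y * vproj N v) \<cdot>\<^sub>m vproj N v)" "j < dim_col (tr (Y * vproj N v) \<cdot>\<^sub>m vproj N v)"
    then have ij: "i < N" "j < N" by (auto simp: vproj_def)
    have "(vproj N v * (Y * vproj N v)) $$ (i,j) = (\<Sum>k<N. v $ i * cnj (v $ k) * (\<Sum>l<N. Y $$ (k,l) * (v $ l * cnj (v $ j))))"
      using ij assms by (simp add: mult_entry[of _ N] del: index_mult_mat) (simp add: vproj_def)
    also have "\<dots> = tr (Y * vproj N v) * (v $ i * cnj (v $ j))"
      unfolding tr_mult[OF assms(2) vproj_carrier]
      unfolding sum_distrib_right sum_distrib_left by (intro sum.cong refl) (simp add: vproj_def mult_ac)
    finally show "(vproj N v * (Y * vproj N v)) $$ (i,j) = (tr (Y * vproj N v) \<cdot>\<^sub>m vproj N v) $$ (i,j)"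
      using ij by (simp add: vproj_def)
  qed (use assms in \<open>auto simp: vproj_def\<close>)
  then have "tr (X * vproj N v * Y * vproj N v) = tr (X * (tr (Y * vproj N v) \<cdot>\<^sub>m vproj N v))"
    using assms by (simp add: assoc_mult_mat[of _ N N _ N _ N])
  then show ?thesis using assms by (simp add: mult_smult_distrib[of _ N N _ N] tr_smult[of _ N])
qed

section \<open>Bounds for words without random letters\<close>

locale moment_bounded =
  fixes A :: "nat \<Rightarrow> complex mat" and v :: "nat \<Rightarrow> complex vec"
  assumes A_carrier: "N \<ge> 1 \<Longrightarrow> A N \<in> carrier_mat N N" and v_carrier: "N \<ge> 1 \<Longrightarrow> v N \<in> carrier_vec N"
    and emp_bounded: "bigo (\<lambda>_. 1) (\<lambda>N. emp_moment N (A N) k)"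
    and vec_bounded: "bigo (\<lambda>_. 1) (\<lambda>N. vec_moment N (A N) (v N) k)"
begin

abbreviation "W N w \<equiv> wev N (\<lambda>_. 1\<^sub>m N) (dlet N (A N) (v N)) w"

lemma model: "N \<ge> 1 \<Longrightarrow> word_model N (\<lambda>_. 1\<^sub>m N) (dlet N (A N) (v N))"
  by unfold_locales (auto simp: A_carrier)

lemmas W_carrier = word_model.wev_carrier[OF model]

lemma tr_minus_smult_mult:
  assumes "X \<in> carrier_mat N N" "Y \<in> carrier_mat N N" "Z \<in> carrier_mat N N"
  shows "tr ((X - c \<cdot>\<^sub>m Y) * Z) = tr (X * Z) - c * tr (Y * Z)"
  using assms by (simp add: minus_mult_distrib_mat[of _ N N _ _ N] mult_smult_assoc_mat[of _ N N _ N] tr_minus[of _ N] tr_smult[of _ N])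

text \<open>The leading power of \<open>A\<close> absorbs each letter, a power minus a bounded
  scalar, so the induction ends at unnormalized moments of \<open>A\<close>.\<close>

lemma tr_C_word:
  assumes "\<forall>l\<in>set w. \<exists>k. l = (None, C k)"
  shows "bigo real (\<lambda>N. tr (A N ^\<^sub>m a * W N w))"
  using assms
proof (induction w arbitrary: a)
  case Nil
  have "bigo real of_nat" unfolding bigo_def by (rule exI[of _ 1]) simp
  from bigo_mult[OF emp_bounded[of a] this] have "bigo real (\<lambda>N. emp_moment N (A N) a * of_nat N)" by simp
  then show ?case
    by (rule bigo_cong) (simp add: emp_moment_def right_mult_one_mat[of _ N N for N] A_carrier)
next
  case (Cons l w)
  then obtain k where l: "l = (None, C k)" by auto
  have "bigo real (\<lambda>N. tr (A N ^\<^sub>m (a + k) * W N w) - emp_moment N (A N) k * tr (A N ^\<^sub>m a * W N w))"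
    using Cons by (intro bigo_diff bigo_bounded_mult emp_bounded) auto
  then show ?case
  proof (rule bigo_cong)
    fix N :: nat assume N: "N \<ge> 1"
    have "A N ^\<^sub>m a * W N (l # w) = A N ^\<^sub>m a * cpow N (A N) k * W N w"
      using A_carrier[OF N] W_carrier[OF N] by (simp add: l assoc_mult_mat[of _ N N _ N _ N])
    then show "tr (A N ^\<^sub>m (a + k) * W N w) - emp_moment N (A N) k * tr (A N ^\<^sub>m a * W N w) = tr (A N ^\<^sub>m a * W N (l # w))"
      unfolding pow_mult_cpow[OF A_carrier[OF N]] using A_carrier[OF N] W_carrier[OF N]
      by (simp add: tr_minus_smult_mult[of _ N] del: wev.simps)
  qed
qed

lemma tr_epow_mult:
  assumes "N \<ge> 1" "Z \<in> carrier_mat N N"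
  shows "tr (A N ^\<^sub>m a * epow N (A N) k * Z) =
    tr (A N ^\<^sub>m (a + k) * Z) - (if k = 0 then 0 else emp_moment N (A N) k) * tr (A N ^\<^sub>m a * Z)"
  using assms A_carrier[OF assms(1)]
  by (simp add: epow_def pow_mult_cpow[of _ N] tr_minus_smult_mult[of _ N] right_mult_one_mat[of _ N N])

lemma if_emp_bounded: "bigo (\<lambda>_. 1) (\<lambda>N. if k = 0 then 0 else emp_moment N (A N) k)"
  using emp_bounded[of k] by (cases "k = 0") (simp_all add: bigo_zero)

text \<open>The leading power absorbs letters \<open>C\<close> as before, while a letter
  \<open>V\<close> cuts the trace into two quadratic forms in \<open>v\<close>. The word is closed
  by the projection, so only vector moments remain and no factor \<open>N\<close> appears.\<close>

lemma tr_V_word: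
  assumes "\<forall>l\<in>set w. fst l = None"
  shows "bigo (\<lambda>_. 1) (\<lambda>N. tr (A N ^\<^sub>m a * (W N w * A N ^\<^sub>m c * vproj N (v N))))"
  using assms
proof (induction w arbitrary: a)
  case Nil
  from vec_bounded[of "a + c"] show ?case
  proof (rule bigo_cong)
    fix N :: nat assume N: "N \<ge> 1"
    show "vec_moment N (A N) (v N) (a + c) = tr (A N ^\<^sub>m a * (W N [] * A N ^\<^sub>m c * vproj N (v N)))"
      unfolding vec_moment_def quadratic_form_eq_tr[OF pow_mat_carrier[OF A_carrier[OF N]] v_carrier[OF N]]
      using A_carrier[OF N]
      by (simp add: left_mult_one_mat[of _ N N] pow_mat_add[of _ N, symmetric] assoc_mult_mat[of _ N N _ N _ N])
  qed
next
  case (Cons l w)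
  let ?Z = "\<lambda>N. W N w * A N ^\<^sub>m c * vproj N (v N)"
  have Z: "?Z N \<in> carrier_mat N N" if "N \<ge> 1" for N using A_carrier[OF that] W_carrier[OF that] by simp
  from Cons.prems obtain x where l: "l = (None, x)" by (cases l) auto
  have IH: "bigo (\<lambda>_. 1) (\<lambda>N. tr (A N ^\<^sub>m a * ?Z N))" for a using Cons by auto
  show ?case
  proof (cases x)
    case (C k)
    have "bigo (\<lambda>_. 1) (\<lambda>N. tr (A N ^\<^sub>m (a + k) * ?Z N) - emp_moment N (A N) k * tr (A N ^\<^sub>m a * ?Z N))"
      by (intro bigo_diff bigo_bounded_mult emp_bounded IH)
    then show ?thesis
    proof (rule bigo_cong)
      fix N :: nat assume N: "N \<ge> 1"
      have "A N ^\<^sub>m a * (W N (l # w) * A N ^\<^sub>m c * vproj N (v N)) = A N ^\<^sub>m a * cpow N (A N) k * ?Z N"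
        using A_carrier[OF N] W_carrier[OF N] by (simp add: l C assoc_mult_mat[of _ N N _ N _ N])
      then show "tr (A N ^\<^sub>m (a + k) * ?Z N) - emp_moment N (A N) k * tr (A N ^\<^sub>m a * ?Z N)
          = tr (A N ^\<^sub>m a * (W N (l # w) * A N ^\<^sub>m c * vproj N (v N)))"
        unfolding pow_mult_cpow[OF A_carrier[OF N]] using A_carrier[OF N] Z[OF N]
        by (simp add: tr_minus_smult_mult[of _ N] del: wev.simps)
    qed
  next
    case (V k j)
    have 1: "bigo (\<lambda>_. 1) (\<lambda>N. tr (A N ^\<^sub>m 0 * epow N (A N) j * ?Z N))"
    proof (rule bigo_cong)
      show "bigo (\<lambda>_. 1) (\<lambda>N. tr (A N ^\<^sub>m (0 + j) * ?Z N) - (if j = 0 then 0 else emp_moment N (A N) j) * tr (A N ^\<^sub>m 0 * ?Z N))"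
        by (intro bigo_diff bigo_bounded_mult if_emp_bounded IH)
    qed (simp only: tr_epow_mult Z)
    have mom: "bigo (\<lambda>_. 1) (\<lambda>N. tr (A N ^\<^sub>m a * vproj N (v N)))" for a
      using vec_bounded[of a]
      by (rule bigo_cong) (simp add: vec_moment_def quadratic_form_eq_tr[of _ N "v N" for N] A_carrier v_carrier)
    have 2: "bigo (\<lambda>_. 1) (\<lambda>N. tr (A N ^\<^sub>m a * epow N (A N) k * vproj N (v N)))"
    proof (rule bigo_cong)
      show "bigo (\<lambda>_. 1) (\<lambda>N. tr (A N ^\<^sub>m (a + k) * vproj N (v N)) - (if k = 0 then 0 else emp_moment N (A N) k) * tr (A N ^\<^sub>m a * vproj N (v N)))"
        by (intro bigo_diff bigo_bounded_mult if_emp_bounded mom)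
    qed (simp only: tr_epow_mult vproj_carrier)
    have "bigo (\<lambda>_. 1) (\<lambda>N. tr (A N ^\<^sub>m a * epow N (A N) k * vproj N (v N)) * tr (A N ^\<^sub>m 0 * epow N (A N) j * ?Z N))"
      by (intro bigo_bounded_mult 1 2)
    then show ?thesis
    proof (rule bigo_cong)
      fix N :: nat assume N: "N \<ge> 1"
      have "A N ^\<^sub>m a * (W N (l # w) * A N ^\<^sub>m c * vproj N (v N)) =
        (A N ^\<^sub>m a * epow N (A N) k) * vproj N (v N) * (epow N (A N) j * (W N w * A N ^\<^sub>m c)) * vproj N (v N)"
        using A_carrier[OF N] W_carrier[OF N] by (simp add: l V assoc_mult_mat[of _ N N _ N _ N])
      moreover have "tr (A N ^\<^sub>m 0 * epow N (A N) j * ?Z N) = tr (epow N (A N) j * (W N w * A N ^\<^sub>m c) * vproj N (v N))"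
        using A_carrier[OF N] W_carrier[OF N] by (simp add: assoc_mult_mat[of _ N N _ N _ N] left_mult_one_mat[of _ N N])
      ultimately show "tr (A N ^\<^sub>m a * epow N (A N) k * vproj N (v N)) * tr (A N ^\<^sub>m 0 * epow N (A N) j * ?Z N)
         = tr (A N ^\<^sub>m a * (W N (l # w) * A N ^\<^sub>m c * vproj N (v N)))"
        using A_carrier[OF N] W_carrier[OF N] by (simp add: tr_vproj_split del: wev.simps)
    qed
  qed
qed

text \<open>A single centered power has trace 0; several of them give \<open>O(N)\<close>, which
  their weight allows. A word with a rank one letter is rotated until it becomes a quadratic form in
  \<open>v\<close>, which is bounded.\<close>

lemma det_word_bound:
  assumes w: "w \<noteq> []" and None: "\<forall>l\<in>set w. fst l = None"
  shows "bigo (\<lambda>N. real N powr (real (word_wt det_wt w) / 2)) (\<lambda>N. tr (W N w))"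
proof (cases "\<forall>l\<in>set w. \<exists>k. l = (None, C k)")
  case True
  have wt: "word_wt det_wt w = length w" using True by (induction w) auto
  show ?thesis
  proof (cases "length w = 1")
    case True
    then obtain l where l: "w = [l]" by (cases w) auto
    with \<open>\<forall>l\<in>set w. \<exists>k. l = (None, C k)\<close> obtain k where "w = [(None, C k)]" by auto
    then have "tr (W N w) = 0" if "N \<ge> 1" for N
      using tr_cpow[OF A_carrier[OF that] that] A_carrier[OF that] by (simp add: right_mult_one_mat[of _ N N])
    then show ?thesis by (intro bigo_cong[OF bigo_zero]) simp
  next
    case False
    then have len: "length w \<ge> 2" using w by (cases w) (auto simp: Suc_le_eq)
    have "bigo real (\<lambda>N. tr (W N w))"
      by (rule bigo_cong[OF tr_C_word[OF True, of 0]]) (simp add: left_mult_one_mat[OF W_carrier] A_carrier carrier_matD(1)[OF A_carrier])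
    then show ?thesis
    proof (rule bigo_mono)
      show "\<forall>\<^sub>F N in sequentially. real N \<le> real N powr (real (word_wt det_wt w) / 2)"
        using eventually_ge_at_top[of 1]
      proof eventually_elim
        case (elim N)
        then have "real N powr 1 \<le> real N powr (real (word_wt det_wt w) / 2)"
          using len wt by (intro powr_mono) auto
        then show ?case using elim by simp
      qed
    qed
  qed
next
  case False
  then obtain l where l: "l \<in> set w" "\<not> (\<exists>k. l = (None, C k))" by auto
  moreover obtain x where x: "l = (None, x)" using None l(1) by (metis prod.collapse)
  ultimately obtain k j where lV: "l = (None, V k j)" by (cases x) auto
  obtain w1 w2 where e: "w = w1 @ l # w2" using l(1) by (meson in_set_conv_decomp)
  define w' where "w' = w2 @ w1"
  have N': "\<forall>l\<in>set w'. fst l = None" using None e by (auto simp: w'_def)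
  let ?e = "\<lambda>k N. if k = 0 then 0 else emp_moment N (A N) k"
  let ?T = "\<lambda>a c N. tr (A N ^\<^sub>m a * (W N w' * A N ^\<^sub>m c * vproj N (v N)))"
  have "bigo (\<lambda>_. 1) (\<lambda>N. (?T j k N - ?e j N * ?T 0 k N) - ?e k N * (?T j 0 N - ?e j N * ?T 0 0 N))"
    by (intro bigo_diff bigo_bounded_mult if_emp_bounded tr_V_word N')
  then have "bigo (\<lambda>_. 1) (\<lambda>N. tr (W N w))"
  proof (rule bigo_cong)
    fix N :: nat assume N: "N \<ge> 1"
    interpret word_model N "\<lambda>_. 1\<^sub>m N" "dlet N (A N) (v N)" by (rule model[OF N])
    note c = A_carrier[OF N] W_carrier[OF N]
    let ?v = "vproj N (v N)"
    have "tr (W N w) = tr (W N (l # w'))"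
      unfolding e w'_def using tr_wev_rotate[of w1 "l # w2"] by simp
    also have "\<dots> = tr (epow N (A N) k * (?v * epow N (A N) j * W N w'))"
      using c by (simp add: lV assoc_mult_mat[of _ N N _ N _ N])
    also have "\<dots> = tr (?v * epow N (A N) j * W N w' * epow N (A N) k)"
      using c by (intro tr_mult_comm[of _ N]) auto
    also have "\<dots> = tr (?v * (epow N (A N) j * W N w' * epow N (A N) k))"
      using c by (simp add: assoc_mult_mat[of _ N N _ N _ N])
    also have "\<dots> = tr (epow N (A N) j * W N w' * epow N (A N) k * ?v)"
      using c by (intro tr_mult_comm[of _ N]) auto
    also have "\<dots> = tr (A N ^\<^sub>m 0 * epow N (A N) j * (W N w' * epow N (A N) k * ?v))"
      using c by (simp add: assoc_mult_mat[of _ N N _ N _ N] left_mult_one_mat[of _ N N])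
    also have "\<dots> = tr (A N ^\<^sub>m j * (W N w' * epow N (A N) k * ?v)) - ?e j N * tr (A N ^\<^sub>m 0 * (W N w' * epow N (A N) k * ?v))"
      using c by (subst tr_epow_mult[OF N]) auto
    finally have 1: "tr (W N w) = tr (A N ^\<^sub>m j * (W N w' * epow N (A N) k * ?v)) - ?e j N * tr (A N ^\<^sub>m 0 * (W N w' * epow N (A N) k * ?v))" .
    have 2: "tr (A N ^\<^sub>m a * (W N w' * epow N (A N) k * ?v)) = ?T a k N - ?e k N * ?T a 0 N" for a
    proof -
      \<comment> \<open>Rotation brings the right end factor to the front, where
        \<open>tr_epow_mult\<close> can expand it.\<close>
      have r: "tr (A N ^\<^sub>m a * (W N w' * Y * ?v)) = tr (A N ^\<^sub>m 0 * Y * (?v * (A N ^\<^sub>m a * W N w')))" if "Y \<in> carrier_mat N N" for Y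
      proof -
        have "tr (A N ^\<^sub>m a * (W N w' * Y * ?v)) = tr (A N ^\<^sub>m a * W N w' * (Y * ?v))"
          using c that by (simp add: assoc_mult_mat[of _ N N _ N _ N])
        also have "\<dots> = tr (Y * ?v * (A N ^\<^sub>m a * W N w'))" using c that by (intro tr_mult_comm[of _ N]) auto
        finally show ?thesis using c that by (simp add: assoc_mult_mat[of _ N N _ N _ N] left_mult_one_mat[of _ N N])
      qed
      have r0: "tr (A N ^\<^sub>m 0 * (A N ^\<^sub>m b) * Z) = tr (A N ^\<^sub>m b * Z)" if "Z \<in> carrier_mat N N" for b Z
        using c that by (simp add: left_mult_one_mat[of _ N N])
      have Zc: "?v * (A N ^\<^sub>m a * W N w') \<in> carrier_mat N N" using c by simp
      show ?thesis
        unfolding r[OF epow_carrier[OF c(1)]] r[OF pow_mat_carrier[OF c(1)]] tr_epow_mult[OF N Zc] r0[OF Zc] by simp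
    qed
    show "(?T j k N - ?e j N * ?T 0 k N) - ?e k N * (?T j 0 N - ?e j N * ?T 0 0 N) = tr (W N w)"
      unfolding 1 2 by (simp add: algebra_simps)
  qed
  then show ?thesis
  proof (rule bigo_mono)
    show "\<forall>\<^sub>F N in sequentially. 1 \<le> real N powr (real (word_wt det_wt w) / 2)"
      using eventually_ge_at_top[of 1] by eventually_elim (auto intro: ge_one_powr_ge_zero)
  qed
qed

end

section \<open>Alternating products of centered powers\<close>

definition pairs :: "(nat \<times> nat) list \<Rightarrow> (bool \<times> nat) list" where
  "pairs prs = concat (map (\<lambda>(k,j). [(True, k), (False, j)]) prs)"

lemma pairs_simps [simp]: "pairs [] = []" "pairs ((k,j) # prs) = (True, k) # (False, j) # pairs prs"
  "pairs (prs @ prs') = pairs prs @ pairs prs'"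
  by (simp_all add: pairs_def)

lemma alternating_pairs_aux:
  assumes "successively (\<noteq>) (map fst ps)" "ps \<noteq> [] \<Longrightarrow> fst (hd ps)"
  shows "\<exists>prs. ps = pairs prs \<or> (\<exists>l. ps = pairs prs @ [(True, l)])"
  using assms
proof (induction ps rule: induct_list012)
  case 1
  show ?case by (rule exI[of _ "[]"]) simp
next
  case (2 x)
  then obtain l where "x = (True, l)" by (cases x) auto
  then have "[x] = pairs [] @ [(True, l)]" by simp
  then show ?case by blast
next
  case (3 x y zs)
  obtain k j where xy: "x = (True, k)" "y = (False, j)" using 3(3,4) by (cases x; cases y) auto
  have "zs \<noteq> [] \<Longrightarrow> fst (hd zs)" using 3(3) xy by (cases zs) auto
  moreover have "successively (\<noteq>) (map fst zs)" using 3(3) by (cases zs) auto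
  ultimately obtain prs where "zs = pairs prs \<or> (\<exists>l. zs = pairs prs @ [(True, l)])" using 3(1) by blast
  then have "x # y # zs = pairs ((k,j) # prs) \<or> (\<exists>l. x # y # zs = pairs ((k,j) # prs) @ [(True, l)])"
    using xy by auto
  then show ?case by blast
qed

text \<open>Blocks of a random and a deterministic power fit the letter encoding. The cases record
  an unpaired power of \<open>X\<close> in front and an unpaired power of \<open>Y\<close> at the
  end, which are later moved cyclically.\<close>

lemma alternating_cases:
  assumes "successively (\<noteq>) (map fst ps)"
  obtains (1) prs where "ps = pairs prs" | (2) prs l where "ps = pairs prs @ [(True, l)]"
    | (3) k prs where "ps = (False, k) # pairs prs" | (4) k prs l where "ps = (False, k) # pairs prs @ [(True, l)]"
proof (cases "ps \<noteq> [] \<longrightarrow> fst (hd ps)")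
  case True
  then show ?thesis using alternating_pairs_aux[OF assms] that by auto
next
  case False
  then obtain k qs where ps: "ps = (False, k) # qs" by (cases ps) auto
  have "successively (\<noteq>) (map fst qs)" using assms ps by (cases qs) auto
  moreover have "qs \<noteq> [] \<Longrightarrow> fst (hd qs)" using assms ps by (cases qs) auto
  ultimately have "\<exists>prs. qs = pairs prs \<or> (\<exists>l. qs = pairs prs @ [(True, l)])" by (rule alternating_pairs_aux)
  then show ?thesis using that ps by auto
qed

definition enc :: "(nat \<times> nat) list \<Rightarrow> det word" where
  "enc prs = map (\<lambda>(k,j). (Some k, C j)) prs"

lemma enc_simps [simp]: "enc [] = []" "enc ((k,j) # prs) = (Some k, C j) # enc prs" "enc (prs @ prs') = enc prs @ enc prs'"
  by (simp_all add: enc_def)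

lemma enc_counts [simp]: "num_random (enc prs) = length prs" "word_wt det_wt (enc prs) = length prs"
  by (induction prs) auto

lemma unitary_conj_pow:
  assumes X: "unitary_mat N X" and B: "B \<in> carrier_mat N N"
  shows "(X * B * adj X) ^\<^sub>m k = X * B ^\<^sub>m k * adj X"
proof (induction k)
  case 0
  then show ?case using X B by (auto simp: unitary_mat_def right_mult_one_mat[of _ N N])
next
  case (Suc k)
  have c: "X \<in> carrier_mat N N" using X by (simp add: unitary_mat_def)
  have "(X * B * adj X) ^\<^sub>m Suc k = conj_by (\<lambda>i. if i = 0 then B ^\<^sub>m k else B) X 0 * conj_by (\<lambda>i. if i = 0 then B ^\<^sub>m k else B) X 1"
    using Suc by (simp add: conj_by_def)
  also have "\<dots> = X * (B ^\<^sub>m k * B) * adj X"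
    by (subst conj_by_mult[OF X]) (use B in auto)
  finally show ?case by simp
qed

section \<open>The rotated pair of matrices and its alternating products\<close>

locale rotated_ensemble = prob_space M for M :: "'w measure" +
  fixes rc :: bool and A B :: "nat \<Rightarrow> complex mat" and v :: "nat \<Rightarrow> complex vec"
    and U :: "'w \<Rightarrow> nat \<Rightarrow> complex mat" and mA mv mB :: "nat \<Rightarrow> complex"
  assumes herm: "N \<ge> 1 \<Longrightarrow> hermitian_mat N (A N) \<and> hermitian_mat N (B N) \<and> unit_vec N (v N)"
    and real_case: "rc \<Longrightarrow> N \<ge> 1 \<Longrightarrow> real_mat (A N) \<and> real_mat (B N) \<and> real_vec (v N)"
    and A_conv: "(\<lambda>N. emp_moment N (A N) k) \<longlonglongrightarrow> mA k"
    and v_conv: "(\<lambda>N. vec_moment N (A N) (v N) k) \<longlonglongrightarrow> mv k"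
    and B_conv: "(\<lambda>N. emp_moment N (B N) k) \<longlonglongrightarrow> mB k"
    and haar: "N \<ge> 1 \<Longrightarrow> haar_random rc M N (\<lambda>w. U w N)"
begin

lemma A_carrier [simp]: "N \<ge> 1 \<Longrightarrow> A N \<in> carrier_mat N N" and A_adj: "N \<ge> 1 \<Longrightarrow> adj (A N) = A N"
  and B_carrier [simp]: "N \<ge> 1 \<Longrightarrow> B N \<in> carrier_mat N N" and B_adj: "N \<ge> 1 \<Longrightarrow> adj (B N) = B N"
  and v_carrier [simp]: "N \<ge> 1 \<Longrightarrow> v N \<in> carrier_vec N" and v_unit: "N \<ge> 1 \<Longrightarrow> v N \<bullet>c v N = 1"
  using herm by (auto simp: hermitian_mat_def unit_vec_def)

sublocale mb: moment_bounded A v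
  by unfold_locales (simp_all add: bigo_convergent[OF A_conv] bigo_convergent[OF v_conv])

lemma haar_words_cpow:
  assumes N: "N \<ge> 1"
  shows "haar_words M rc N (\<lambda>w. U w N) (cpow N (B N)) (dlet N (A N) (v N)) det_star"
proof
  show "haar_random rc M N (\<lambda>w. U w N)" by (rule haar[OF N])
  show "cpow N (B N) k \<in> carrier_mat N N" "adj (cpow N (B N) k) = cpow N (B N) k" "tr (cpow N (B N) k) = 0" for k
    using N by (simp_all add: adj_cpow B_adj tr_cpow)
  show "dlet N (A N) (v N) x \<in> carrier_mat N N" "adj (dlet N (A N) (v N) x) = dlet N (A N) (v N) (det_star x)" for x
    using N by (simp_all add: adj_dlet A_adj)
  show "real_mat (cpow N (B N) k)" if rc for k
    using real_case[OF that N] N by (intro real_cpow) (simp_all add: B_adj)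
  show "real_mat (dlet N (A N) (v N) x)" if rc for x
    using real_case[OF that N] N by (intro real_dlet) (simp_all add: A_adj)
qed

sublocale hs: haar_sequence M rc U "\<lambda>N. cpow N (B N)" "\<lambda>N. dlet N (A N) (v N)" det_star
    "\<lambda>N. emp_moment N (B N)" det_wt det_ht
proof (intro haar_sequence.intro haar_sequence_axioms.intro prob_space_axioms haar_words_cpow)
  fix N :: nat assume N: "N \<ge> 1"
  show "cpow N (B N) k * cpow N (B N) l = cpow N (B N) (k + l) - emp_moment N (B N) l \<cdot>\<^sub>m cpow N (B N) k
     - emp_moment N (B N) k \<cdot>\<^sub>m cpow N (B N) l + (emp_moment N (B N) (k + l) - emp_moment N (B N) k * emp_moment N (B N) l) \<cdot>\<^sub>m 1\<^sub>m N" for k l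
    by (rule cpow_mult) (use N in simp)
next
  show "bigo (\<lambda>_. 1) (\<lambda>N. emp_moment N (B N) k)" for k by (rule bigo_convergent[OF B_conv])
  show "det_wt (det_star x) = det_wt x" for x by (cases x) simp_all
  show "det_ht (det_star x) = det_ht x" for x by (cases x) simp_all
  show "finite {x. det_ht x \<le> K}" for K by (rule finite_det_ht)
  show "bigo (\<lambda>N. real N powr (real (word_wt det_wt w) / 2)) (\<lambda>N. tr (wev N (cpow N (B N)) (dlet N (A N) (v N)) w))"
    if "w \<noteq> []" "\<forall>l\<in>set w. fst l = None" for w
  proof -
    have "wev N (cpow N (B N)) (dlet N (A N) (v N)) w = wev N (\<lambda>_. 1\<^sub>m N) (dlet N (A N) (v N)) w" for N
      by (rule wev_all_None[OF that(2)])
    then show ?thesis using mb.det_word_bound[OF that] by simp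
  qed
qed

abbreviation "BB N w \<equiv> U w N * B N * adj (U w N)"

definition Mb :: "nat \<Rightarrow> 'w \<Rightarrow> bool \<Rightarrow> complex mat" where
  "Mb N w b = (if b then BB N w else A N)"

definition tb :: "nat \<Rightarrow> bool \<Rightarrow> nat \<Rightarrow> complex" where
  "tb N b k = emp_moment N (if b then B N else A N) k"

text \<open>Centering uses the moment at size \<open>N\<close> and not its limit, so that the traces
  vanish exactly, as the loop equation demands.\<close>

definition pc :: "nat \<Rightarrow> 'w \<Rightarrow> bool \<times> nat \<Rightarrow> complex mat" where
  "pc N w p = Mb N w (fst p) ^\<^sub>m snd p - tb N (fst p) (snd p) \<cdot>\<^sub>m 1\<^sub>m N"

definition pprod :: "nat \<Rightarrow> 'w \<Rightarrow> (bool \<times> nat) list \<Rightarrow> complex mat" where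
  "pprod N w ps = foldr (\<lambda>p X. pc N w p * X) ps (1\<^sub>m N)"

lemma U_unitary: "N \<ge> 1 \<Longrightarrow> w \<in> space M \<Longrightarrow> unitary_mat N (U w N)"
  using haar by (auto simp: haar_random_def)

lemma Mb_carrier [simp]: "N \<ge> 1 \<Longrightarrow> w \<in> space M \<Longrightarrow> Mb N w b \<in> carrier_mat N N"
  using U_unitary by (simp add: Mb_def unitary_mat_def)

lemma pc_carrier [simp]: "N \<ge> 1 \<Longrightarrow> w \<in> space M \<Longrightarrow> pc N w p \<in> carrier_mat N N"
  by (simp add: pc_def)

lemma pprod_carrier [simp]: "N \<ge> 1 \<Longrightarrow> w \<in> space M \<Longrightarrow> pprod N w ps \<in> carrier_mat N N"
  by (induction ps) (auto simp: pprod_def)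

lemma pprod_simps: "pprod N w [] = 1\<^sub>m N" "pprod N w (p # ps) = pc N w p * pprod N w ps"
  by (simp_all add: pprod_def)

lemma pprod_append: "N \<ge> 1 \<Longrightarrow> w \<in> space M \<Longrightarrow> pprod N w (ps @ qs) = pprod N w ps * pprod N w qs"
  by (induction ps) (auto simp: pprod_simps left_mult_one_mat[of _ N N] assoc_mult_mat[of _ N N _ N _ N])

lemma pc_False: "pc N w (False, k) = cpow N (A N) k"
  by (simp add: pc_def Mb_def tb_def cpow_def)

lemma pc_True:
  assumes "N \<ge> 1" "w \<in> space M"
  shows "pc N w (True, k) = hs.q N w k"
proof -
  note u = U_unitary[OF assms]
  have c: "U w N \<in> carrier_mat N N" using u by (simp add: unitary_mat_def)
  have "hs.q N w k = U w N * B N ^\<^sub>m k * adj (U w N) - emp_moment N (B N) k \<cdot>\<^sub>m (U w N * adj (U w N))"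
    unfolding conj_by_def cpow_def using c assms
    by (simp add: mult_minus_distrib_mat[of _ N N _ N] minus_mult_distrib_mat[of _ N N _ _ N]
      mult_smult_distrib[of _ N N _ N] mult_smult_assoc_mat[of _ N N _ N] right_mult_one_mat[of _ N N])
  then show ?thesis using u assms
    by (simp add: pc_def Mb_def tb_def unitary_conj_pow[OF u] unitary_mat_def)
qed

abbreviation "WV N w x \<equiv> wev N (hs.q N w) (dlet N (A N) (v N)) x"

lemma pprod_pairs:
  assumes "N \<ge> 1" "w \<in> space M"
  shows "pprod N w (pairs prs) = WV N w (enc prs)"
proof (induction prs)
  case (Cons x prs)
  obtain k j where x: "x = (k, j)" by force
  have "WV N w (enc prs) \<in> carrier_mat N N" by (rule word_model.wev_carrier[OF hs.model[OF assms]])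
  moreover have "hs.q N w k \<in> carrier_mat N N" by (rule word_model.q_carrier[OF hs.model[OF assms]])
  ultimately show ?case using assms
    by (simp add: x pprod_simps Cons pc_True[OF assms] pc_False assoc_mult_mat[of _ N N _ N _ N])
qed (simp add: pprod_simps)

lemma AE_cong_seq:
  assumes "AE w in M. (\<lambda>N. f N w) \<longlonglongrightarrow> (c :: complex)" "\<And>N w. N \<ge> 1 \<Longrightarrow> w \<in> space M \<Longrightarrow> f N w = g N w"
  shows "AE w in M. (\<lambda>N. g N w) \<longlonglongrightarrow> c"
  using assms(1) AE_space
proof eventually_elim
  case (elim w)
  have "\<forall>\<^sub>F N in sequentially. f N w = g N w"
    using eventually_ge_at_top[of 1] by eventually_elim (use elim assms(2) in auto)
  then show ?case using elim(1) by (rule Lim_transform_eventually[rotated])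
qed

lemma hs_AE: "x \<noteq> [] \<Longrightarrow> word_wt det_wt x + 1 \<le> num_random x + 2 * \<beta> \<Longrightarrow> AE w in M. (\<lambda>N. tr (WV N w x) / of_nat N ^ \<beta>) \<longlonglongrightarrow> 0"
  by (rule hs.AE_trace_tendsto_0)

text \<open>With \<open>\<beta> = 1\<close> the weight may exceed the number of random letters by
  one, so an unpaired power of \<open>A\<close> is affordable. Rotation reduces all shapes to
  encoded words; only if both ends are powers of \<open>Y\<close> do they meet cyclically and have
  to be merged.\<close>

theorem AE_trace_alternating:
  assumes alt: "successively (\<noteq>) (map fst ps)" and len: "length ps \<ge> 2"
  shows "AE w in M. (\<lambda>N. tr (pprod N w ps) / of_nat N) \<longlonglongrightarrow> 0"
proof -
  have wc: "WV N w x \<in> carrier_mat N N" "hs.q N w k \<in> carrier_mat N N" if "N \<ge> 1" "w \<in> space M" for N w x k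
    using word_model.wev_carrier[OF hs.model[OF that]] word_model.q_carrier[OF hs.model[OF that]] by auto
  have hs1: "AE w in M. (\<lambda>N. tr (WV N w x) / of_nat N) \<longlonglongrightarrow> 0" if "x \<noteq> []" "word_wt det_wt x \<le> num_random x + 1" for x
    using hs_AE[OF that(1), of 1] that(2) by simp
  from alt show ?thesis
  proof (cases rule: alternating_cases)
    case (1 prs)
    have "AE w in M. (\<lambda>N. tr (WV N w (enc prs)) / of_nat N) \<longlonglongrightarrow> 0"
    proof (rule hs1)
      show "enc prs \<noteq> []" using 1 len by (cases prs) auto
    qed simp
    then show ?thesis by (rule AE_cong_seq) (simp add: 1 pprod_pairs)
  next
    case (2 prs l)
    then obtain k j prs' where prs: "prs = (k, j) # prs'" using len by (cases prs) auto
    let ?t = "\<lambda>N. emp_moment N (B N)"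
    let ?f = "\<lambda>o' N w. tr (WV N w ((o', C j) # enc prs')) / of_nat N"
    have h: "AE w in M. (\<lambda>N. ?f o' N w) \<longlonglongrightarrow> 0" for o'
      by (rule hs1) auto
    have "AE w in M. (\<lambda>N. ?f (Some (l + k)) N w - ?t N k * ?f (Some l) N w - ?t N l * ?f (Some k) N w
       + (?t N (l + k) - ?t N l * ?t N k) * ?f None N w) \<longlonglongrightarrow> 0 - mB k * 0 - mB l * 0 + (mB (l + k) - mB l * mB k) * 0"
      using h[of "Some (l + k)"] h[of "Some l"] h[of "Some k"] h[of None]
      by eventually_elim (intro tendsto_intros B_conv)
    then have "AE w in M. (\<lambda>N. ?f (Some (l + k)) N w - ?t N k * ?f (Some l) N w - ?t N l * ?f (Some k) N w
       + (?t N (l + k) - ?t N l * ?t N k) * ?f None N w) \<longlonglongrightarrow> 0" by simp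
    then show ?thesis
    proof (rule AE_cong_seq)
      fix N :: nat and w assume N: "N \<ge> 1" and w: "w \<in> space M"
      have "tr (pprod N w ps) = tr (WV N w (enc prs) * hs.q N w l)"
        using N w wc[OF N w] by (simp add: 2 pprod_append pprod_pairs pprod_simps pc_True right_mult_one_mat[of _ N N])
      also have "\<dots> = tr (hs.q N w l * WV N w (enc prs))" by (rule tr_mult_comm) (use wc[OF N w] in auto)
      also have "\<dots> = tr (hs.q N w l * WV N w ((Some k, C j) # enc prs')) * hs.F [] N w"
        by (simp add: prs hs.F_def traces_def)
      also have "\<dots> = tr (WV N w ((Some (l + k), C j) # enc prs')) - ?t N k * tr (WV N w ((Some l, C j) # enc prs'))
        - ?t N l * tr (WV N w ((Some k, C j) # enc prs')) + (?t N (l + k) - ?t N l * ?t N k) * tr (WV N w ((None, C j) # enc prs'))"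
        unfolding hs.tr_merge[OF N w] by (simp add: hs.F_def traces_def)
      finally show "?f (Some (l + k)) N w - ?t N k * ?f (Some l) N w - ?t N l * ?f (Some k) N w
       + (?t N (l + k) - ?t N l * ?t N k) * ?f None N w = tr (pprod N w ps) / of_nat N"
        by (simp add: add_divide_distrib diff_divide_distrib del: wev.simps)
    qed
  next
    case (3 k prs)
    have "AE w in M. (\<lambda>N. tr (WV N w (enc prs @ [(None, C k)])) / of_nat N) \<longlonglongrightarrow> 0"
      by (rule hs1) auto
    then show ?thesis
    proof (rule AE_cong_seq)
      fix N :: nat and w assume N: "N \<ge> 1" and w: "w \<in> space M"
      interpret word_model N "hs.q N w" "dlet N (A N) (v N)" by (rule hs.model[OF N w])
      have "tr (pprod N w ps) = tr (WV N w ([(None, C k)] @ enc prs))"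
        using N w by (simp add: 3 pprod_simps pprod_pairs pc_False)
      then show "tr (WV N w (enc prs @ [(None, C k)])) / of_nat N = tr (pprod N w ps) / of_nat N"
        unfolding tr_wev_rotate[of "enc prs" "[(None, C k)]"] by simp
    qed
  next
    case (4 k prs l)
    have "AE w in M. (\<lambda>N. tr (WV N w ((Some l, C k) # enc prs)) / of_nat N) \<longlonglongrightarrow> 0"
      by (rule hs1) auto
    then show ?thesis
    proof (rule AE_cong_seq)
      fix N :: nat and w assume N: "N \<ge> 1" and w: "w \<in> space M"
      have "tr (pprod N w ps) = tr (cpow N (A N) k * WV N w (enc prs) * hs.q N w l)"
        using N w wc[OF N w] by (simp add: 4 pprod_simps pprod_append pprod_pairs pc_False pc_True right_mult_one_mat[of _ N N] assoc_mult_mat[of _ N N _ N _ N])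
      also have "\<dots> = tr (hs.q N w l * (cpow N (A N) k * WV N w (enc prs)))"
        by (rule tr_mult_comm[of _ N]) (use N wc[OF N w] in auto)
      also have "\<dots> = tr (WV N w ((Some l, C k) # enc prs))"
        using N wc[OF N w] by (simp add: assoc_mult_mat[of _ N N _ N _ N])
      finally show "tr (WV N w ((Some l, C k) # enc prs)) / of_nat N = tr (pprod N w ps) / of_nat N" by simp
    qed
  qed
qed

text \<open>Under the trace both ends meet at the projection, so end powers of \<open>A\<close> are
  stored in the letter \<open>V j c\<close>. Since \<open>\<beta> = 0\<close> there is no slack: the
  random letters outnumber the weight by exactly one, because the rank one letter replaces one
  \<open>C\<close>. At least one factor in \<open>Y\<close> is therefore required.\<close>

theorem AE_vector_alternating:
  assumes alt: "successively (\<noteq>) (map fst ps)" and True: "True \<in> fst ` set ps" and pos: "\<forall>p\<in>set ps. snd p \<ge> 1"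
  shows "AE w in M. (\<lambda>N. tr (pprod N w ps * vproj N (v N))) \<longlonglongrightarrow> 0"
proof -
  have wc: "WV N w x \<in> carrier_mat N N" "hs.q N w k \<in> carrier_mat N N" if "N \<ge> 1" "w \<in> space M" for N w x k
    using word_model.wev_carrier[OF hs.model[OF that]] word_model.q_carrier[OF hs.model[OF that]] by auto
  have main: "AE w in M. (\<lambda>N. tr (epow N (A N) c * WV N w (enc prs) * hs.q N w k * epow N (A N) j * vproj N (v N))) \<longlonglongrightarrow> 0" for c prs k j
  proof -
    have "AE w in M. (\<lambda>N. tr (WV N w (enc prs @ [(Some k, V j c)])) / of_nat N ^ 0) \<longlonglongrightarrow> 0"
      by (rule hs_AE) auto
    then show ?thesis
    proof (rule AE_cong_seq)
      fix N :: nat and w assume N: "N \<ge> 1" and w: "w \<in> space M"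
      interpret word_model N "hs.q N w" "dlet N (A N) (v N)" by (rule hs.model[OF N w])
      note cc = wc[OF N w] A_carrier[OF N]
      have "tr (epow N (A N) c * WV N w (enc prs) * hs.q N w k * epow N (A N) j * vproj N (v N)) =
        tr (epow N (A N) c * (WV N w (enc prs) * hs.q N w k * epow N (A N) j * vproj N (v N)))"
        using cc by (simp add: assoc_mult_mat[of _ N N _ N _ N])
      also have "\<dots> = tr (WV N w (enc prs) * hs.q N w k * epow N (A N) j * vproj N (v N) * epow N (A N) c)"
        by (rule tr_mult_comm[of _ N]) (use cc in auto)
      also have "WV N w (enc prs) * hs.q N w k * epow N (A N) j * vproj N (v N) * epow N (A N) c = WV N w (enc prs @ [(Some k, V j c)])"
        unfolding wev_append using cc by (simp add: assoc_mult_mat[of _ N N _ N _ N] right_mult_one_mat[of _ N N])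
      finally show "tr (WV N w (enc prs @ [(Some k, V j c)])) / of_nat N ^ 0
          = tr (epow N (A N) c * WV N w (enc prs) * hs.q N w k * epow N (A N) j * vproj N (v N))" by simp
    qed
  qed
  have "\<exists>c prs k j. \<forall>N w. N \<ge> 1 \<longrightarrow> w \<in> space M \<longrightarrow>
     pprod N w ps = epow N (A N) c * WV N w (enc prs) * hs.q N w k * epow N (A N) j"
    using alt
  proof (cases rule: alternating_cases)
    case (1 prs)
    then have "prs \<noteq> []" using True by auto
    then obtain prs' k j where prs: "prs = prs' @ [(k, j)]" by (cases prs rule: rev_cases) auto
    \<comment> \<open>Positivity matters: at exponent 0 \<open>epow\<close> would be the identity
      and not the centered power.\<close>
    have "j \<ge> 1" using pos 1 prs by auto
    then have e: "epow N (A N) j = cpow N (A N) j" for N by (simp add: epow_def)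
    have "pprod N w ps = epow N (A N) 0 * WV N w (enc prs') * hs.q N w k * epow N (A N) j" if "N \<ge> 1" "w \<in> space M" for N w
      unfolding e using that wc[OF that] word_model.wev_append[OF hs.model[OF that], of "enc prs'" "[(Some k, C j)]"]
      by (simp add: 1 prs pprod_append pprod_pairs pprod_simps epow_def pc_True pc_False
         left_mult_one_mat[of _ N N] right_mult_one_mat[of _ N N] assoc_mult_mat[of _ N N _ N _ N])
    then show ?thesis by blast
  next
    case (2 prs l)
    have "pprod N w ps = epow N (A N) 0 * WV N w (enc prs) * hs.q N w l * epow N (A N) 0" if "N \<ge> 1" "w \<in> space M" for N w
      using that wc[OF that]
      by (simp add: 2 pprod_append pprod_pairs pprod_simps epow_def pc_True
         left_mult_one_mat[of _ N N] right_mult_one_mat[of _ N N] assoc_mult_mat[of _ N N _ N _ N])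
    then show ?thesis by blast
  next
    case (3 c prs)
    then have "prs \<noteq> []" using True by auto
    then obtain prs' k j where prs: "prs = prs' @ [(k, j)]" by (cases prs rule: rev_cases) auto
    have "j \<ge> 1" "c \<ge> 1" using pos 3 prs by auto
    then have e: "epow N (A N) j = cpow N (A N) j" "epow N (A N) c = cpow N (A N) c" for N by (simp_all add: epow_def)
    have "pprod N w ps = epow N (A N) c * WV N w (enc prs') * hs.q N w k * epow N (A N) j" if "N \<ge> 1" "w \<in> space M" for N w
      unfolding e using that wc[OF that] word_model.wev_append[OF hs.model[OF that], of "enc prs'" "[(Some k, C j)]"]
      by (simp add: 3 prs pprod_append pprod_pairs pprod_simps pc_True pc_False
         left_mult_one_mat[of _ N N] right_mult_one_mat[of _ N N] assoc_mult_mat[of _ N N _ N _ N])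
    then show ?thesis by blast
  next
    case (4 c prs l)
    have "c \<ge> 1" using pos 4 by auto
    then have e: "epow N (A N) c = cpow N (A N) c" for N by (simp add: epow_def)
    have "pprod N w ps = epow N (A N) c * WV N w (enc prs) * hs.q N w l * epow N (A N) 0" if "N \<ge> 1" "w \<in> space M" for N w
      unfolding e using that wc[OF that]
      by (simp add: 4 pprod_append pprod_pairs pprod_simps epow_def pc_True pc_False
         left_mult_one_mat[of _ N N] right_mult_one_mat[of _ N N] assoc_mult_mat[of _ N N _ N _ N])
    then show ?thesis by blast
  qed
  then obtain c prs k j where eq: "\<And>N w. N \<ge> 1 \<Longrightarrow> w \<in> space M \<Longrightarrow>
     pprod N w ps = epow N (A N) c * WV N w (enc prs) * hs.q N w k * epow N (A N) j" by blast
  from main[of c prs k j] show ?thesis by (rule AE_cong_seq) (simp only: eq)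
qed

end

section \<open>Evaluation of noncommutative polynomials\<close>

lemma word_eval_carrier [simp]:
  "X \<in> carrier_mat N N \<Longrightarrow> Y \<in> carrier_mat N N \<Longrightarrow> word_eval N X Y u \<in> carrier_mat N N"
  by (induction u) (auto simp: word_eval_def)

lemma word_eval_Nil: "word_eval N X Y [] = 1\<^sub>m N"
  and word_eval_Cons: "word_eval N X Y (b # u) = (if b then Y else X) * word_eval N X Y u"
  by (simp_all add: word_eval_def)

lemma word_eval_append:
  assumes "X \<in> carrier_mat N N" "Y \<in> carrier_mat N N"
  shows "word_eval N X Y (u @ v) = word_eval N X Y u * word_eval N X Y v"
proof (induction u)
  case Nil
  then show ?case using assms by (simp add: word_eval_Nil left_mult_one_mat[of _ N N])
next
  case (Cons b u)
  then show ?case using assms by (simp add: word_eval_Cons assoc_mult_mat[of _ N N _ N _ N])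
qed

lemma word_eval_replicate:
  assumes "X \<in> carrier_mat N N" "Y \<in> carrier_mat N N"
  shows "word_eval N X Y (replicate k b) = (if b then Y else X) ^\<^sub>m k"
proof (induction k)
  case 0
  then show ?case using assms by (simp add: word_eval_Nil)
next
  case (Suc k)
  let ?Z = "if b then Y else X"
  have Z: "?Z \<in> carrier_mat N N" using assms by simp
  have "word_eval N X Y (replicate (Suc k) b) = ?Z ^\<^sub>m 1 * ?Z ^\<^sub>m k"
    using Suc Z by (simp add: word_eval_Cons left_mult_one_mat[of _ N N])
  also have "\<dots> = ?Z ^\<^sub>m Suc k" unfolding pow_mat_add[OF Z] by simp
  finally show ?case .
qed

lemma nc_eval_carrier [simp]: "nc_eval N X Y P \<in> carrier_mat N N"
  by (simp add: nc_eval_def)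

lemma nc_eval_entry:
  assumes "i < N" "j < N" "finite S" "{u. P u \<noteq> 0} \<subseteq> S"
  shows "nc_eval N X Y P $$ (i,j) = (\<Sum>u\<in>S. P u * word_eval N X Y u $$ (i,j))"
proof -
  have "(\<Sum>u\<in>{u. P u \<noteq> 0}. P u * word_eval N X Y u $$ (i,j)) = (\<Sum>u\<in>S. P u * word_eval N X Y u $$ (i,j))"
    using assms by (intro sum.mono_neutral_left) auto
  then show ?thesis using assms by (simp add: nc_eval_def)
qed

lemma nc_mult_support:
  "{u. nc_mult P Q u \<noteq> 0} \<subseteq> (\<lambda>(x,y). x @ y) ` ({u. P u \<noteq> 0} \<times> {u. Q u \<noteq> 0})"
proof
  fix u assume "u \<in> {u. nc_mult P Q u \<noteq> 0}"
  then have "(\<Sum>i\<le>length u. P (take i u) * Q (drop i u)) \<noteq> 0" by (simp add: nc_mult_def)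
  then obtain i where "P (take i u) * Q (drop i u) \<noteq> 0" by (rule sum.not_neutral_contains_not_neutral)
  then have "(take i u, drop i u) \<in> {u. P u \<noteq> 0} \<times> {u. Q u \<noteq> 0}" by simp
  then show "u \<in> (\<lambda>(x,y). x @ y) ` ({u. P u \<noteq> 0} \<times> {u. Q u \<noteq> 0})"
    by (rule rev_image_eqI) simp
qed

lemma is_ncpoly_mult: "is_ncpoly P \<Longrightarrow> is_ncpoly Q \<Longrightarrow> is_ncpoly (nc_mult P Q)"
  unfolding is_ncpoly_def using nc_mult_support[of P Q] by (rule finite_subset) simp

lemma is_ncpoly_one: "is_ncpoly nc_one"
  by (simp add: is_ncpoly_def nc_one_def)

lemma nc_eval_one: "nc_eval N X Y nc_one = 1\<^sub>m N"
proof (rule eq_matI)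
  fix i j assume ij: "i < dim_row (1\<^sub>m N :: complex mat)" "j < dim_col (1\<^sub>m N :: complex mat)"
  then show "nc_eval N X Y nc_one $$ (i,j) = 1\<^sub>m N $$ (i,j)"
    by (subst nc_eval_entry[of _ N _ "{[]}"]) (auto simp: nc_one_def word_eval_Nil split: if_splits)
qed (simp_all add: nc_eval_def)

lemma nc_eval_mult:
  assumes P: "is_ncpoly P" and Q: "is_ncpoly Q" and X: "X \<in> carrier_mat N N" and Y: "Y \<in> carrier_mat N N"
  shows "nc_eval N X Y (nc_mult P Q) = nc_eval N X Y P * nc_eval N X Y Q"
proof (rule eq_matI)
  let ?SP = "{u. P u \<noteq> 0}" and ?SQ = "{u. Q u \<noteq> 0}"
  let ?S = "(\<lambda>(x,y). x @ y) ` (?SP \<times> ?SQ)"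
  let ?E = "word_eval N X Y"
  have fin: "finite ?SP" "finite ?SQ" using P Q by (auto simp: is_ncpoly_def)
  fix i j assume "i < dim_row (nc_eval N X Y P * nc_eval N X Y Q)" "j < dim_col (nc_eval N X Y P * nc_eval N X Y Q)"
  then have ij: "i < N" "j < N" by (auto simp: nc_eval_def)
  let ?h = "\<lambda>(u, n). P (take n u) * Q (drop n u) * ?E u $$ (i,j)"
  \<comment> \<open>Different pairs may concatenate to the same word, so the cut position is
    recorded to make the map injective.\<close>
  let ?g = "\<lambda>(x, y). (x @ y, length x)"
  have "nc_eval N X Y (nc_mult P Q) $$ (i,j) = (\<Sum>u\<in>?S. nc_mult P Q u * ?E u $$ (i,j))"
    using fin by (intro nc_eval_entry ij nc_mult_support) auto
  also have "\<dots> = (\<Sum>u\<in>?S. \<Sum>n\<le>length u. ?h (u, n))"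
    by (simp add: nc_mult_def sum_distrib_right)
  also have "\<dots> = (\<Sum>z\<in>Sigma ?S (\<lambda>u. {..length u}). ?h z)"
    using fin by (subst sum.Sigma) (auto intro!: sum.cong)
  also have "\<dots> = (\<Sum>z\<in>?g ` (?SP \<times> ?SQ). ?h z)"
  proof (rule sum.mono_neutral_right)
    show "finite (Sigma ?S (\<lambda>u. {..length u}))" using fin by auto
    show "?g ` (?SP \<times> ?SQ) \<subseteq> Sigma ?S (\<lambda>u. {..length u})" by force
    show "\<forall>z\<in>Sigma ?S (\<lambda>u. {..length u}) - ?g ` (?SP \<times> ?SQ). ?h z = 0"
    proof
      fix z assume z: "z \<in> Sigma ?S (\<lambda>u. {..length u}) - ?g ` (?SP \<times> ?SQ)"
      obtain u n where un: "z = (u, n)" by force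
      have n: "n \<le> length u" using z un by auto
      have "P (take n u) = 0 \<or> Q (drop n u) = 0"
      proof (rule ccontr)
        assume "\<not> ?thesis"
        then have "(take n u, drop n u) \<in> ?SP \<times> ?SQ" by simp
        then have "?g (take n u, drop n u) \<in> ?g ` (?SP \<times> ?SQ)" by (rule imageI)
        then show False using z un n by simp
      qed
      then show "?h z = 0" using un by auto
    qed
  qed
  also have "\<dots> = (\<Sum>z\<in>?SP \<times> ?SQ. ?h (?g z))"
  proof (rule sum.reindex_cong[OF _ refl refl])
    show "inj_on ?g (?SP \<times> ?SQ)"
    proof (rule inj_onI, clarify)
      fix x y x' y' :: "bool list" assume "x @ y = x' @ y'" "length x = length x'"
      then show "x = x' \<and> y = y'" by simp
    qed
  qed
  also have "\<dots> = (\<Sum>(x,y)\<in>?SP \<times> ?SQ. P x * Q y * (\<Sum>k<N. ?E x $$ (i,k) * ?E y $$ (k,j)))"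
    using ij X Y by (intro sum.cong refl) (auto simp: word_eval_append mult_entry[of _ N] simp del: index_mult_mat)
  also have "\<dots> = (\<Sum>x\<in>?SP. \<Sum>y\<in>?SQ. \<Sum>k<N. (P x * ?E x $$ (i,k)) * (Q y * ?E y $$ (k,j)))"
    unfolding sum.cartesian_product[symmetric] by (simp add: sum_distrib_left mult_ac)
  also have "\<dots> = (\<Sum>k<N. \<Sum>x\<in>?SP. \<Sum>y\<in>?SQ. (P x * ?E x $$ (i,k)) * (Q y * ?E y $$ (k,j)))"
    by (subst (2) sum.swap, subst sum.swap) simp
  also have "\<dots> = (\<Sum>k<N. (\<Sum>x\<in>?SP. P x * ?E x $$ (i,k)) * (\<Sum>y\<in>?SQ. Q y * ?E y $$ (k,j)))"
    by (simp add: sum_product)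
  also have "\<dots> = (\<Sum>k<N. nc_eval N X Y P $$ (i,k) * nc_eval N X Y Q $$ (k,j))"
    using ij fin by (intro sum.cong refl) (simp add: nc_eval_entry[OF _ _ fin(1) order_refl] nc_eval_entry[OF _ _ fin(2) order_refl])
  finally show "nc_eval N X Y (nc_mult P Q) $$ (i,j) = (nc_eval N X Y P * nc_eval N X Y Q) $$ (i,j)"
    unfolding mult_entry[OF nc_eval_carrier nc_eval_carrier ij] .
qed (simp_all add: nc_eval_def)

lemma tr_mult_nc_eval:
  assumes P: "is_ncpoly P" and X: "X \<in> carrier_mat N N" "Y \<in> carrier_mat N N"
    and L: "L \<in> carrier_mat N N" and R: "R \<in> carrier_mat N N"
  shows "tr (L * (nc_eval N X Y P * R)) = (\<Sum>u\<in>{u. P u \<noteq> 0}. P u * tr (L * (word_eval N X Y u * R)))"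
proof -
  have cyc: "tr (L * (Z * R)) = (\<Sum>i<N. \<Sum>j<N. (R * L) $$ (i,j) * Z $$ (j,i))" if Z: "Z \<in> carrier_mat N N" for Z
  proof -
    have "tr (L * (Z * R)) = tr (L * Z * R)" using L R Z by (simp add: assoc_mult_mat[of _ N N _ N _ N])
    also have "\<dots> = tr (R * (L * Z))" using L R Z by (intro tr_mult_comm[of _ N]) auto
    also have "\<dots> = tr (R * L * Z)" using L R Z by (simp add: assoc_mult_mat[of _ N N _ N _ N])
    finally show ?thesis unfolding tr_mult[OF mult_square_carrier[OF R L] Z] .
  qed
  have fin: "finite {u. P u \<noteq> 0}" using P by (simp add: is_ncpoly_def)
  have "tr (L * (nc_eval N X Y P * R)) = (\<Sum>i<N. \<Sum>j<N. \<Sum>u\<in>{u. P u \<noteq> 0}. P u * ((R * L) $$ (i,j) * word_eval N X Y u $$ (j,i)))"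
    unfolding cyc[OF nc_eval_carrier]
    by (intro sum.cong refl) (simp add: nc_eval_entry[OF _ _ fin order_refl] sum_distrib_left mult_ac del: index_mult_mat)
  also have "\<dots> = (\<Sum>u\<in>{u. P u \<noteq> 0}. \<Sum>i<N. \<Sum>j<N. P u * ((R * L) $$ (i,j) * word_eval N X Y u $$ (j,i)))"
    by (subst (2) sum.swap, subst sum.swap) simp
  finally show ?thesis unfolding cyc[OF word_eval_carrier[OF X]] sum_distrib_left .
qed

lemma tr_mult_centered:
  assumes "X \<in> carrier_mat N N" "Y \<in> carrier_mat N N" "Z \<in> carrier_mat N N"
  shows "tr (X * ((Y - c \<cdot>\<^sub>m 1\<^sub>m N) * Z)) = tr (X * (Y * Z)) - c * tr (X * Z)"
proof -
  have "(Y - c \<cdot>\<^sub>m 1\<^sub>m N) * Z = Y * Z - c \<cdot>\<^sub>m Z"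
    using assms by (simp add: minus_mult_distrib_mat[of _ N N _ _ N] mult_smult_assoc_mat[of _ N N _ N] left_mult_one_mat[of _ N N])
  then have "X * ((Y - c \<cdot>\<^sub>m 1\<^sub>m N) * Z) = X * (Y * Z) - c \<cdot>\<^sub>m (X * Z)"
    using assms by (simp add: mult_minus_distrib_mat[of _ N N _ N] mult_smult_distrib[of _ N N _ N])
  then show ?thesis using assms by (simp add: tr_minus[of _ N] tr_smult[of _ N])
qed

fun unblock :: "(bool \<times> nat) list \<Rightarrow> bool list" where
  "unblock [] = []"
| "unblock ((b,k) # ps) = replicate k b @ unblock ps"

lemma word_blocks:
  "\<exists>ps. unblock ps = u \<and> successively (\<noteq>) (map fst ps) \<and> (\<forall>p\<in>set ps. snd p \<ge> 1)"
proof (induction u)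
  case Nil
  show ?case by (rule exI[of _ "[]"]) simp
next
  case (Cons b u)
  then obtain ps where ps: "unblock ps = u" "successively (\<noteq>) (map fst ps)" "\<forall>p\<in>set ps. snd p \<ge> 1" by blast
  show ?case
  proof (cases ps)
    case Nil
    then show ?thesis using ps by (intro exI[of _ "[(b,1)]"]) auto
  next
    case (Cons p qs)
    obtain c k where p: "p = (c, k)" by force
    show ?thesis
    proof (cases "b = c")
      case True
      have "successively (\<noteq>) (map fst ((c, Suc k) # qs))" using ps Cons p by (cases qs) auto
      then show ?thesis using ps Cons p True by (intro exI[of _ "(c, Suc k) # qs"]) auto
    next
      case False
      then show ?thesis using ps Cons p by (intro exI[of _ "(b, 1) # ps"]) auto
    qed
  qed
qed

lemma in_subalg_word:
  assumes "in_subalg b a" "a u \<noteq> 0"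
  shows "u = replicate (length u) b"
proof -
  have "set u \<subseteq> {b}" using assms unfolding in_subalg_def by blast
  then show ?thesis by (intro replicate_eqI) auto
qed

definition lin_ext :: "(bool list \<Rightarrow> complex) \<Rightarrow> ncpoly \<Rightarrow> complex" where
  "lin_ext c P = (\<Sum>u\<in>{u. P u \<noteq> 0}. P u * c u)"

lemma lin_ext_superset: "finite S \<Longrightarrow> {u. P u \<noteq> 0} \<subseteq> S \<Longrightarrow> lin_ext c P = (\<Sum>u\<in>S. P u * c u)"
  unfolding lin_ext_def by (rule sum.mono_neutral_left) auto

lemma unital_linear_functional_lin_ext:
  assumes "c [] = 1"
  shows "unital_linear_functional (lin_ext c)"
  unfolding unital_linear_functional_def
proof (intro conjI allI impI)
  fix P Q assume "is_ncpoly P" "is_ncpoly Q"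
  then have fin: "finite ({u. P u \<noteq> 0} \<union> {u. Q u \<noteq> 0})" (is "finite ?S") by (simp add: is_ncpoly_def)
  have "lin_ext c (\<lambda>w. P w + Q w) = (\<Sum>u\<in>?S. (P u + Q u) * c u)"
    by (rule lin_ext_superset[OF fin]) auto
  also have "\<dots> = (\<Sum>u\<in>?S. P u * c u) + (\<Sum>u\<in>?S. Q u * c u)"
    by (simp add: distrib_right sum.distrib)
  also have "\<dots> = lin_ext c P + lin_ext c Q"
    using lin_ext_superset[OF fin, of P c] lin_ext_superset[OF fin, of Q c] by simp
  finally show "lin_ext c (\<lambda>w. P w + Q w) = lin_ext c P + lin_ext c Q" .
next
  fix a P assume "is_ncpoly P"
  then have fin: "finite {u. P u \<noteq> 0}" (is "finite ?S") by (simp add: is_ncpoly_def)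
  have "lin_ext c (\<lambda>w. a * P w) = (\<Sum>u\<in>?S. (a * P u) * c u)"
    by (rule lin_ext_superset[OF fin]) auto
  then show "lin_ext c (\<lambda>w. a * P w) = a * lin_ext c P" by (simp add: lin_ext_def sum_distrib_left mult.assoc)
next
  have "lin_ext c nc_one = (\<Sum>u\<in>{[]}. nc_one u * c u)"
    by (rule lin_ext_superset) (auto simp: nc_one_def split: if_splits)
  then show "lin_ext c nc_one = 1" using assms by (simp add: nc_one_def)
qed

section \<open>Limits of all words\<close>

context rotated_ensemble
begin

definition mt :: "bool \<Rightarrow> nat \<Rightarrow> complex" where
  "mt b k = (if b then mB k else mA k)"

lemma tb_conv: "(\<lambda>N. tb N b k) \<longlonglongrightarrow> mt b k"
  unfolding tb_def mt_def using A_conv B_conv by simp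

abbreviation "we N w u \<equiv> word_eval N (A N) (BB N w) u"
abbreviation "ne N w a \<equiv> nc_eval N (A N) (BB N w) a"

lemma BB_carrier [simp]: "N \<ge> 1 \<Longrightarrow> w \<in> space M \<Longrightarrow> BB N w \<in> carrier_mat N N"
  using Mb_carrier[of N w True] by (simp add: Mb_def)

lemma we_replicate: "N \<ge> 1 \<Longrightarrow> w \<in> space M \<Longrightarrow> we N w (replicate k b) = Mb N w b ^\<^sub>m k"
  by (simp add: word_eval_replicate[of _ N] Mb_def)

definition nprod :: "nat \<Rightarrow> 'w \<Rightarrow> ncpoly list \<Rightarrow> complex mat" where
  "nprod N w as = foldr (\<lambda>a X. ne N w a * X) as (1\<^sub>m N)"

lemma nprod_simps: "nprod N w [] = 1\<^sub>m N" "nprod N w (a # as) = ne N w a * nprod N w as"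
  by (simp_all add: nprod_def)

lemma nprod_carrier [simp]: "nprod N w as \<in> carrier_mat N N"
  by (induction as) (auto simp: nprod_simps)

lemma nprod_eq:
  assumes "N \<ge> 1" "w \<in> space M" "\<forall>a\<in>set as. is_ncpoly a"
  shows "is_ncpoly (foldr nc_mult as nc_one) \<and> nc_eval N (A N) (BB N w) (foldr nc_mult as nc_one) = nprod N w as"
  using assms(3)
  by (induction as) (use assms(1,2) in \<open>auto simp: is_ncpoly_one nc_eval_one nprod_simps is_ncpoly_mult nc_eval_mult[of _ _ _ N]\<close>)

definition ae_conv :: "(nat \<Rightarrow> 'w \<Rightarrow> complex) \<Rightarrow> complex \<Rightarrow> bool" where
  "ae_conv f c \<longleftrightarrow> (AE w in M. (\<lambda>N. f N w) \<longlonglongrightarrow> c)"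

lemma ae_conv_cong: "ae_conv f c \<Longrightarrow> (\<And>N w. N \<ge> 1 \<Longrightarrow> w \<in> space M \<Longrightarrow> f N w = g N w) \<Longrightarrow> ae_conv g c"
  unfolding ae_conv_def by (rule AE_cong_seq)

lemma ae_conv_add:
  assumes "ae_conv f c" "ae_conv g e"
  shows "ae_conv (\<lambda>N w. f N w + g N w) (c + e)"
  using assms unfolding ae_conv_def by eventually_elim (rule tendsto_add)

lemma ae_conv_diff:
  assumes "ae_conv f c" "ae_conv g e"
  shows "ae_conv (\<lambda>N w. f N w - g N w) (c - e)"
  using assms unfolding ae_conv_def by eventually_elim (rule tendsto_diff)

lemma ae_conv_mult:
  assumes "s \<longlonglongrightarrow> s0" "ae_conv f c"
  shows "ae_conv (\<lambda>N w. s N * f N w) (s0 * c)"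
  using assms(2) unfolding ae_conv_def by eventually_elim (rule tendsto_mult[OF assms(1)])

lemma ae_conv_sum:
  assumes "\<And>i. i \<in> I \<Longrightarrow> ae_conv (f i) (c i)"
  shows "ae_conv (\<lambda>N w. \<Sum>i\<in>I. f i N w) (\<Sum>i\<in>I. c i)"
  using assms
proof (induction I rule: infinite_finite_induct)
  case (insert x F)
  then show ?case using ae_conv_add[of "f x" "c x"] by simp
qed (simp_all add: ae_conv_def)

text \<open>Both limits hold simultaneously at some point, since a probability space is not
  null.\<close>

lemma ae_conv_unique:
  assumes "ae_conv f c" "ae_conv f e"
  shows "c = e"
proof -
  have "AE w in M. c = e"
    using assms unfolding ae_conv_def by eventually_elim (rule LIMSEQ_unique)
  then show ?thesis by simp
qed

end

text \<open>The normalized trace and the vector state both have the form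
  \<open>tr (X * Y N)\<close>, with \<open>Y N\<close> the scaled identity or the projection on
  \<open>v N\<close>; \<tau> and \<phi> thus share one argument. Its input is the vanishing of
  alternating centered products and the limits of pure powers.\<close>

locale state_limits = rotated_ensemble M rc A B v U mA mv mB
  for M :: "'w measure" and rc A B v U mA mv mB +
  fixes Y :: "nat \<Rightarrow> complex mat" and cb :: "bool \<Rightarrow> nat \<Rightarrow> complex"
  assumes Y_carrier [simp]: "N \<ge> 1 \<Longrightarrow> Y N \<in> carrier_mat N N"
    and alternating: "successively (\<noteq>) (map fst ps) \<Longrightarrow> length ps \<ge> 2 \<Longrightarrow> \<forall>p\<in>set ps. snd p \<ge> 1 \<Longrightarrow>
        ae_conv (\<lambda>N w. tr (pprod N w ps * Y N)) 0"
    and single: "ae_conv (\<lambda>N w. tr (Mb N w b ^\<^sub>m k * Y N)) (cb b k)"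
begin

text \<open>An expanded word, then centered powers, then polynomials. The inductions expand the
  later parts into the earlier ones.\<close>

definition G :: "bool list \<Rightarrow> (bool \<times> nat) list \<Rightarrow> ncpoly list \<Rightarrow> nat \<Rightarrow> 'w \<Rightarrow> complex" where
  "G x ps as N w = tr (we N w x * (pprod N w ps * (nprod N w as * Y N)))"

lemma G_piece:
  assumes "N \<ge> 1" "w \<in> space M"
  shows "G x ((b,k) # ps) as N w = G (x @ replicate k b) ps as N w - tb N b k * G x ps as N w"
proof -
  define Z where "Z = pprod N w ps * (nprod N w as * Y N)"
  have Z: "Z \<in> carrier_mat N N" unfolding Z_def using assms by simp
  have m: "Mb N w b ^\<^sub>m k \<in> carrier_mat N N" by (rule pow_mat_carrier[OF Mb_carrier[OF assms]])
  have x: "we N w x \<in> carrier_mat N N" by (rule word_eval_carrier[OF A_carrier[OF assms(1)] BB_carrier[OF assms]])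
  have "G x ((b,k) # ps) as N w = tr (we N w x * (pc N w (b,k) * Z))"
    unfolding G_def pprod_simps Z_def
    by (subst assoc_mult_mat[OF pc_carrier[OF assms] pprod_carrier[OF assms] mult_square_carrier[OF nprod_carrier Y_carrier[OF assms(1)]]]) (rule refl)
  also have "\<dots> = tr (we N w x * (Mb N w b ^\<^sub>m k * Z)) - tb N b k * tr (we N w x * Z)"
    unfolding pc_def fst_conv snd_conv by (rule tr_mult_centered[OF x m Z])
  also have "we N w x * (Mb N w b ^\<^sub>m k * Z) = we N w (x @ replicate k b) * Z"
    unfolding word_eval_append[OF A_carrier[OF assms(1)] BB_carrier[OF assms]] we_replicate[OF assms]
    by (rule assoc_mult_mat[OF x m Z, symmetric])
  finally show ?thesis unfolding G_def Z_def .
qed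

lemma G_poly:
  assumes "N \<ge> 1" "w \<in> space M" "is_ncpoly a"
  shows "G x [] (a # as) N w = (\<Sum>u\<in>{u. a u \<noteq> 0}. a u * G (x @ u) [] as N w)"
proof -
  define Z where "Z = nprod N w as * Y N"
  have Z: "Z \<in> carrier_mat N N" unfolding Z_def using assms by simp
  have x: "we N w u \<in> carrier_mat N N" for u
    by (rule word_eval_carrier[OF A_carrier[OF assms(1)] BB_carrier[OF assms(1,2)]])
  have "G x [] (a # as) N w = tr (we N w x * (ne N w a * Z))"
    unfolding G_def Z_def nprod_simps pprod_simps
    by (subst assoc_mult_mat[OF nc_eval_carrier nprod_carrier Y_carrier[OF assms(1)]], subst left_mult_one_mat)
      (use assms in \<open>auto intro!: mult_square_carrier[of _ N]\<close>)
  also have "\<dots> = (\<Sum>u\<in>{u. a u \<noteq> 0}. a u * tr (we N w x * (we N w u * Z)))"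
    by (rule tr_mult_nc_eval[OF assms(3) A_carrier[OF assms(1)] BB_carrier[OF assms(1,2)] x Z])
  also have "\<dots> = (\<Sum>u\<in>{u. a u \<noteq> 0}. a u * G (x @ u) [] as N w)"
  proof (intro sum.cong refl arg_cong2[where f = times])
    fix u
    show "tr (we N w x * (we N w u * Z)) = G (x @ u) [] as N w"
      unfolding G_def pprod_simps word_eval_append[OF A_carrier[OF assms(1)] BB_carrier[OF assms(1,2)]]
        Z_def[symmetric] left_mult_one_mat[OF Z]
      by (rule arg_cong[OF assoc_mult_mat[OF x x Z, symmetric]])
  qed
  finally show ?thesis .
qed

text \<open>A polynomial in one variable is a combination of centered powers plus a scalar, its
  normalized trace at size \<open>N\<close>.\<close>

lemma G_centered_poly:
  assumes "N \<ge> 1" "w \<in> space M" "in_subalg b a"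
  shows "G [] ps (a # as) N w = (\<Sum>u\<in>{u. a u \<noteq> 0}. a u * G [] (ps @ [(b, length u)]) as N w)
     + (\<Sum>u\<in>{u. a u \<noteq> 0}. a u * tb N b (length u)) * G [] ps as N w"
proof -
  define Z where "Z = nprod N w as * Y N"
  have Z: "Z \<in> carrier_mat N N" unfolding Z_def using assms by simp
  define L where "L = pprod N w ps"
  have L: "L \<in> carrier_mat N N" unfolding L_def using assms by simp
  have G0: "G [] ps' as N w = tr (pprod N w ps' * Z)" for ps'
    unfolding G_def Z_def[symmetric] using assms Z by (simp add: word_eval_Nil left_mult_one_mat[of _ N N])
  have "G [] ps (a # as) N w = tr (L * (ne N w a * Z))"
    unfolding G_def nprod_simps Z_def L_def word_eval_Nil
    by (subst assoc_mult_mat[OF nc_eval_carrier nprod_carrier Y_carrier[OF assms(1)]], subst left_mult_one_mat)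
      (use assms in \<open>auto intro!: mult_square_carrier[of _ N]\<close>)
  also have "\<dots> = (\<Sum>u\<in>{u. a u \<noteq> 0}. a u * tr (L * (we N w u * Z)))"
    by (rule tr_mult_nc_eval[OF _ A_carrier[OF assms(1)] BB_carrier[OF assms(1,2)] L Z])
      (use assms in \<open>simp add: in_subalg_def\<close>)
  also have "\<dots> = (\<Sum>u\<in>{u. a u \<noteq> 0}. a u * G [] (ps @ [(b, length u)]) as N w + a u * tb N b (length u) * G [] ps as N w)"
  proof (intro sum.cong refl)
    fix u assume "u \<in> {u. a u \<noteq> 0}"
    then have "u = replicate (length u) b" by (intro in_subalg_word[OF assms(3)]) simp
    from arg_cong[OF this, of "we N w"] have u: "we N w u = Mb N w b ^\<^sub>m length u"
      unfolding we_replicate[OF assms(1,2)] .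
    have m: "Mb N w b ^\<^sub>m length u \<in> carrier_mat N N" by (rule pow_mat_carrier[OF Mb_carrier[OF assms(1,2)]])
    have "pprod N w (ps @ [(b, length u)]) = L * pc N w (b, length u)"
      unfolding pprod_append[OF assms(1,2)] pprod_simps L_def[symmetric]
      by (simp only: right_mult_one_mat[OF pc_carrier[OF assms(1,2)]])
    then have "G [] (ps @ [(b, length u)]) as N w = tr (L * (pc N w (b, length u) * Z))"
      unfolding G0 by (simp only: assoc_mult_mat[OF L pc_carrier[OF assms(1,2)] Z])
    also have "\<dots> = tr (L * (we N w u * Z)) - tb N b (length u) * G [] ps as N w"
      unfolding G0 L_def[symmetric] u pc_def fst_conv snd_conv by (rule tr_mult_centered[OF L m Z])
    finally have "tr (L * (we N w u * Z)) = G [] (ps @ [(b, length u)]) as N w + tb N b (length u) * G [] ps as N w"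
      by simp
    then show "a u * tr (L * (we N w u * Z)) = a u * G [] (ps @ [(b, length u)]) as N w + a u * tb N b (length u) * G [] ps as N w"
      by (simp add: distrib_left mult.assoc)
  qed
  finally show ?thesis by (simp add: sum.distrib sum_distrib_right)
qed

text \<open>Expanding a centered power never increases the total length, so only plain words of
  length below \<open>n\<close> arise.\<close>

lemma conv_lower:
  assumes IH: "\<And>x. length x < n \<Longrightarrow> \<exists>c. ae_conv (G x [] as) c"
    and "length x + length (unblock ps) < n"
  shows "\<exists>c. ae_conv (G x ps as) c"
  using assms(2)
proof (induction ps arbitrary: x)
  case Nil
  then show ?case using IH by simp
next
  case (Cons p ps)
  obtain b k where p: "p = (b, k)" by force
  have len: "length (x @ replicate k b) + length (unblock ps) < n" "length x + length (unblock ps) < n"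
    using Cons.prems by (auto simp: p)
  obtain c e where "ae_conv (G (x @ replicate k b) ps as) c" "ae_conv (G x ps as) e"
    using Cons.IH[OF len(1)] Cons.IH[OF len(2)] by blast
  then have "ae_conv (\<lambda>N w. G (x @ replicate k b) ps as N w - tb N b k * G x ps as N w) (c - mt b k * e)"
    by (intro ae_conv_diff ae_conv_mult tb_conv)
  then have "ae_conv (G x (p # ps) as) (c - mt b k * e)"
    by (rule ae_conv_cong) (simp add: p G_piece)
  then show ?case by blast
qed

text \<open>Undoing the centering of one block changes the product by a bounded multiple of a
  strictly shorter one, which converges by \<open>conv_lower\<close>. Hence convergence passes from
  the centered product to the plain word.\<close>

lemma conv_top:
  assumes IH: "\<And>x. length x < n \<Longrightarrow> \<exists>c. ae_conv (G x [] []) c"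
    and "length x + length (unblock ps) = n" "\<forall>p\<in>set ps. snd p \<ge> 1" "\<exists>c. ae_conv (G x ps []) c"
  shows "\<exists>c. ae_conv (G (x @ unblock ps) [] []) c"
  using assms(2-4)
proof (induction ps arbitrary: x)
  case Nil
  then show ?case by simp
next
  case (Cons p ps)
  obtain b k where p: "p = (b, k)" by force
  have "k \<ge> 1" using Cons.prems p by simp
  then have "length x + length (unblock ps) < n" using Cons.prems(1) p by simp
  then obtain e where e: "ae_conv (G x ps []) e" using conv_lower[OF IH] by blast
  obtain c where "ae_conv (G x (p # ps) []) c" using Cons.prems by blast
  then have "ae_conv (\<lambda>N w. G x (p # ps) [] N w + tb N b k * G x ps [] N w) (c + mt b k * e)"
    using e by (intro ae_conv_add ae_conv_mult tb_conv)
  then have "ae_conv (G (x @ replicate k b) ps []) (c + mt b k * e)"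
    by (rule ae_conv_cong) (simp add: p G_piece)
  then have "\<exists>c. ae_conv (G ((x @ replicate k b) @ unblock ps) [] []) c"
    by (intro Cons.IH) (use Cons.prems p in auto)
  then show ?case by (simp add: p)
qed

lemma G_word: "N \<ge> 1 \<Longrightarrow> w \<in> space M \<Longrightarrow> G u [] [] N w = tr (we N w u * Y N)"
  unfolding G_def pprod_simps nprod_simps by (simp add: left_mult_one_mat[of _ N N])

text \<open>The word is cut into alternating blocks. With two or more blocks the centered product
  tends to 0 and \<open>conv_top\<close> applies; otherwise the word is a pure power.\<close>

lemma conv_word: "\<exists>c. ae_conv (G u [] []) c"
proof (induction "length u" arbitrary: u rule: less_induct)
  case less
  obtain ps where ps: "unblock ps = u" "successively (\<noteq>) (map fst ps)" "\<forall>p\<in>set ps. snd p \<ge> 1"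
    using word_blocks by blast
  show ?case
  proof (cases "length ps \<ge> 2")
    case True
    have "ae_conv (G [] ps []) 0"
      by (rule ae_conv_cong[OF alternating[OF ps(2) True ps(3)]])
        (simp add: G_def nprod_simps word_eval_Nil left_mult_one_mat[of _ N N for N])
    then have "\<exists>c. ae_conv (G ([] @ unblock ps) [] []) c"
      using less ps by (intro conv_top[where n = "length u"]) auto
    then show ?thesis using ps by simp
  next
    case False
    obtain b k where u: "u = replicate k b"
    proof (cases ps)
      case Nil
      then show ?thesis using ps that[of 0] by simp
    next
      case (Cons p qs)
      then have "qs = []" using False by (cases qs) auto
      then have "u = replicate (snd p) (fst p)" using ps(1) Cons by (cases p) simp
      then show ?thesis by (rule that)
    qed
    have "ae_conv (G u [] []) (cb b k)"
      by (rule ae_conv_cong[OF single]) (simp add: G_word u we_replicate)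
    then show ?thesis by blast
  qed
qed

definition cw :: "bool list \<Rightarrow> complex" where
  "cw u = (SOME c. ae_conv (G u [] []) c)"

lemma cw: "ae_conv (\<lambda>N w. tr (we N w u * Y N)) (cw u)"
  unfolding cw_def by (rule ae_conv_cong[OF someI_ex[OF conv_word]]) (simp add: G_word)

lemma cw_replicate: "cw (replicate k b) = cb b k"
proof (rule ae_conv_unique[OF cw])
  show "ae_conv (\<lambda>N w. tr (we N w (replicate k b) * Y N)) (cb b k)"
    by (rule ae_conv_cong[OF single]) (simp add: we_replicate)
qed

text \<open>The value of the limit is irrelevant: in \<open>centered_product_zero\<close> it is
  multiplied by a coefficient that tends to 0.\<close>

lemma conv_polys:
  assumes "\<forall>a\<in>set as. is_ncpoly a"
  shows "\<exists>c. ae_conv (G x ps as) c"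
proof -
  have 0: "\<exists>c. ae_conv (G x [] as) c" for x
    using assms
  proof (induction as arbitrary: x)
    case Nil
    show ?case by (rule conv_word)
  next
    case (Cons a as)
    then have "\<forall>u. \<exists>c. ae_conv (G (x @ u) [] as) c" by simp
    then obtain c where c: "\<And>u. ae_conv (G (x @ u) [] as) (c u)" by metis
    have "ae_conv (\<lambda>N w. \<Sum>u\<in>{u. a u \<noteq> 0}. a u * G (x @ u) [] as N w) (\<Sum>u\<in>{u. a u \<noteq> 0}. a u * c u)"
      by (intro ae_conv_sum ae_conv_mult tendsto_const c)
    then have "ae_conv (G x [] (a # as)) (\<Sum>u\<in>{u. a u \<noteq> 0}. a u * c u)"
      by (rule ae_conv_cong) (use Cons.prems in \<open>simp add: G_poly\<close>)
    then show ?case by blast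
  qed
  show ?thesis by (rule conv_lower[where n = "Suc (length x + length (unblock ps))"]) (use 0 in auto)
qed

lemma pc_zero: "N \<ge> 1 \<Longrightarrow> w \<in> space M \<Longrightarrow> pc N w (b, 0) = 0\<^sub>m N N"
proof -
  assume N: "N \<ge> 1" and w: "w \<in> space M"
  have "tb N b 0 = 1"
    unfolding tb_def emp_moment_def using N carrier_matD(1)[OF A_carrier[OF N]] carrier_matD(1)[OF B_carrier[OF N]]
    by (simp add: tr_one)
  then show ?thesis
    unfolding pc_def using carrier_matD(1)[OF Mb_carrier[OF N w, of b]] by (intro eq_matI) auto
qed

lemma pprod_zero:
  assumes "N \<ge> 1" "w \<in> space M" "p \<in> set ps" "snd p = 0"
  shows "pprod N w ps = 0\<^sub>m N N"
proof -
  obtain p1 p2 where "ps = p1 @ p # p2" using assms(3) by (meson in_set_conv_decomp)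
  moreover have "pc N w p = 0\<^sub>m N N" using pc_zero[OF assms(1,2), of "fst p"] assms(4) by (metis prod.collapse)
  ultimately show ?thesis using assms
    by (simp add: pprod_append pprod_simps left_mult_zero_mat[of _ N N] right_mult_zero_mat[of _ N N])
qed

text \<open>Constant terms of polynomials lead to exponent 0, which \<open>alternating\<close>
  excludes; such a centered factor is the zero matrix.\<close>

lemma alternating_all:
  assumes "successively (\<noteq>) (map fst ps)" "length ps \<ge> 2"
  shows "ae_conv (G [] ps []) 0"
proof (cases "\<forall>p\<in>set ps. snd p \<ge> 1")
  case True
  show ?thesis
    by (rule ae_conv_cong[OF alternating[OF assms True]])
      (simp add: G_def nprod_simps word_eval_Nil left_mult_one_mat[of _ N N for N])
next
  case False
  then obtain p where p: "p \<in> set ps" "snd p = 0" by (auto simp: not_le)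
  have "ae_conv (\<lambda>N w. 0) 0" by (simp add: ae_conv_def)
  then show ?thesis
    by (rule ae_conv_cong)
      (use p in \<open>simp add: G_def nprod_simps pprod_zero word_eval_Nil left_mult_one_mat[of _ N N for N] left_mult_zero_mat[of _ N N for N] tr_def\<close>)
qed

text \<open>Each polynomial is traded for centered powers of the same variable, so alternation and
  the number of factors persist. The leftover scalar tends to the assumed value 0 and meets a
  convergent factor.\<close>

lemma centered_product_zero:
  assumes "list_all2 (\<lambda>a b. in_subalg b a \<and> (\<Sum>u\<in>{u. a u \<noteq> 0}. a u * mt b (length u)) = 0) as idx"
    and "successively (\<noteq>) (map fst ps @ idx)" "length ps + length idx \<ge> 2"
  shows "ae_conv (G [] ps as) 0"
  using assms
proof (induction as idx arbitrary: ps rule: list_all2_induct)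
  case Nil
  then show ?case using alternating_all by simp
next
  case (Cons a as b idx)
  have nc: "\<forall>a\<in>set as. is_ncpoly a"
    using Cons(2) by (auto simp: list_all2_conv_all_nth in_set_conv_nth in_subalg_def)
  obtain c where c: "ae_conv (G [] ps as) c" using conv_polys[OF nc] by blast
  have "ae_conv (\<lambda>N w. (\<Sum>u\<in>{u. a u \<noteq> 0}. a u * G [] (ps @ [(b, length u)]) as N w)
     + (\<Sum>u\<in>{u. a u \<noteq> 0}. a u * tb N b (length u)) * G [] ps as N w)
     ((\<Sum>u\<in>{u. a u \<noteq> 0}. a u * 0) + (\<Sum>u\<in>{u. a u \<noteq> 0}. a u * mt b (length u)) * c)"
    by (intro ae_conv_add ae_conv_sum ae_conv_mult tendsto_intros c tb_conv Cons.IH) (use Cons.prems in auto)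
  then have "ae_conv (\<lambda>N w. (\<Sum>u\<in>{u. a u \<noteq> 0}. a u * G [] (ps @ [(b, length u)]) as N w)
     + (\<Sum>u\<in>{u. a u \<noteq> 0}. a u * tb N b (length u)) * G [] ps as N w) 0"
    using Cons(1) by simp
  then show ?case by (rule ae_conv_cong) (simp only: G_centered_poly[OF _ _ conjunct1[OF Cons(1)]])
qed

lemma poly_limit:
  assumes "is_ncpoly P"
  shows "ae_conv (\<lambda>N w. tr (ne N w P * Y N)) (lin_ext cw P)"
proof -
  have "ae_conv (\<lambda>N w. \<Sum>u\<in>{u. P u \<noteq> 0}. P u * tr (we N w u * Y N)) (lin_ext cw P)"
    unfolding lin_ext_def by (intro ae_conv_sum ae_conv_mult tendsto_const cw)
  then show ?thesis
  proof (rule ae_conv_cong)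
    fix N :: nat and w assume N: "N \<ge> 1" "w \<in> space M"
    have "tr (1\<^sub>m N * (ne N w P * Y N)) = (\<Sum>u\<in>{u. P u \<noteq> 0}. P u * tr (1\<^sub>m N * (we N w u * Y N)))"
      using N assms by (intro tr_mult_nc_eval) auto
    then show "(\<Sum>u\<in>{u. P u \<noteq> 0}. P u * tr (we N w u * Y N)) = tr (ne N w P * Y N)"
      using N by (simp add: left_mult_one_mat[of _ N N])
  qed
qed

lemma lin_ext_centered_product:
  assumes "list_all2 (\<lambda>a b. in_subalg b a \<and> (\<Sum>u\<in>{u. a u \<noteq> 0}. a u * mt b (length u)) = 0) as idx"
    and "successively (\<noteq>) idx" "length idx \<ge> 2"
  shows "lin_ext cw (foldr nc_mult as nc_one) = 0"
proof -
  have nc: "\<forall>a\<in>set as. is_ncpoly a"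
    using assms(1) by (auto simp: list_all2_conv_all_nth in_set_conv_nth in_subalg_def)
  have poly: "is_ncpoly (foldr nc_mult as nc_one)"
    using nc by (induction as) (auto simp: is_ncpoly_one is_ncpoly_mult)
  have "ae_conv (G [] [] as) 0" using assms by (intro centered_product_zero) auto
  then have "ae_conv (\<lambda>N w. tr (ne N w (foldr nc_mult as nc_one) * Y N)) 0"
    by (rule ae_conv_cong)
      (use nprod_eq[OF _ _ nc] in \<open>simp add: G_def pprod_simps word_eval_Nil left_mult_one_mat[of _ N N for N]\<close>)
  then show ?thesis using ae_conv_unique poly_limit[OF poly] by blast
qed

end

section \<open>The two limit functionals and conditional freeness\<close>

context rotated_ensemble
begin

lemma tr_Mb_pow:
  assumes "N \<ge> 1" "w \<in> space M"
  shows "tr (Mb N w b ^\<^sub>m k) = of_nat N * tb N b k"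
proof -
  have "tr (pc N w (b, k)) = 0"
  proof (cases b)
    case True
    then show ?thesis using pc_True[OF assms] haar_words.tr_q[OF haar_words_cpow[OF assms(1)] assms(2)] by simp
  next
    case False
    then show ?thesis using pc_False tr_cpow[OF A_carrier[OF assms(1)] assms(1)] by simp
  qed
  moreover have "tr (pc N w (b, k)) = tr (Mb N w b ^\<^sub>m k) - tb N b k * of_nat N"
    unfolding pc_def using assms by (simp add: tr_minus[of _ N] tr_smult[of _ N] tr_one)
  ultimately show ?thesis by simp
qed

lemma tr_vproj: "N \<ge> 1 \<Longrightarrow> tr (vproj N (v N)) = 1"
  using quadratic_form_eq_tr[of "1\<^sub>m N" N "v N"] v_unit[of N] by (simp add: left_mult_one_mat[of _ N N])

lemma tr_mult_scaled_one: "X \<in> carrier_mat N N \<Longrightarrow> tr (X * ((1 / of_nat N) \<cdot>\<^sub>m 1\<^sub>m N)) = tr X / of_nat N"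
  by (simp add: mult_smult_distrib[of _ N N _ N] right_mult_one_mat[of _ N N] tr_smult[of _ N])

sublocale ts: state_limits M rc A B v U mA mv mB "\<lambda>N. (1 / of_nat N) \<cdot>\<^sub>m 1\<^sub>m N" mt
proof
  show "ae_conv (\<lambda>N w. tr (pprod N w ps * ((1 / of_nat N) \<cdot>\<^sub>m 1\<^sub>m N))) 0"
    if "successively (\<noteq>) (map fst ps)" "length ps \<ge> 2" for ps
    using AE_trace_alternating[OF that, folded ae_conv_def] by (rule ae_conv_cong) (simp add: tr_mult_scaled_one)
  show "ae_conv (\<lambda>N w. tr (Mb N w b ^\<^sub>m k * ((1 / of_nat N) \<cdot>\<^sub>m 1\<^sub>m N))) (mt b k)" for b k
  proof (rule ae_conv_cong)
    show "ae_conv (\<lambda>N w. tb N b k) (mt b k)" unfolding ae_conv_def using tb_conv by simp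
    show "tb N b k = tr (Mb N w b ^\<^sub>m k * ((1 / of_nat N) \<cdot>\<^sub>m 1\<^sub>m N))" if "N \<ge> 1" "w \<in> space M" for N w
      using that by (simp add: tr_mult_scaled_one tr_Mb_pow)
  qed
qed simp

lemma mB_0: "mB 0 = 1"
proof (rule LIMSEQ_unique[OF B_conv])
  have "\<forall>\<^sub>F N in sequentially. 1 = emp_moment N (B N) 0"
    using eventually_ge_at_top[of 1]
  proof eventually_elim
    case (elim N)
    then show ?case using carrier_matD(1)[OF B_carrier[OF elim]] by (simp add: emp_moment_def tr_one)
  qed
  then show "(\<lambda>N. emp_moment N (B N) 0) \<longlonglongrightarrow> 1" by (rule Lim_transform_eventually[OF tendsto_const])
qed

text \<open>For \<open>b = True\<close> the limit is the trace moment \<open>mB k\<close>: the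
  rotation erases any relation between \<open>B N\<close> and \<open>v N\<close>. This makes \<phi>
  and \<tau> agree on polynomials in \<open>Y\<close>.\<close>

sublocale ps: state_limits M rc A B v U mA mv mB "\<lambda>N. vproj N (v N)" "\<lambda>b k. if b then mB k else mv k"
proof
  have mixed: "True \<in> set xs" if "successively (\<noteq>) xs" "length xs \<ge> 2" for xs :: "bool list"
    using that by (cases xs; cases "tl xs") auto
  show "ae_conv (\<lambda>N w. tr (pprod N w ps * vproj N (v N))) 0"
    if "successively (\<noteq>) (map fst ps)" "length ps \<ge> 2" "\<forall>p\<in>set ps. snd p \<ge> 1" for ps
    unfolding ae_conv_def using that(1,3) mixed[OF that(1)] that(2) by (intro AE_vector_alternating) auto
  show "ae_conv (\<lambda>N w. tr (Mb N w b ^\<^sub>m k * vproj N (v N))) (if b then mB k else mv k)" for b k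
  proof (cases b)
    case False
    have "ae_conv (\<lambda>N w. vec_moment N (A N) (v N) k) (mv k)" unfolding ae_conv_def using v_conv by simp
    then show ?thesis unfolding if_not_P[OF False]
      by (rule ae_conv_cong) (simp add: False Mb_def vec_moment_def quadratic_form_eq_tr[of _ N "v N" for N])
  next
    case True
    show ?thesis
    proof (cases "k = 0")
      case k: True
      have "ae_conv (\<lambda>N w. 1) 1" by (simp add: ae_conv_def)
      then show ?thesis unfolding if_P[OF True] k mB_0
      proof (rule ae_conv_cong)
        fix N :: nat and w assume N: "N \<ge> 1" "w \<in> space M"
        then show "1 = tr (Mb N w b ^\<^sub>m 0 * vproj N (v N))"
          using carrier_matD(1)[OF Mb_carrier[OF N, of b]] by (simp add: left_mult_one_mat[of _ N N] tr_vproj)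
      qed
    next
      case k: False
      \<comment> \<open>The vector estimate already covers a single centered power of the rotated
        matrix, which leaves only its centering constant.\<close>
      have "AE w in M. (\<lambda>N. tr (pprod N w [(True, k)] * vproj N (v N))) \<longlonglongrightarrow> 0"
        using k by (intro AE_vector_alternating) auto
      then have "ae_conv (\<lambda>N w. tr (pprod N w [(True, k)] * vproj N (v N)) + tb N True k * 1) (0 + mt True k * 1)"
        by (intro ae_conv_add ae_conv_mult tb_conv) (simp_all add: ae_conv_def)
      then have "ae_conv (\<lambda>N w. tr (pprod N w [(True, k)] * vproj N (v N)) + tb N True k * 1) (mB k)"
        by (simp add: mt_def)
      then show ?thesis unfolding if_P[OF True]
      proof (rule ae_conv_cong)
        fix N :: nat and w assume N: "N \<ge> 1" "w \<in> space M"
        let ?m = "Mb N w True ^\<^sub>m k"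
        have m: "?m \<in> carrier_mat N N" by (rule pow_mat_carrier[OF Mb_carrier[OF N]])
        have "pprod N w [(True, k)] * vproj N (v N) = 1\<^sub>m N * ((?m - tb N True k \<cdot>\<^sub>m 1\<^sub>m N) * vproj N (v N))"
          using pc_carrier[OF N, of "(True, k)"] m
          by (simp add: pprod_simps pc_def right_mult_one_mat[of _ N N] left_mult_one_mat[of _ N N])
        then have "tr (pprod N w [(True, k)] * vproj N (v N)) = tr (?m * vproj N (v N)) - tb N True k * tr (vproj N (v N))"
          using m by (simp only: tr_mult_centered[OF one_carrier_mat m vproj_carrier])
            (simp add: left_mult_one_mat[of _ N N])
        then show "tr (pprod N w [(True, k)] * vproj N (v N)) + tb N True k * 1 = tr (Mb N w b ^\<^sub>m k * vproj N (v N))"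
          using True tr_vproj[OF N(1)] by simp
      qed
    qed
  qed
qed simp

definition \<tau> :: "ncpoly \<Rightarrow> complex" where "\<tau> = lin_ext ts.cw"

definition \<phi> :: "ncpoly \<Rightarrow> complex" where "\<phi> = lin_ext ps.cw"

lemma tau_trace:
  assumes "is_ncpoly P"
  shows "AE w in M. (\<lambda>N. tr (ne N w P) / of_nat N) \<longlonglongrightarrow> \<tau> P"
  using ae_conv_cong[OF ts.poly_limit[OF assms], of "\<lambda>N w. tr (ne N w P) / of_nat N"]
  by (simp add: tr_mult_scaled_one \<tau>_def ae_conv_def)

lemma phi_vector:
  assumes "is_ncpoly P"
  shows "AE w in M. (\<lambda>N. (ne N w P *\<^sub>v v N) \<bullet>c v N) \<longlonglongrightarrow> \<phi> P"
  using ae_conv_cong[OF ps.poly_limit[OF assms], of "\<lambda>N w. (ne N w P *\<^sub>v v N) \<bullet>c v N"]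
  by (simp add: quadratic_form_eq_tr[of _ N "v N" for N] \<phi>_def ae_conv_def)

lemma lin_ext_subalg:
  assumes "in_subalg b a" "\<And>k. c (replicate k b) = f k"
  shows "lin_ext c a = (\<Sum>u\<in>{u. a u \<noteq> 0}. a u * f (length u))"
  unfolding lin_ext_def
proof (intro sum.cong refl arg_cong2[where f = times])
  fix u assume "u \<in> {u. a u \<noteq> 0}"
  then have "u = replicate (length u) b" by (intro in_subalg_word[OF assms(1)]) simp
  from arg_cong[OF this, of c] show "c u = f (length u)" unfolding assms(2) .
qed

lemma tau_unital: "unital_linear_functional \<tau>"
  unfolding \<tau>_def
proof (rule unital_linear_functional_lin_ext)
  have "ts.cw [] = mt True 0" using ts.cw_replicate[of 0 True] by simp
  then show "ts.cw [] = 1" by (simp add: mt_def mB_0)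
qed

lemma phi_unital: "unital_linear_functional \<phi>"
  unfolding \<phi>_def
proof (rule unital_linear_functional_lin_ext)
  show "ps.cw [] = 1" using ps.cw_replicate[of 0 True] by (simp add: mB_0)
qed

lemma cond_free_tau_phi: "cond_free \<tau> \<phi>"
  unfolding cond_free_def
proof (intro allI impI, elim conjE)
  fix as :: "ncpoly list" and idx :: "bool list"
  assume len: "length as = length idx" "length as > 1"
    and sub: "\<forall>j<length as. in_subalg (idx ! j) (as ! j)"
    and alt: "\<forall>j. j + 1 < length idx \<longrightarrow> idx ! j \<noteq> idx ! (j + 1)"
    and zero: "\<forall>j<length as. \<tau> (as ! j) = 0"
  have tau: "\<tau> a = (\<Sum>u\<in>{u. a u \<noteq> 0}. a u * mt b (length u))" if "in_subalg b a" for a b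
    unfolding \<tau>_def by (rule lin_ext_subalg[where f = "mt b", OF that]) (rule ts.cw_replicate)
  have la: "list_all2 (\<lambda>a b. in_subalg b a \<and> (\<Sum>u\<in>{u. a u \<noteq> 0}. a u * mt b (length u)) = 0) as idx"
    unfolding list_all2_conv_all_nth
  proof (intro conjI allI impI)
    fix j assume j: "j < length as"
    show s: "in_subalg (idx ! j) (as ! j)" using sub j by blast
    show "(\<Sum>u\<in>{u. (as ! j) u \<noteq> 0}. (as ! j) u * mt (idx ! j) (length u)) = 0"
      unfolding tau[OF s, symmetric] using zero j by blast
  qed (rule len)
  have alt': "successively (\<noteq>) idx" using alt by (simp add: successively_conv_nth)
  have len2: "length idx \<ge> 2" using len by simp
  have "\<tau> (foldr nc_mult as nc_one) = 0" unfolding \<tau>_def by (rule ts.lin_ext_centered_product[OF la alt' len2])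
  moreover have "\<phi> (foldr nc_mult as nc_one) = 0" unfolding \<phi>_def by (rule ps.lin_ext_centered_product[OF la alt' len2])
  moreover have "prod_list (map \<phi> as) = 0"
  proof -
    \<comment> \<open>One of two neighbours is a polynomial in \<open>Y\<close>; there \<phi> equals
      \<tau>, so this factor of the product is 0.\<close>
    have "idx ! 0 \<noteq> idx ! 1" using alt[rule_format, of 0] len by simp
    then have "idx ! 0 \<or> idx ! 1" by simp
    then obtain j where j: "j < length as" "idx ! j"
    proof
      show thesis if "idx ! 0" using that \<open>\<And>j. j < length as \<Longrightarrow> idx ! j \<Longrightarrow> thesis\<close>[of 0] len by linarith
      show thesis if "idx ! 1" using that \<open>\<And>j. j < length as \<Longrightarrow> idx ! j \<Longrightarrow> thesis\<close>[of 1] len by linarith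
    qed
    have inT: "in_subalg True (as ! j)" using sub[rule_format, OF j(1)] j(2) by simp
    have "\<phi> (as ! j) = (\<Sum>u\<in>{u. (as ! j) u \<noteq> 0}. (as ! j) u * mt True (length u))"
      unfolding \<phi>_def
      by (rule lin_ext_subalg[where f = "mt True", OF inT]) (simp add: ps.cw_replicate mt_def)
    then have "\<phi> (as ! j) = 0" using tau[OF inT] zero j(1) by simp
    moreover have "\<phi> (as ! j) \<in> set (map \<phi> as)" using j(1) by simp
    ultimately show ?thesis by (simp add: prod_list_zero_iff)
  qed
  ultimately show "\<tau> (foldr nc_mult as nc_one) = 0 \<and> \<phi> (foldr nc_mult as nc_one) = prod_list (map \<phi> as)"
    by simp
qed

end

theorem theorem1p2:
  fixes real_case :: bool
    and A B :: "nat \<Rightarrow> complex mat"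
    and v :: "nat \<Rightarrow> complex vec"
    and \<mu>1 \<nu>1 \<mu>2 :: "real measure"
    and M :: "'w measure"
    and U :: "'w \<Rightarrow> nat \<Rightarrow> complex mat"
  assumes "\<And>N. N \<ge> 1 \<Longrightarrow> hermitian_mat N (A N) \<and> hermitian_mat N (B N) \<and> unit_vec N (v N)"
    and "real_case \<Longrightarrow> (\<forall>N\<ge>1. real_mat (A N) \<and> real_mat (B N) \<and> real_vec (v N))"
    and "real_prob_measure \<mu>1" "real_prob_measure \<nu>1" "real_prob_measure \<mu>2"
    and "moment_conv (\<lambda>N. emp_moment N (A N)) \<mu>1"
    and "moment_conv (\<lambda>N. vec_moment N (A N) (v N)) \<nu>1"
    and "moment_conv (\<lambda>N. emp_moment N (B N)) \<mu>2"
    and "prob_space M"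
    and "\<And>N. N \<ge> 1 \<Longrightarrow> haar_random real_case M N (\<lambda>w. U w N)"
  shows "\<exists>\<tau> \<phi>. unital_linear_functional \<tau> \<and> unital_linear_functional \<phi> \<and>
    (\<forall>P. is_ncpoly P \<longrightarrow> (AE w in M.
       (\<lambda>N. tr (nc_eval N (A N) (U w N * B N * adj (U w N)) P) / of_nat N) \<longlonglongrightarrow> \<tau> P)) \<and>
    (\<forall>P. is_ncpoly P \<longrightarrow> (AE w in M.
       (\<lambda>N. (nc_eval N (A N) (U w N * B N * adj (U w N)) P *\<^sub>v v N) \<bullet>c v N) \<longlonglongrightarrow> \<phi> P)) \<and>
    cond_free \<tau> \<phi>"
proof -
  interpret prob_space M by (rule assms)
  interpret rotated_ensemble M real_case A B v U
    "\<lambda>k. complex_of_real (\<integral>x. x ^ k \<partial>\<mu>1)" "\<lambda>k. complex_of_real (\<integral>x. x ^ k \<partial>\<nu>1)" "\<lambda>k. complex_of_real (\<integral>x. x ^ k \<partial>\<mu>2)"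
    by unfold_locales (use assms in \<open>auto simp: moment_conv_def\<close>)
  show ?thesis
    using tau_unital phi_unital tau_trace phi_vector cond_free_tau_phi by blast
qed

end
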